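(* Let $K$ be a number field of degree $d$, and let $S$, $K_S$, $\tau$, $\mathcal{O}_K$ be as in the context. Let $\phi=(\phi_\sigma)_{\sigma\in S}:[0,1]\to K_S$ be a continuously differentiable map. Assume that for all but finitely many $x\in[0,1]$ there is a subset $S'\subset S$ (possibly depending on $x$) such that $\phi'_\sigma(x)\neq 0$ for all $\sigma\in S'$ and $$|\{\sigma\in S':\sigma\text{ is real}\}|+2\,|\{\sigma\in S':\sigma\text{ is complex}\}|>\left\lfloor \tfrac d2\right\rfloor .$$ For $x\in[0,1]$ define $$\Phi(x):=\left(\begin{pmatrix}1&\phi_\sigma(x)\\0&1\end{pmatrix}\right)_{\sigma\in S}\in \mathrm{SL}_2(K_S),$$ and for $t\ge 0$ let $$g_t:=\left(\begin{pmatrix}e^{-t}&0\\0&e^{t}\end{pmatrix}\right)_{\sigma\in S}\in\mathrm{SL}_2(K_S)$$ act on $\mathrm{SL}_2(\mathcal{O}_K)\backslash \mathrm{SL}_2(K_S)$ by right multiplication. Let $g\in \mathrm{SL}_2(K_S)$ and $\Lambda=\mathrm{SL}_2(\mathcal{O}_K)g\in \mathrm{SL}_2(\mathcal{O}_K)\backslash \mathrm{SL}_2(K_S)$. Then the set $$\{x\in[0,1] : \Lambda\Phi(x)\text{ has bounded trajectory under the flow } g_t\}$$ is winning in the sense of Schmidt (as a subset of $[0,1]$), and hence has Hausdorff dimension $1$.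
   Context: Number field notation. $K$ is a number field of degree $d$ over $\mathbb{Q}$ with $r$ real embeddings and $s$ pairs of complex conjugate embeddings (so $d=r+2s$), and $\mathcal{O}_K$ is its ring of integers. $S$ denotes the set of field embeddings $\sigma$ of $K$ into $\mathbb{R}$ or $\mathbb{C}$, where from each complex conjugate pair $\sigma,\bar\sigma$ exactly one is chosen; thus $|S|=r+s$. $K_S:=\mathbb{R}^r\times\mathbb{C}^s$, with coordinates indexed by $S$ (real coordinates for real $\sigma$, complex coordinates for complex $\sigma$). $\tau:K\to K_S$, $\tau(x)=(\sigma(x))_{\sigma\in S}$, is extended entrywise to vectors and matrices. $\mathrm{SL}_2(K_S)=\prod_{\sigma\text{ real}}\mathrm{SL}_2(\mathbb{R})\times\prod_{\sigma\text{ complex}}\mathrm{SL}_2(\mathbb{C})$, and $\mathrm{SL}_2(\mathcal{O}_K)$ is regarded as a subgroup of it via $\tau$. Bounded trajectory. A point $y\in \mathrm{SL}_2(\mathcal{O}_K)\backslash \mathrm{SL}_2(K_S)$ has bounded trajectory under $g_t$ if $\{y g_t : t\ge 0\}$ is relatively compact in $\mathrm{SL}_2(\mathcal{O}_K)\backslash \mathrm{SL}_2(K_S)$. Schmidt's game. Let $X$ be a complete metric space (here $X=[0,1]$ with the usual metric), $W\subseteq X$, and $0<\alpha,\beta<1$. Balls are closed balls $B(x,\rho)$ with specified center and radius. Player A first chooses an arbitrary ball $A_0=B(x_0,\rho)$; Player B chooses a ball $B_0=B(y_0,\alpha\rho)\subset A_0$. In general, at step $n$ Player A chooses a ball $A_n=B(x_n,(\alpha\beta)^n\rho)\subset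 B_{n-1}$ and then Player B chooses a ball $B_n=B(y_n,\alpha(\alpha\beta)^n\rho)\subset A_n$. The intersection $\bigcap_n A_n$ is a single point $x_\infty$; Player B wins if $x_\infty\in W$. $W$ is $(\alpha,\beta)$-winning if Player B has a winning strategy, $\alpha$-winning if it is $(\alpha,\beta)$-winning for all $0<\beta<1$, and winning (in the sense of Schmidt) if it is $\alpha$-winning for some $\alpha>0$. *)

theory Defs
  imports "HOL-Analysis.Analysis" "HOL-Algebra.Product_Groups"
begin

section \<open>Number fields and their embeddings\<close>

interpretation rat_vs: vector_space "\<lambda>(q::rat) (x::'k::field_char_0). of_rat q * x"
  by unfold_locales (simp_all add: algebra_simps of_rat_add of_rat_mult)

definition number_field :: "'k::field_char_0 itself \<Rightarrow> bool" where
  "number_field _ \<longleftrightarrow> (\<exists>B::'k set. finite B \<and> rat_vs.span B = UNIV)"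

definition number_field_degree :: "'k::field_char_0 itself \<Rightarrow> nat" where
  "number_field_degree _ = rat_vs.dim (UNIV :: 'k set)"

definition ring_of_integers :: "'k::field_char_0 set" where
  "ring_of_integers = {x. algebraic_int x}"

definition field_embedding :: "('k::field_char_0 \<Rightarrow> complex) \<Rightarrow> bool" where
  "field_embedding \<sigma> \<longleftrightarrow> \<sigma> 1 = 1 \<and> (\<forall>x y. \<sigma> (x + y) = \<sigma> x + \<sigma> y) \<and> (\<forall>x y. \<sigma> (x * y) = \<sigma> x * \<sigma> y)"

definition real_valued :: "('k \<Rightarrow> complex) \<Rightarrow> bool" where
  "real_valued \<sigma> \<longleftrightarrow> range \<sigma> \<subseteq> \<real>"

text \<open>All real embeddings, and exactly one from each pair of complex conjugate embeddings.\<close>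

definition embedding_system :: "('k::field_char_0 \<Rightarrow> complex) set \<Rightarrow> bool" where
  "embedding_system S \<longleftrightarrow>
     (\<forall>\<sigma>\<in>S. field_embedding \<sigma>) \<and>
     (\<forall>\<sigma>. field_embedding \<sigma> \<and> real_valued \<sigma> \<longrightarrow> \<sigma> \<in> S) \<and>
     (\<forall>\<sigma>. field_embedding \<sigma> \<and> \<not> real_valued \<sigma> \<longrightarrow> (\<sigma> \<in> S \<longleftrightarrow> cnj \<circ> \<sigma> \<notin> S))"

text \<open>The completion at a real embedding is the set of reals inside the complex numbers, so that
  all coordinates live in one type.\<close>

definition coord_field :: "('k \<Rightarrow> complex) \<Rightarrow> complex set" where
  "coord_field \<sigma> = (if real_valued \<sigma> then \<real> else UNIV)"

definition K_S :: "('k \<Rightarrow> complex) set \<Rightarrow> (('k \<Rightarrow> complex) \<Rightarrow> complex) set" where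
  "K_S S = (\<Pi>\<^sub>E \<sigma>\<in>S. coord_field \<sigma>)"

definition tau :: "('k \<Rightarrow> complex) set \<Rightarrow> 'k \<Rightarrow> (('k \<Rightarrow> complex) \<Rightarrow> complex)" where
  "tau S x = (\<lambda>\<sigma>\<in>S. \<sigma> x)"


section \<open>The homogeneous space\<close>

definition SL2 :: "'a::comm_ring_1 set \<Rightarrow> ('a^2^2) monoid" where
  "SL2 R = \<lparr>carrier = {A. det A = 1 \<and> (\<forall>i j. A $ i $ j \<in> R)}, mult = (**), one = mat 1\<rparr>"

definition SL2_KS :: "('k \<Rightarrow> complex) set \<Rightarrow> (('k \<Rightarrow> complex) \<Rightarrow> complex^2^2) monoid" where
  "SL2_KS S = product_group S (\<lambda>\<sigma>. SL2 (coord_field \<sigma>))"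

definition SL2_KS_topology :: "('k \<Rightarrow> complex) set \<Rightarrow> (('k \<Rightarrow> complex) \<Rightarrow> complex^2^2) topology" where
  "SL2_KS_topology S = product_topology (\<lambda>\<sigma>. top_of_set (carrier (SL2 (coord_field \<sigma>)))) S"

definition tau_matrix :: "('k \<Rightarrow> complex) set \<Rightarrow> 'k^2^2 \<Rightarrow> (('k \<Rightarrow> complex) \<Rightarrow> complex^2^2)" where
  "tau_matrix S A = (\<lambda>\<sigma>\<in>S. \<chi> i j. tau S (A $ i $ j) \<sigma>)"

definition SL2_OK :: "('k::field_char_0 \<Rightarrow> complex) set \<Rightarrow> (('k \<Rightarrow> complex) \<Rightarrow> complex^2^2) set" where
  "SL2_OK S = tau_matrix S ` carrier (SL2 ring_of_integers)"

definition quotient_topology :: "'a topology \<Rightarrow> ('a \<Rightarrow> 'b) \<Rightarrow> 'b topology" where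
  "quotient_topology X q =
     topology (\<lambda>U. U \<subseteq> q ` topspace X \<and> openin X {x \<in> topspace X. q x \<in> U})"

lemma openin_quotient_topology:
  "openin (quotient_topology X q) U \<longleftrightarrow>
     U \<subseteq> q ` topspace X \<and> openin X {x \<in> topspace X. q x \<in> U}"
proof -
  have "istopology (\<lambda>U. U \<subseteq> q ` topspace X \<and> openin X {x \<in> topspace X. q x \<in> U})"
  proof (unfold istopology_def, intro conjI allI impI)
    fix U V
    assume "U \<subseteq> q ` topspace X \<and> openin X {x \<in> topspace X. q x \<in> U}"
       and "V \<subseteq> q ` topspace X \<and> openin X {x \<in> topspace X. q x \<in> V}"
    moreover have "{x \<in> topspace X. q x \<in> U \<inter> V} =
        {x \<in> topspace X. q x \<in> U} \<inter> {x \<in> topspace X. q x \<in> V}" by blast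
    ultimately show "U \<inter> V \<subseteq> q ` topspace X" "openin X {x \<in> topspace X. q x \<in> U \<inter> V}"
      by (auto intro: openin_Int)
  next
    fix \<U>
    assume *: "\<forall>U\<in>\<U>. U \<subseteq> q ` topspace X \<and> openin X {x \<in> topspace X. q x \<in> U}"
    have "{x \<in> topspace X. q x \<in> \<Union>\<U>} = (\<Union>U\<in>\<U>. {x \<in> topspace X. q x \<in> U})" by blast
    then show "openin X {x \<in> topspace X. q x \<in> \<Union>\<U>}" using * by auto
    show "\<Union>\<U> \<subseteq> q ` topspace X" using * by blast
  qed
  then show ?thesis by (simp add: quotient_topology_def)
qed

lemma topspace_quotient_topology: "topspace (quotient_topology X q) = q ` topspace X"
proof (rule antisym)
  have "openin (quotient_topology X q) (topspace (quotient_topology X q))"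
    by (rule openin_topspace)
  then show "topspace (quotient_topology X q) \<subseteq> q ` topspace X"
    unfolding openin_quotient_topology by (rule conjunct1)
  have "{x \<in> topspace X. q x \<in> q ` topspace X} = topspace X" by auto
  then have "openin (quotient_topology X q) (q ` topspace X)"
    unfolding openin_quotient_topology by simp
  then show "q ` topspace X \<subseteq> topspace (quotient_topology X q)"
    by (rule openin_subset)
qed

lemma quotient_map_quotient_topology: "quotient_map X (quotient_topology X q) q"
  unfolding quotient_map_def topspace_quotient_topology openin_quotient_topology by simp

text \<open>Points are the right cosets \<open>SL2_OK S #> g\<close>; the group acts on them by
  \<open>(SL2_OK S #> g) #> h = SL2_OK S #> (g \<otimes> h)\<close>.\<close>

definition homogeneous_space ::
    "('k::field_char_0 \<Rightarrow> complex) set \<Rightarrow> (('k \<Rightarrow> complex) \<Rightarrow> complex^2^2) set topology" where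
  "homogeneous_space S =
     quotient_topology (SL2_KS_topology S) (\<lambda>g. SL2_OK S #>\<^bsub>SL2_KS S\<^esub> g)"

definition flow :: "('k \<Rightarrow> complex) set \<Rightarrow> real \<Rightarrow> (('k \<Rightarrow> complex) \<Rightarrow> complex^2^2)" where
  "flow S t = (\<lambda>\<sigma>\<in>S. vector [vector [complex_of_real (exp (- t)), 0],
                            vector [0, complex_of_real (exp t)]])"

definition unipotent ::
    "('k \<Rightarrow> complex) set \<Rightarrow> (('k \<Rightarrow> complex) \<Rightarrow> complex) \<Rightarrow> (('k \<Rightarrow> complex) \<Rightarrow> complex^2^2)" where
  "unipotent S v = (\<lambda>\<sigma>\<in>S. vector [vector [1, v \<sigma>], vector [0, 1]])"

definition bounded_trajectory ::
    "('k::field_char_0 \<Rightarrow> complex) set \<Rightarrow> (('k \<Rightarrow> complex) \<Rightarrow> complex^2^2) set \<Rightarrow> bool" where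
  "bounded_trajectory S y \<longleftrightarrow>
     compactin (homogeneous_space S)
       (homogeneous_space S closure_of {y #>\<^bsub>SL2_KS S\<^esub> flow S t | t. t \<ge> 0})"


section \<open>Continuously differentiable maps on the unit interval\<close>

text \<open>Derivatives are taken within the closed interval, hence one-sided at the endpoints.\<close>

definition coord_deriv :: "(real \<Rightarrow> 'i \<Rightarrow> complex) \<Rightarrow> 'i \<Rightarrow> real \<Rightarrow> complex" where
  "coord_deriv \<phi> \<sigma> x = vector_derivative (\<lambda>u. \<phi> u \<sigma>) (at x within {0..1})"

definition C1_map :: "('k \<Rightarrow> complex) set \<Rightarrow> (real \<Rightarrow> ('k \<Rightarrow> complex) \<Rightarrow> complex) \<Rightarrow> bool" where
  "C1_map S \<phi> \<longleftrightarrow>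
     \<phi> \<in> {0..1} \<rightarrow> K_S S \<and>
     (\<forall>\<sigma>\<in>S. (\<lambda>u. \<phi> u \<sigma>) differentiable_on {0..1} \<and> continuous_on {0..1} (coord_deriv \<phi> \<sigma>))"


section \<open>Schmidt's game\<close>

text \<open>The ambient space \<open>X\<close> is a subset of a metric space, with the induced metric. A play
  consists of the initial radius \<open>\<rho>\<close>, the centres \<open>x n\<close> chosen by Player A and the centres
  \<open>y n\<close> chosen by Player B; the other radii are forced.\<close>

definition A_ball :: "'a::metric_space set \<Rightarrow> real \<Rightarrow> real \<Rightarrow> real \<Rightarrow> (nat \<Rightarrow> 'a) \<Rightarrow> nat \<Rightarrow> 'a set" where
  "A_ball X \<alpha> \<beta> \<rho> x n = X \<inter> cball (x n) ((\<alpha> * \<beta>) ^ n * \<rho>)"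

definition B_ball :: "'a::metric_space set \<Rightarrow> real \<Rightarrow> real \<Rightarrow> real \<Rightarrow> (nat \<Rightarrow> 'a) \<Rightarrow> nat \<Rightarrow> 'a set" where
  "B_ball X \<alpha> \<beta> \<rho> y n = X \<inter> cball (y n) (\<alpha> * (\<alpha> * \<beta>) ^ n * \<rho>)"

definition A_legal :: "'a::metric_space set \<Rightarrow> real \<Rightarrow> real \<Rightarrow> real \<Rightarrow> (nat \<Rightarrow> 'a) \<Rightarrow> (nat \<Rightarrow> 'a) \<Rightarrow> nat \<Rightarrow> bool" where
  "A_legal X \<alpha> \<beta> \<rho> x y n \<longleftrightarrow>
     x n \<in> X \<and> (\<forall>m. n = Suc m \<longrightarrow> A_ball X \<alpha> \<beta> \<rho> x n \<subseteq> B_ball X \<alpha> \<beta> \<rho> y m)"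

definition B_legal :: "'a::metric_space set \<Rightarrow> real \<Rightarrow> real \<Rightarrow> real \<Rightarrow> (nat \<Rightarrow> 'a) \<Rightarrow> (nat \<Rightarrow> 'a) \<Rightarrow> nat \<Rightarrow> bool" where
  "B_legal X \<alpha> \<beta> \<rho> x y n \<longleftrightarrow> y n \<in> X \<and> B_ball X \<alpha> \<beta> \<rho> y n \<subseteq> A_ball X \<alpha> \<beta> \<rho> x n"

text \<open>A strategy \<open>f\<close> for Player B computes the next centre from Player A's moves so far, namely
  \<open>\<rho>\<close> and the list of A's centres (B's own earlier moves being determined by these). It must
  answer legally as long as A has played legally, and it must win every play in which A always
  plays legally.\<close>

definition B_winning_strategy ::
    "'a::metric_space set \<Rightarrow> 'a set \<Rightarrow> real \<Rightarrow> real \<Rightarrow> (real \<Rightarrow> 'a list \<Rightarrow> 'a) \<Rightarrow> bool" where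
  "B_winning_strategy X W \<alpha> \<beta> f \<longleftrightarrow>
     (\<forall>\<rho> x y. \<rho> > 0 \<and> (\<forall>n. y n = f \<rho> (map x [0..<Suc n])) \<longrightarrow>
        (\<forall>n. (\<forall>m\<le>n. A_legal X \<alpha> \<beta> \<rho> x y m) \<longrightarrow> B_legal X \<alpha> \<beta> \<rho> x y n) \<and>
        ((\<forall>n. A_legal X \<alpha> \<beta> \<rho> x y n) \<longrightarrow> (\<exists>p\<in>W. (\<Inter>n. A_ball X \<alpha> \<beta> \<rho> x n) = {p})))"

definition alpha_beta_winning :: "'a::metric_space set \<Rightarrow> real \<Rightarrow> real \<Rightarrow> 'a set \<Rightarrow> bool" where
  "alpha_beta_winning X \<alpha> \<beta> W \<longleftrightarrow> W \<subseteq> X \<and> (\<exists>f. B_winning_strategy X W \<alpha> \<beta> f)"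

definition alpha_winning :: "'a::metric_space set \<Rightarrow> real \<Rightarrow> 'a set \<Rightarrow> bool" where
  "alpha_winning X \<alpha> W \<longleftrightarrow> (\<forall>\<beta>. 0 < \<beta> \<and> \<beta> < 1 \<longrightarrow> alpha_beta_winning X \<alpha> \<beta> W)"

definition schmidt_winning :: "'a::metric_space set \<Rightarrow> 'a set \<Rightarrow> bool" where
  "schmidt_winning X W \<longleftrightarrow> (\<exists>\<alpha>. 0 < \<alpha> \<and> \<alpha> < 1 \<and> alpha_winning X \<alpha> W)"


section \<open>Hausdorff dimension\<close>

text \<open>Covering sets must be bounded, since \<^const>\<open>diameter\<close> is meaningless otherwise.\<close>

definition hausdorff_premeasure :: "real \<Rightarrow> real \<Rightarrow> 'a::metric_space set \<Rightarrow> ennreal" where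
  "hausdorff_premeasure \<delta> s E =
     (INF U \<in> {U :: nat \<Rightarrow> 'a set. E \<subseteq> (\<Union>i. U i) \<and> (\<forall>i. bounded (U i) \<and> diameter (U i) \<le> \<delta>)}.
        (\<Sum>i. ennreal (diameter (U i) powr s)))"

definition hausdorff_measure :: "real \<Rightarrow> 'a::metric_space set \<Rightarrow> ennreal" where
  "hausdorff_measure s E = (SUP \<delta>\<in>{0<..}. hausdorff_premeasure \<delta> s E)"

text \<open>The exponent \<open>0\<close>, where \<open>0 powr 0 = 0\<close> would give the wrong measure, can be left out
  without changing the infimum.\<close>

definition hausdorff_dimension :: "'a::metric_space set \<Rightarrow> ennreal" where
  "hausdorff_dimension E = (INF s \<in> {s. s > 0 \<and> hausdorff_measure s E = 0}. ennreal s)"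

end

theory Submission
  imports Defs "HOL-Algebra.Algebraic_Closure_Type" "Jordan_Normal_Form.Char_Poly"
begin

text \<open>
  The orbit of \<open>\<Lambda> \<Phi>(x)\<close> is described by the vectors \<open>u\<close> of the module \<open>O\<^sub>K\<^sup>2\<close>: at time \<open>t\<close> their
  images have coordinates \<open>(e\<^sup>-\<^sup>t a\<^sub>\<sigma>, e\<^sup>t (a\<^sub>\<sigma> \<phi>\<^sub>\<sigma>(x) + b\<^sub>\<sigma>))\<close>, where \<open>(a, b) = u g\<close>. By a Mahler-type
  criterion the orbit is bounded once the weighted product over \<open>\<sigma>\<close> of the sizes of these vectors,
  which is insensitive to units, stays away from zero, uniformly in \<open>u \<noteq> 0\<close> and \<open>t \<ge> 0\<close>.

  The determinant of two vectors of \<open>O\<^sub>K\<^sup>2\<close> is an algebraic integer, so if it is nonzero its norm is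
  at least one. Hence all vectors whose product is small at time \<open>t\<close> somewhere on an interval of
  length \<open>e\<^sup>-\<^sup>2\<^sup>t\<close> lie on one \<open>K\<close>-line. For each \<open>\<sigma>\<close> this line singles out the point of the interval
  where \<open>a\<^sub>\<sigma> \<phi>\<^sub>\<sigma> + b\<^sub>\<sigma>\<close> is smallest. Player B avoids these points at every stage, together with
  the finitely many exceptional points. From then on the line expands at every \<open>\<sigma>\<close> with
  \<open>\<phi>'\<^sub>\<sigma>(x) \<noteq> 0\<close>, and since such \<open>\<sigma>\<close> make up more than half of the degree, the product never
  becomes much smaller again.

  For the dimension, Player A plays against a cover of the winning set, moving each time into one of
  many disjoint balls that meets little of the cover.
\<close>

text \<open>One dangerous line per ball means that Player B has to avoid at most one point per
  embedding besides the exceptional points. This number depends neither on the stage nor on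
  \<open>\<beta>\<close>, so one \<open>\<alpha>\<close> serves every \<open>\<beta>\<close>. The
  obstacle is that the set \<open>S'\<close> belongs to the outcome of the play, which is unknown
  while B moves: B therefore avoids the points of all embeddings, and \<open>S'\<close>, the
  expansion constants and the final lower bound are extracted only afterwards, from the outcome. The
  criterion for boundedness is obtained by counting. A box of size \<open>R\<close> contains, after
  translation, of order \<open>R ^ (2 * d)\<close> integral vectors, while a single
  \<open>K\<close>-line on which the product is bounded below has at most of order
  \<open>R ^ d\<close> of them there; hence for large \<open>R\<close> two independent short vectors
  exist at every time. They form an integral matrix of bounded determinant, and such matrices fall
  into finitely many classes modulo \<open>SL\<^sub>2\<close> of the integers, which yields bounded
  representatives of the orbit points.\<close>

hide_const (open) Polynomials.lead_coeff Polynomials.degree up_ring.coeff up_ring.monom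
  Determinant.det Matrix.mat Matrix.vec
no_notation vec_index (infixl "$" 100)
no_notation fps_nth (infixl "$" 75)

section \<open>Algebraic integers\<close>

text \<open>The elements of \<open>B\<close> form an eigenvector, with eigenvalue \<open>x\<close>,
  of the integer matrix \<open>c\<close>, whose characteristic polynomial is monic with integer
  coefficients.\<close>

lemma algebraic_int_eigenvalue:
  fixes x :: "'a::field_char_0" and B :: "'a set"
  assumes fin: "finite B" and nz: "b0 \<in> B" "b0 \<noteq> 0"
    and c: "\<And>b. b \<in> B \<Longrightarrow> x * b = (\<Sum>b'\<in>B. of_int (c b b') * b')"
  shows "algebraic_int x"
proof -
  obtain h where h: "bij_betw h {0..<card B} B"
    using fin ex_bij_betw_nat_finite by blast
  define n where "n = card B"
  define A where "A = Matrix.mat n n (\<lambda>(i,j). c (h i) (h j))"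
  define v where "v = Matrix.vec n h"
  have hB: "h i \<in> B" if "i < n" for i
    using h that by (auto simp: bij_betw_def n_def)
  have A: "A \<in> carrier_mat n n" by (simp add: A_def)
  have "map_mat of_int A *\<^sub>v v = x \<cdot>\<^sub>v v"
  proof (rule eq_vecI)
    fix i assume i: "i < dim_vec (x \<cdot>\<^sub>v v)"
    then have i: "i < n" by (simp add: v_def)
    have "(\<Sum>j = 0..<n. of_int (c (h i) (h j)) * h j) = (\<Sum>b'\<in>B. of_int (c (h i) b') * b')"
      using sum.reindex_bij_betw[OF h, of "\<lambda>b'. of_int (c (h i) b') * b'"] by (simp add: n_def)
    also have "\<dots> = x * h i" using c[OF hB[OF i]] by simp
    finally show "vec_index (map_mat of_int A *\<^sub>v v) i = vec_index (x \<cdot>\<^sub>v v) i"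
      using i A by (simp add: v_def A_def scalar_prod_def)
  qed (simp add: v_def A_def)
  moreover have "v \<noteq> 0\<^sub>v n"
  proof -
    have "b0 \<in> h ` {0..<n}" using h nz by (auto simp: bij_betw_def n_def)
    then obtain i where "i < n" "h i = b0" by auto
    then have "vec_index v i \<noteq> vec_index (0\<^sub>v n) i" using nz by (simp add: v_def)
    then show ?thesis by metis
  qed
  ultimately have "eigenvalue (map_mat of_int A) x"
    unfolding eigenvalue_def eigenvector_def by (intro exI[of _ v]) (auto simp: v_def A_def)
  then have "poly (char_poly (map_mat of_int A)) x = 0"
    using eigenvalue_root_char_poly[of "map_mat of_int A" n x] A by auto
  then have "poly (map_poly of_int (char_poly A)) x = 0"
    using of_int_hom.char_poly_hom[OF A, where 'a='a] by simp
  moreover have "lead_coeff (char_poly A) = 1"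
    using degree_monic_char_poly[OF A] by simp
  ultimately show ?thesis unfolding algebraic_int_altdef_ipoly by blast
qed

definition int_span :: "'a::comm_ring_1 set \<Rightarrow> 'a set" where
  "int_span B = range (\<lambda>c. \<Sum>b\<in>B. of_int (c b) * b)"

lemma int_span_add: "x \<in> int_span B \<Longrightarrow> y \<in> int_span B \<Longrightarrow> x + y \<in> int_span B"
proof -
  assume "x \<in> int_span B" "y \<in> int_span B"
  then obtain c e where "x = (\<Sum>b\<in>B. of_int (c b) * b)" "y = (\<Sum>b\<in>B. of_int (e b) * b)"
    by (auto simp: int_span_def)
  then have "x + y = (\<Sum>b\<in>B. of_int (c b + e b) * b)"
    by (simp add: sum.distrib algebra_simps)
  then show ?thesis unfolding int_span_def by (rule range_eqI[of _ _ "\<lambda>b. c b + e b"])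
qed

lemma int_span_scale: "x \<in> int_span B \<Longrightarrow> of_int k * x \<in> int_span B"
proof -
  assume "x \<in> int_span B"
  then obtain c where "x = (\<Sum>b\<in>B. of_int (c b) * b)" by (auto simp: int_span_def)
  then have "of_int k * x = (\<Sum>b\<in>B. of_int (k * c b) * b)"
    by (simp add: sum_distrib_left algebra_simps)
  then show ?thesis unfolding int_span_def by (rule range_eqI[of _ _ "\<lambda>b. k * c b"])
qed

lemma int_span_zero: "0 \<in> int_span B"
  unfolding int_span_def by (rule range_eqI[of _ _ "\<lambda>_. 0"]) simp

lemma int_span_sum: "(\<And>i. i \<in> I \<Longrightarrow> f i \<in> int_span B) \<Longrightarrow> sum f I \<in> int_span B"
  by (induction I rule: infinite_finite_induct) (auto simp: int_span_zero int_span_add)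

lemma int_span_base: "finite B \<Longrightarrow> b \<in> B \<Longrightarrow> b \<in> int_span B"
proof -
  assume "finite B" "b \<in> B"
  then have "b = (\<Sum>b'\<in>B. of_int (if b' = b then 1 else 0) * b')"
    by (simp add: if_distrib[of of_int] if_distrib[of "\<lambda>x. x * _"] cong: if_cong)
  then show ?thesis
    unfolding int_span_def by (rule range_eqI[of _ _ "\<lambda>b'. if b' = b then 1 else 0"])
qed

lemma int_span_stable:
  assumes "\<And>b. b \<in> B \<Longrightarrow> x * b \<in> int_span B" and "z \<in> int_span B"
  shows "x * z \<in> int_span B"
proof -
  obtain c where c: "z = (\<Sum>b\<in>B. of_int (c b) * b)" using assms(2) by (auto simp: int_span_def)
  then have "x * z = (\<Sum>b\<in>B. of_int (c b) * (x * b))"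
    by (simp add: sum_distrib_left algebra_simps)
  also have "\<dots> \<in> int_span B" by (intro int_span_sum int_span_scale assms)
  finally show ?thesis .
qed

lemma algebraic_int_stable:
  fixes x :: "'a::field_char_0"
  assumes "finite B" "b0 \<in> B" "b0 \<noteq> 0" "\<And>b. b \<in> B \<Longrightarrow> x * b \<in> int_span B"
  shows "algebraic_int x"
proof -
  have "\<forall>b\<in>B. \<exists>c. x * b = (\<Sum>b'\<in>B. of_int (c b') * b')"
    using assms(4) unfolding int_span_def by blast
  then obtain c where "\<And>b. b \<in> B \<Longrightarrow> x * b = (\<Sum>b'\<in>B. of_int (c b b') * b')"
    by metis
  then show ?thesis using algebraic_int_eigenvalue assms(1-3) by blast
qed

lemma algebraic_int_power_reduce:
  fixes x :: "'a::field_char_0"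
  assumes "algebraic_int x"
  obtains m and a :: "nat \<Rightarrow> int" where "m > 0" "x ^ m = (\<Sum>i<m. of_int (a i) * x ^ i)"
proof -
  obtain p where p: "poly (map_poly of_int p) x = 0" "lead_coeff p = 1"
    using assms unfolding algebraic_int_altdef_ipoly by blast
  define m where "m = degree p"
  have [simp]: "degree (map_poly of_int p :: 'a poly) = m"
    by (simp add: m_def)
  have "m > 0"
  proof (rule ccontr)
    assume "\<not> m > 0"
    then have "degree p = 0" by (simp add: m_def)
    then obtain a where "p = [:a:]" by (rule degree_eq_zeroE)
    then show False using p by (simp add: of_int_hom.map_poly_pCons_hom)
  qed
  have "0 = (\<Sum>i\<le>m. of_int (coeff p i) * x ^ i)"
    using p(1) by (simp add: poly_altdef coeff_map_poly m_def)
  also have "\<dots> = (\<Sum>i<m. of_int (coeff p i) * x ^ i) + x ^ m"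
    using p(2) by (simp add: m_def lessThan_Suc_atMost[symmetric])
  finally have "x ^ m = (\<Sum>i<m. of_int (- coeff p i) * x ^ i)"
    by (simp add: sum_negf eq_neg_iff_add_eq_0 add.commute)
  with \<open>m > 0\<close> show thesis by (rule that)
qed

text \<open>Both elements map the Z-module generated by the products \<open>x ^ i * y ^ j\<close>
  into itself: the exponents stay below \<open>m\<close> and \<open>n\<close> because the integral
  equations rewrite the top powers.\<close>

lemma algebraic_int_add_mult:
  fixes x y :: "'a::field_char_0"
  assumes "algebraic_int x" "algebraic_int y"
  shows algebraic_int_add: "algebraic_int (x + y)"
    and algebraic_int_mult: "algebraic_int (x * y)"
proof -
  obtain m a where m: "m > 0" "x ^ m = (\<Sum>i<m. of_int (a i) * x ^ i)"
    using algebraic_int_power_reduce[OF assms(1)] by metis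
  obtain n e where n: "n > 0" "y ^ n = (\<Sum>j<n. of_int (e j) * y ^ j)"
    using algebraic_int_power_reduce[OF assms(2)] by metis
  define B where "B = (\<lambda>(i,j). x ^ i * y ^ j) ` ({..<m} \<times> {..<n})"
  have finB: "finite B" by (simp add: B_def)
  have inB: "x ^ i * y ^ j \<in> int_span B" if "i < m" "j < n" for i j
    using that finB by (intro int_span_base) (auto simp: B_def)
  have xB: "x * b \<in> int_span B" if b: "b \<in> B" for b
  proof -
    obtain i j where ij: "i < m" "j < n" "b = x ^ i * y ^ j" using b unfolding B_def by auto
    show ?thesis
    proof (cases "Suc i < m")
      case True
      then show ?thesis using inB[of "Suc i" j] ij by (simp add: mult.assoc)
    next
      case False
      then have "Suc i = m" using ij by simp
      then have "x * b = x ^ m * y ^ j" using ij by (auto simp: mult.assoc)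
      also have "\<dots> = (\<Sum>i<m. of_int (a i) * (x ^ i * y ^ j))"
        by (simp add: m(2) sum_distrib_right mult.assoc)
      also have "\<dots> \<in> int_span B" using ij by (intro int_span_sum int_span_scale inB) auto
      finally show ?thesis .
    qed
  qed
  have yB: "y * b \<in> int_span B" if b: "b \<in> B" for b
  proof -
    obtain i j where ij: "i < m" "j < n" "b = x ^ i * y ^ j" using b unfolding B_def by auto
    show ?thesis
    proof (cases "Suc j < n")
      case True
      then show ?thesis using inB[of i "Suc j"] ij by (simp add: algebra_simps)
    next
      case False
      then have "Suc j = n" using ij by simp
      then have "y * b = x ^ i * y ^ n" using ij by (auto simp: algebra_simps)
      also have "\<dots> = (\<Sum>j<n. of_int (e j) * (x ^ i * y ^ j))"
        by (simp add: n(2) sum_distrib_left algebra_simps)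
      also have "\<dots> \<in> int_span B" using ij by (intro int_span_sum int_span_scale inB) auto
      finally show ?thesis .
    qed
  qed
  have one: "1 \<in> B" unfolding B_def using m n by (auto intro!: image_eqI[of _ _ "(0,0)"])
  show "algebraic_int (x + y)"
    using finB one by (rule algebraic_int_stable) (simp_all add: distrib_right int_span_add xB yB)
  show "algebraic_int (x * y)"
    using finB one
    by (rule algebraic_int_stable) (simp_all add: mult.assoc int_span_stable[OF xB] yB)
qed

lemma algebraic_int_diff:
  fixes x y :: "'a::field_char_0"
  shows "algebraic_int x \<Longrightarrow> algebraic_int y \<Longrightarrow> algebraic_int (x - y)"
  using algebraic_int_add[of x "- y"] by simp

lemma algebraic_int_sum:
  fixes f :: "'b \<Rightarrow> 'a::field_char_0"
  shows "(\<And>i. i \<in> I \<Longrightarrow> algebraic_int (f i)) \<Longrightarrow> algebraic_int (sum f I)"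
  by (induction I rule: infinite_finite_induct) (auto intro: algebraic_int_add)

lemma algebraic_int_prod:
  fixes f :: "'b \<Rightarrow> 'a::field_char_0"
  shows "(\<And>i. i \<in> I \<Longrightarrow> algebraic_int (f i)) \<Longrightarrow> algebraic_int (prod f I)"
  by (induction I rule: infinite_finite_induct) (auto intro: algebraic_int_mult int_imp_algebraic_int)

lemma algebraic_int_power:
  fixes x :: "'a::field_char_0"
  shows "algebraic_int x \<Longrightarrow> algebraic_int (x ^ n)"
  by (induction n) (auto intro: algebraic_int_mult int_imp_algebraic_int)

lemma algebraic_int_of_int: "algebraic_int (of_int k :: 'a::field_char_0)"
  by (rule int_imp_algebraic_int) simp

text \<open>In a monic integral equation of least degree for \<open>x\<close>, the constant term is,
  up to sign, \<open>x\<close> times a polynomial in \<open>x\<close>; it is nonzero, since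
  otherwise \<open>x\<close> could be divided out and the degree lowered.\<close>

lemma algebraic_int_dvd_int:
  fixes x :: "'a::field_char_0"
  assumes x: "algebraic_int x" "x \<noteq> 0"
  obtains m :: int and y where "m \<noteq> 0" "algebraic_int y" "x * y = of_int m"
proof -
  define P where "P p \<longleftrightarrow> lead_coeff p = (1::int) \<and> poly (map_poly of_int p) x = 0" for p
  have "\<exists>p. P p" using x(1) unfolding algebraic_int_altdef_ipoly P_def by blast
  then obtain p where p: "P p" and pmin: "\<And>q. P q \<Longrightarrow> degree p \<le> degree q"
    using ex_has_least_nat[of P _ degree] by blast
  obtain a q where pq: "p = pCons a q" by (cases p)
  have "q \<noteq> 0" using p pq by (auto simp: P_def of_int_hom.map_poly_pCons_hom)
  then have lq: "lead_coeff q = 1" "degree q < degree p" using p pq by (auto simp: P_def)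
  have eq: "of_int a + x * poly (map_poly of_int q) x = 0"
    using p pq by (simp add: P_def of_int_hom.map_poly_pCons_hom)
  have "a \<noteq> 0"
  proof
    assume "a = 0"
    then have "P q" using eq x lq by (simp add: P_def)
    then show False using pmin lq(2) by fastforce
  qed
  have "algebraic_int (poly (map_poly of_int q) x)"
    unfolding poly_altdef
    by (intro algebraic_int_sum algebraic_int_mult algebraic_int_power x)
       (simp add: coeff_map_poly algebraic_int_of_int)
  moreover have "x * poly (map_poly of_int q) x = of_int (- a)"
    using eq by (simp add: eq_neg_iff_add_eq_0 add.commute)
  ultimately show thesis using that[of "- a"] \<open>a \<noteq> 0\<close> by simp
qed

section \<open>Primitive elements and minimal polynomials\<close>

text \<open>Rational polynomials are kept as such and evaluated in the number field, in the complex
  numbers and in an algebraic closure alike; identities between polynomials thus transfer from one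
  field to another.\<close>

definition qeval :: "rat poly \<Rightarrow> 'a::field_char_0 \<Rightarrow> 'a" where
  "qeval p x = poly (map_poly of_rat p) x"

lemma qeval_pCons [simp]: "qeval (pCons a p) x = of_rat a + x * qeval p x"
  by (simp add: qeval_def of_rat_hom.map_poly_pCons_hom)

lemma qeval_0 [simp]: "qeval 0 x = 0"
  by (simp add: qeval_def)

lemma qeval_1 [simp]: "qeval 1 x = 1"
  by (simp add: qeval_def)

lemma qeval_add [simp]: "qeval (p + q) x = qeval p x + qeval q x"
  by (induction p q rule: poly_induct2) (auto simp: of_rat_add algebra_simps)

lemma qeval_smult [simp]: "qeval (Polynomial.smult a p) x = of_rat a * qeval p x"
  by (induction p) (auto simp: of_rat_mult algebra_simps)

lemma qeval_mult [simp]: "qeval (p * q) x = qeval p x * qeval q x"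
  by (induction p) (auto simp: algebra_simps)

lemma qeval_minus [simp]: "qeval (- p) x = - qeval p x"
  using qeval_smult[of "-1" p x] by (simp add: of_rat_minus)

lemma qeval_diff [simp]: "qeval (p - q) x = qeval p x - qeval q x"
  using qeval_add[of p "- q" x] by simp

lemma qeval_power [simp]: "qeval (p ^ n) x = qeval p x ^ n"
  by (induction n) auto

lemma qeval_monom [simp]: "qeval (monom a n) x = of_rat a * x ^ n"
  by (simp add: qeval_def poly_monom)

lemma qeval_sum: "qeval (sum f I) x = (\<Sum>i\<in>I. qeval (f i) x)"
  by (induction I rule: infinite_finite_induct) auto

lemma qeval_altdef: "degree p < n \<Longrightarrow> qeval p x = (\<Sum>i<n. of_rat (coeff p i) * x ^ i)"
proof -
  assume n: "degree p < n"
  have "qeval p x = (\<Sum>i\<le>degree p. of_rat (coeff p i) * x ^ i)"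
    by (simp add: qeval_def poly_altdef coeff_map_poly)
  also have "\<dots> = (\<Sum>i<n. of_rat (coeff p i) * x ^ i)"
    using n by (intro sum.mono_neutral_left) (auto simp: coeff_eq_0)
  finally show ?thesis .
qed

text \<open>The notion of \<open>field_embedding\<close> with an arbitrary target, so that it also
  covers \<open>to_ac\<close>, the inclusion into the algebraic closure.\<close>

definition ring_map :: "('a::field_char_0 \<Rightarrow> 'b::field_char_0) \<Rightarrow> bool" where
  "ring_map h \<longleftrightarrow> h 1 = 1 \<and> (\<forall>x y. h (x + y) = h x + h y) \<and> (\<forall>x y. h (x * y) = h x * h y)"

lemma ring_map:
  assumes "ring_map h"
  shows ring_map_1: "h 1 = 1" and ring_map_add: "h (x + y) = h x + h y"
    and ring_map_mult: "h (x * y) = h x * h y" and ring_map_0: "h 0 = 0"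
    and ring_map_minus: "h (- x) = - h x" and ring_map_diff: "h (x - y) = h x - h y"
    and ring_map_power: "h (x ^ n) = h x ^ n"
    and ring_map_of_int: "h (of_int k) = of_int k"
    and ring_map_eq_0: "h x = 0 \<longleftrightarrow> x = 0"
proof -
  have 1: "h 1 = 1" and add: "h (x + y) = h x + h y" and mult: "h (x * y) = h x * h y" for x y
    using assms by (auto simp: ring_map_def)
  show "h 1 = 1" "h (x + y) = h x + h y" "h (x * y) = h x * h y" by fact+
  have 0: "h 0 = 0" using add[of 0 0] by simp
  then show "h 0 = 0" .
  have m: "h (- x) = - h x" for x using add[of x "- x"] 0 by (simp add: eq_neg_iff_add_eq_0 add.commute)
  then show "h (- x) = - h x" .
  show "h (x - y) = h x - h y" using add[of x "- y"] m by simp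
  show "h (x ^ n) = h x ^ n" by (induction n) (auto simp: 1 mult)
  have "h (of_nat k) = of_nat k" for k by (induction k) (auto simp: 0 1 add)
  moreover have "h (a - b) = h a - h b" for a b using add[of a "- b"] m by simp
  ultimately show "h (of_int k) = of_int k" by (cases k rule: int_diff_cases) simp
  have "x = 0" if "h x = 0"
  proof (rule ccontr)
    assume "x \<noteq> 0"
    then have "h x * h (inverse x) = 1" using mult[of x "inverse x"] 1 by simp
    then show False using that by simp
  qed
  then show "h x = 0 \<longleftrightarrow> x = 0" using 0 by auto
qed

lemma ring_map_sum: "ring_map h \<Longrightarrow> h (sum f I) = (\<Sum>i\<in>I. h (f i))"
  by (induction I rule: infinite_finite_induct) (auto simp: ring_map_0 ring_map_add)

lemma ring_map_of_rat: "ring_map h \<Longrightarrow> h (of_rat q) = of_rat q"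
proof -
  assume h: "ring_map h"
  obtain a b where q: "quotient_of q = (a, b)" by (cases "quotient_of q")
  then have b: "b > 0" "q = of_int a / of_int b"
    by (auto intro: quotient_of_denom_pos quotient_of_div)
  have "h (of_rat q) * of_int b = h (of_rat q * of_int b)"
    by (simp add: ring_map_mult[OF h] ring_map_of_int[OF h])
  also have "of_rat q * of_int b = (of_int a :: 'a)"
    using b by (simp add: of_rat_divide)
  also have "h (of_int a) = of_rat q * of_int b"
    using b by (simp add: of_rat_divide ring_map_of_int[OF h])
  finally show ?thesis using b by simp
qed

lemma ring_map_qeval: "ring_map h \<Longrightarrow> h (qeval p x) = qeval p (h x)"
  by (induction p) (simp_all add: ring_map_0 ring_map_add ring_map_mult ring_map_of_rat)

text \<open>Fixed by least degree alone, hence only up to a nonzero constant factor.\<close>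

definition is_minpoly :: "rat poly \<Rightarrow> 'a::field_char_0 \<Rightarrow> bool" where
  "is_minpoly f x \<longleftrightarrow> f \<noteq> 0 \<and> qeval f x = 0 \<and> (\<forall>p. p \<noteq> 0 \<longrightarrow> qeval p x = 0 \<longrightarrow> degree f \<le> degree p)"

lemma minpoly_exists:
  assumes "p \<noteq> 0" "qeval p x = 0"
  obtains f where "is_minpoly f x"
  using ex_has_least_nat[of "\<lambda>p. p \<noteq> 0 \<and> qeval p x = 0" p degree] assms
  unfolding is_minpoly_def by blast

lemma minpoly_dvd:
  assumes "is_minpoly f x" "qeval p x = 0"
  shows "f dvd p"
proof -
  have "qeval (p mod f) x = qeval p x - qeval (p div f) x * qeval f x"
    by (simp add: minus_div_mult_eq_mod[symmetric])
  then have z: "qeval (p mod f) x = 0" using assms by (simp add: is_minpoly_def)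
  have "p mod f = 0"
  proof (rule ccontr)
    assume "p mod f \<noteq> 0"
    then have "degree f \<le> degree (p mod f)" using z assms(1) by (simp add: is_minpoly_def)
    moreover have "degree (p mod f) < degree f"
      using degree_mod_less[of f p] \<open>p mod f \<noteq> 0\<close> assms(1) by (auto simp: is_minpoly_def)
    ultimately show False by simp
  qed
  then show ?thesis by auto
qed

text \<open>The gcd cannot vanish at \<open>x\<close>, since it divides \<open>p\<close>; so its
  cofactor in \<open>f\<close> does, and minimality leaves degree 0 for the gcd.\<close>

lemma minpoly_coprime:
  assumes f: "is_minpoly f x" and p: "qeval p x \<noteq> 0"
  shows "coprime f p"
proof -
  define g where "g = gcd f p"
  have f0: "f \<noteq> 0" using f by (simp add: is_minpoly_def)
  have gd: "g dvd f" "g dvd p" by (auto simp: g_def)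
  then obtain e where e: "f = g * e" by (auto elim: dvdE)
  have nz: "g \<noteq> 0" "e \<noteq> 0" using f0 e by auto
  have "qeval g x \<noteq> 0" using gd(2) p by (auto elim!: dvdE)
  then have "qeval e x = 0" using f e by (auto simp: is_minpoly_def)
  then have "degree f \<le> degree e" using nz f by (auto simp: is_minpoly_def)
  then have "degree g = 0" using e nz by (simp add: degree_mult_eq)
  then have "is_unit g" using nz is_unit_iff_degree by blast
  then show ?thesis unfolding g_def is_unit_gcd .
qed

lemma coprime_bezout_poly:
  fixes p q :: "rat poly"
  assumes "coprime p q"
  obtains u v where "u * p + v * q = 1"
  using bezout_coefficients_fst_snd[of p q] assms by (metis coprime_imp_gcd_eq_1)

lemma minpoly_degree_pos:
  assumes "is_minpoly f x"
  shows "degree f > 0"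
proof (rule ccontr)
  assume "\<not> degree f > 0"
  then have "degree f = 0" by simp
  then obtain a where "f = [:a:]" by (rule degree_eq_zeroE)
  then show False using assms by (simp add: is_minpoly_def)
qed

text \<open>\<open>z\<close> may lie in another field than \<open>x\<close>: coprimality of
  \<open>f\<close> and its derivative is proved at \<open>x\<close>, and the resulting Bezout
  identity holds at every \<open>z\<close>.\<close>

lemma minpoly_simple_root:
  fixes x :: "'a::field_char_0" and z :: "'b::field_char_0"
  assumes f: "is_minpoly f x" and z: "qeval f z = 0"
  shows "qeval (pderiv f) z \<noteq> 0"
proof
  assume 0: "qeval (pderiv f) z = 0"
  have deg: "degree (pderiv f) < degree f"
    using minpoly_degree_pos[OF f] by (simp add: degree_pderiv)
  have "pderiv f \<noteq> 0" using minpoly_degree_pos[OF f] by (simp add: pderiv_eq_0_iff)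
  then have "qeval (pderiv f) x \<noteq> 0" using f deg unfolding is_minpoly_def by (meson linorder_not_less)
  then obtain u v where "u * f + v * pderiv f = 1"
    using minpoly_coprime[OF f] coprime_bezout_poly by metis
  then have "qeval (u * f + v * pderiv f) z = 1" by simp
  then show False using z 0 by simp
qed

lemma poly_pderiv_qeval: "poly (pderiv (map_poly of_rat f)) z = qeval (pderiv f) z"
  by (induction f) (simp_all add: qeval_def pderiv_pCons of_rat_hom.map_poly_pCons_hom
      flip: qeval_def)

text \<open>The ring Q[x]; for algebraic \<open>x\<close> it is already a field, by
  \<open>rat_adjoin_inverse\<close>, so polynomial values suffice.\<close>

definition rat_adjoin :: "'a::field_char_0 \<Rightarrow> 'a set" where
  "rat_adjoin x = range (\<lambda>p. qeval p x)"

lemma rat_adjoinI: "qeval p x \<in> rat_adjoin x"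
  by (simp add: rat_adjoin_def)

lemma rat_adjoinE: "a \<in> rat_adjoin x \<Longrightarrow> (\<And>p. a = qeval p x \<Longrightarrow> thesis) \<Longrightarrow> thesis"
  by (auto simp: rat_adjoin_def)

lemma rat_adjoin_closed:
  shows rat_adjoin_self: "x \<in> rat_adjoin x"
    and rat_adjoin_of_rat: "of_rat q \<in> rat_adjoin x"
    and rat_adjoin_add: "a \<in> rat_adjoin x \<Longrightarrow> b \<in> rat_adjoin x \<Longrightarrow> a + b \<in> rat_adjoin x"
    and rat_adjoin_diff: "a \<in> rat_adjoin x \<Longrightarrow> b \<in> rat_adjoin x \<Longrightarrow> a - b \<in> rat_adjoin x"
    and rat_adjoin_mult: "a \<in> rat_adjoin x \<Longrightarrow> b \<in> rat_adjoin x \<Longrightarrow> a * b \<in> rat_adjoin x"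
proof -
  show "x \<in> rat_adjoin x" unfolding rat_adjoin_def by (rule range_eqI[of _ _ "[:0,1:]"]) simp
  show "of_rat q \<in> rat_adjoin x" unfolding rat_adjoin_def by (rule range_eqI[of _ _ "[:q:]"]) simp
  show "a \<in> rat_adjoin x \<Longrightarrow> b \<in> rat_adjoin x \<Longrightarrow> a + b \<in> rat_adjoin x"
    by (elim rat_adjoinE) (metis rat_adjoinI qeval_add)
  show "a \<in> rat_adjoin x \<Longrightarrow> b \<in> rat_adjoin x \<Longrightarrow> a - b \<in> rat_adjoin x"
    by (elim rat_adjoinE) (metis rat_adjoinI qeval_diff)
  show "a \<in> rat_adjoin x \<Longrightarrow> b \<in> rat_adjoin x \<Longrightarrow> a * b \<in> rat_adjoin x"
    by (elim rat_adjoinE) (metis rat_adjoinI qeval_mult)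
qed

lemma rat_adjoin_qeval: "a \<in> rat_adjoin x \<Longrightarrow> qeval p a \<in> rat_adjoin x"
  by (induction p)
    (use rat_adjoin_of_rat[of 0 x] in \<open>auto intro: rat_adjoin_add rat_adjoin_mult rat_adjoin_of_rat\<close>)

lemma rat_adjoin_trans: "x \<in> rat_adjoin y \<Longrightarrow> a \<in> rat_adjoin x \<Longrightarrow> a \<in> rat_adjoin y"
  using rat_adjoin_qeval unfolding rat_adjoin_def[of x] by blast

lemma rat_adjoin_inverse:
  assumes f: "is_minpoly f x" and a: "a \<in> rat_adjoin x"
  shows "inverse a \<in> rat_adjoin x"
proof (cases "a = 0")
  case True
  then show ?thesis using a by simp
next
  case False
  obtain p where p: "a = qeval p x" using a by (auto simp: rat_adjoin_def)
  then obtain u v where "u * f + v * p = 1"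
    using minpoly_coprime[OF f] False coprime_bezout_poly by metis
  then have "qeval (u * f + v * p) x = 1" by simp
  then have "qeval v x * a = 1" using f p by (simp add: is_minpoly_def)
  then have "inverse a = qeval v x" using False by (simp add: field_simps)
  then show ?thesis by (simp add: rat_adjoin_def)
qed

section \<open>Polynomials over a subfield and the primitive element theorem\<close>

definition poly_over :: "'a::comm_ring_1 set \<Rightarrow> 'a poly set" where
  "poly_over F = {p. \<forall>i. coeff p i \<in> F}"

text \<open>The division available in \<open>'a poly\<close> says nothing about where coefficients
  lie; long division by a monic polynomial keeps those of the remainder in \<open>F\<close>.\<close>

lemma poly_over_division:
  fixes m :: "'a::field poly"
  assumes F: "0 \<in> F" "\<And>a b. a \<in> F \<Longrightarrow> b \<in> F \<Longrightarrow> a - b \<in> F" "\<And>a b. a \<in> F \<Longrightarrow> b \<in> F \<Longrightarrow> a * b \<in> F"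
    and m: "m \<in> poly_over F" "lead_coeff m = 1" "degree m > 0" and p: "p \<in> poly_over F"
  shows "\<exists>q r. p = q * m + r \<and> r \<in> poly_over F \<and> degree r < degree m"
  using p
proof (induction "degree p" arbitrary: p rule: less_induct)
  case less
  show ?case
  proof (cases "degree p < degree m")
    case True
    then show ?thesis using less.prems by (intro exI[of _ 0] exI[of _ p]) auto
  next
    case False
    define k where "k = degree p - degree m"
    define s where "s = monom (lead_coeff p) k * m"
    have "s \<in> poly_over F"
      using m(1) less.prems F by (auto simp: poly_over_def s_def coeff_monom_mult)
    then have "p - s \<in> poly_over F" using less.prems F by (auto simp: poly_over_def)
    moreover have "degree (p - s) < degree p"
    proof -
      have p0: "lead_coeff p \<noteq> 0" using False m(3) by auto
      have ds: "degree s = degree p"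
        unfolding s_def using False p0 m(2,3)
        by (subst degree_mult_eq) (auto simp: degree_monom_eq k_def monom_eq_0_iff)
      have "coeff s (degree p) = lead_coeff p"
        using False m(2) by (simp add: s_def coeff_monom_mult k_def)
      then have "coeff (p - s) (degree p) = 0" by simp
      moreover have "degree (p - s) \<le> degree p" using ds by (intro degree_diff_le) auto
      moreover have "degree p > 0" using False m(3) by simp
      ultimately show ?thesis
        by (metis degree_0 leading_coeff_0_iff le_neq_implies_less)
    qed
    ultimately obtain q r where "p - s = q * m + r" "r \<in> poly_over F" "degree r < degree m"
      using less.hyps by blast
    then show ?thesis
      by (intro exI[of _ "q + monom (lead_coeff p) k"] exI[of _ r])
        (auto simp: s_def algebra_simps)
  qed
qed

lemma finite_qeval_roots: "f \<noteq> 0 \<Longrightarrow> finite {z::'a::field_char_0. qeval f z = 0}"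
  unfolding qeval_def by (rule poly_roots_finite) simp

lemma poly_over_add:
  assumes F: "\<And>a b. a \<in> F \<Longrightarrow> b \<in> F \<Longrightarrow> a + b \<in> F"
  shows "p \<in> poly_over F \<Longrightarrow> q \<in> poly_over F \<Longrightarrow> p + q \<in> poly_over F"
  using F by (simp add: poly_over_def)

lemma poly_over_mult:
  assumes F: "0 \<in> F" "\<And>a b. a \<in> F \<Longrightarrow> b \<in> F \<Longrightarrow> a + b \<in> F" "\<And>a b. a \<in> F \<Longrightarrow> b \<in> F \<Longrightarrow> a * b \<in> F"
  shows "p \<in> poly_over F \<Longrightarrow> q \<in> poly_over F \<Longrightarrow> p * q \<in> poly_over F"
proof -
  have "sum h I \<in> F" if "\<And>i. i \<in> I \<Longrightarrow> h i \<in> F" for h and I :: "nat set"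
    using that by (induction I rule: infinite_finite_induct) (auto intro: F)
  then show "p \<in> poly_over F \<Longrightarrow> q \<in> poly_over F \<Longrightarrow> p * q \<in> poly_over F"
    using F by (simp add: poly_over_def coeff_mult)
qed

lemma poly_over_pcompose:
  assumes F: "0 \<in> F" "\<And>a b. a \<in> F \<Longrightarrow> b \<in> F \<Longrightarrow> a + b \<in> F" "\<And>a b. a \<in> F \<Longrightarrow> b \<in> F \<Longrightarrow> a * b \<in> F"
  shows "p \<in> poly_over F \<Longrightarrow> q \<in> poly_over F \<Longrightarrow> pcompose p q \<in> poly_over F"
proof (induction p)
  case 0
  then show ?case by simp
next
  case (pCons a p)
  have "coeff (pCons a p) 0 \<in> F" "coeff (pCons a p) (Suc i) \<in> F" for i
    using pCons.prems(1) unfolding poly_over_def by blast+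
  then have "a \<in> F" "p \<in> poly_over F"
    by (simp_all add: poly_over_def)
  moreover from this(1) have "[:a:] \<in> poly_over F"
    using F(1) by (simp add: poly_over_def coeff_pCons split: nat.split)
  ultimately show ?case
    using pCons F by (auto simp: pcompose_pCons intro!: poly_over_add[OF F(2)] poly_over_mult[OF F])
qed

interpretation to_ac_hom: map_poly_idom_hom to_ac
  by unfold_locales auto

lemma ring_map_to_ac: "ring_map to_ac"
  by (simp add: ring_map_def)

lemma map_poly_to_ac_of_rat: "map_poly to_ac (map_poly of_rat p) = map_poly of_rat p"
  by (subst map_poly_map_poly) (auto simp: o_def ring_map_of_rat[OF ring_map_to_ac])

text \<open>The element \<open>\<theta> = x + c y\<close> works for all but finitely many
  \<open>c\<close>. The minimal polynomial \<open>m\<close> of \<open>y\<close> over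
  Q(\<open>\<theta>\<close>) divides both \<open>g\<close> and \<open>f(\<theta> - c Y)\<close>; for
  good \<open>c\<close> their only common root in the algebraic closure is \<open>y\<close>, and it
  is a simple root of \<open>g\<close>, so \<open>m\<close> is linear and \<open>y\<close> lies in
  Q(\<open>\<theta>\<close>).\<close>

lemma primitive_element_two:
  fixes x y :: "'k::field_char_0"
  assumes alg: "\<And>z::'k. \<exists>p. p \<noteq> 0 \<and> qeval p z = 0"
  shows "\<exists>\<theta>. x \<in> rat_adjoin \<theta> \<and> y \<in> rat_adjoin \<theta>"
proof -
  obtain f where f: "is_minpoly f x" using alg[of x] minpoly_exists by blast
  obtain g where g: "is_minpoly g y" using alg[of y] minpoly_exists by blast
  \<comment> \<open>The \<open>c\<close> for which a root \<open>b\<close> of \<open>g\<close> other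
    than \<open>y\<close> makes \<open>\<theta> - c b\<close> a root \<open>a\<close> of
    \<open>f\<close>; the pairs with \<open>b = y\<close> merely contribute 0.\<close>
  define bad where "bad = (\<lambda>(a,b). (a - to_ac x) / (to_ac y - b)) `
      ({a. qeval f a = 0} \<times> {b. qeval g b = 0})"
  have "finite bad"
    using f g unfolding bad_def is_minpoly_def by (intro finite_imageI finite_cartesian_product finite_qeval_roots) auto
  moreover have "infinite (range (of_nat :: nat \<Rightarrow> 'k alg_closure))"
    by (simp add: finite_image_iff inj_of_nat)
  ultimately obtain c :: nat where c: "of_nat c \<notin> bad"
    by (metis (no_types, lifting) finite_subset image_subset_iff)
  define \<theta> where "\<theta> = x + of_nat c * y"
  define F where "F = rat_adjoin \<theta>"
  obtain t where t: "is_minpoly t \<theta>" using alg[of \<theta>] minpoly_exists by blast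
  have F0: "0 \<in> F" "1 \<in> F" "of_nat n \<in> F" "of_rat q \<in> F" for n q
    using rat_adjoin_of_rat[of 0 \<theta>] rat_adjoin_of_rat[of 1 \<theta>]
      rat_adjoin_of_rat[of "of_nat n" \<theta>] rat_adjoin_of_rat[of q \<theta>] by (simp_all add: F_def)
  have Fadd: "a \<in> F \<Longrightarrow> b \<in> F \<Longrightarrow> a + b \<in> F" and Fdiff: "a \<in> F \<Longrightarrow> b \<in> F \<Longrightarrow> a - b \<in> F"
    and Fmult: "a \<in> F \<Longrightarrow> b \<in> F \<Longrightarrow> a * b \<in> F" and Finv: "a \<in> F \<Longrightarrow> inverse a \<in> F" for a b
    unfolding F_def using rat_adjoin_add rat_adjoin_diff rat_adjoin_mult rat_adjoin_inverse[OF t] by auto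
  define P where "P m \<longleftrightarrow> m \<in> poly_over F \<and> lead_coeff m = 1 \<and> poly m y = 0" for m
  have scale: "P (Polynomial.smult (inverse (lead_coeff p)) p)"
    if "p \<in> poly_over F" "p \<noteq> 0" "poly p y = 0" for p
    using that Finv Fmult by (auto simp: P_def poly_over_def)
  have over_rat: "map_poly of_rat p \<in> poly_over F" for p
    using F0 by (auto simp: poly_over_def coeff_map_poly)
  have "\<exists>m. P m"
    using scale[OF over_rat[of g]] g by (auto simp: is_minpoly_def qeval_def)
  then obtain m where m: "P m" and mmin: "\<And>q. P q \<Longrightarrow> degree m \<le> degree q"
    using ex_has_least_nat[of P _ degree] by blast
  have mF: "m \<in> poly_over F" and mlc: "lead_coeff m = 1" and my: "poly m y = 0"
    using m by (auto simp: P_def)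
  have mdeg: "degree m > 0"
  proof (rule ccontr)
    assume "\<not> degree m > 0"
    then obtain a where "m = [:a:]" by (auto elim: degree_eq_zeroE)
    then show False using mlc my by simp
  qed
  have mdvd: "m dvd p" if p: "p \<in> poly_over F" "poly p y = 0" for p
  proof -
    obtain q r where qr: "p = q * m + r" "r \<in> poly_over F" "degree r < degree m"
      using poly_over_division[OF F0(1) Fdiff Fmult mF mlc mdeg p(1)] by blast
    have "poly r y = 0" using p(2) qr(1) my by simp
    then have "r = 0"
      using mmin[OF scale[OF qr(2)]] qr(3) by (cases "r = 0") auto
    then show ?thesis using qr by simp
  qed
  \<comment> \<open>This is \<open>f(\<theta> - c Y)\<close> as a polynomial in \<open>Y\<close>; it
    vanishes at \<open>y\<close> by the definition of \<open>\<theta>\<close>.\<close>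
  define h where "h = pcompose (map_poly of_rat f) [:\<theta>, - of_nat c:]"
  have "- of_nat c \<in> F" using Fdiff[OF F0(1) F0(3)[of c]] by simp
  then have "[:\<theta>, - of_nat c:] \<in> poly_over F"
    using F0(1) rat_adjoin_self[of \<theta>] by (auto simp: poly_over_def coeff_pCons F_def split: nat.split)
  then have "h \<in> poly_over F" unfolding h_def
    by (intro poly_over_pcompose F0 Fadd Fmult over_rat)
  moreover have "poly h y = 0" using f by (simp add: h_def poly_pcompose \<theta>_def is_minpoly_def qeval_def)
  ultimately obtain e where e: "h = m * e" using mdvd by (auto elim: dvdE)
  have "m dvd map_poly of_rat g" using g by (intro mdvd over_rat) (simp add: is_minpoly_def qeval_def)
  then obtain k where k: "map_poly of_rat g = m * k" by (auto elim: dvdE)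
  let ?M = "map_poly to_ac m"
  let ?Y = "to_ac y"
  have rootg: "qeval g z = poly ?M z * poly (map_poly to_ac k) z" for z
    using arg_cong[OF k, of "map_poly to_ac"]
    by (simp add: to_ac_hom.hom_mult map_poly_to_ac_of_rat qeval_def)
  have rootf: "qeval f (to_ac \<theta> - of_nat c * z) = poly ?M z * poly (map_poly to_ac e) z" for z
    using arg_cong[OF arg_cong[OF e, of "map_poly to_ac"], of "\<lambda>p. poly p z"]
    by (simp add: to_ac_hom.hom_mult h_def to_ac_hom.base.map_poly_pcompose map_poly_to_ac_of_rat
        qeval_def poly_pcompose mult.commute to_ac_hom.base.map_poly_pCons_hom)
  have "degree m = 1"
  proof (rule ccontr)
    assume "degree m \<noteq> 1"
    then have deg2: "degree m \<ge> 2" using mdeg by simp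
    have "poly ?M ?Y = 0" using my by (metis to_ac_0 to_ac_hom.base.poly_map_poly)
    then obtain M1 where M1: "?M = [:- ?Y, 1:] * M1" unfolding poly_eq_0_iff_dvd by (rule dvdE)
    have "M1 \<noteq> 0" using M1 mdeg by auto
    then have "degree ?M = Suc (degree M1)" unfolding M1 by (subst degree_mult_eq) auto
    moreover have "degree ?M = degree m" by (rule degree_map_poly) auto
    ultimately have "degree M1 > 0" using deg2 by simp
    \<comment> \<open>A second root of \<open>m\<close>: if it differs from \<open>y\<close>, then
      \<open>c\<close> is bad; if it equals \<open>y\<close>, then \<open>y\<close> is a multiple
      root of \<open>g\<close>.\<close>
    then obtain z where z: "poly M1 z = 0" using alg_closed_imp_poly_has_root by blast
    show False
    proof (cases "z = ?Y")
      case False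
      have "poly ?M z = 0" using M1 z by simp
      then have "qeval g z = 0" "qeval f (to_ac \<theta> - of_nat c * z) = 0" using rootg rootf by auto
      then have "((to_ac \<theta> - of_nat c * z) - to_ac x) / (?Y - z) \<in> bad"
        unfolding bad_def by (auto intro!: image_eqI[of _ _ "(to_ac \<theta> - of_nat c * z, z)"])
      moreover have "((to_ac \<theta> - of_nat c * z) - to_ac x) / (?Y - z) = of_nat c"
        using False by (simp add: \<theta>_def field_simps)
      ultimately show False using c by simp
    next
      case True
      then have "poly M1 ?Y = 0" using z by simp
      then obtain M2 where M2: "M1 = [:- ?Y, 1:] * M2" unfolding poly_eq_0_iff_dvd by (rule dvdE)
      define l where "l = [:- ?Y, 1:]"
      have l: "poly l ?Y = 0" by (simp add: l_def)
      have "(map_poly of_rat g :: 'k alg_closure poly) = ?M * map_poly to_ac k"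
        using arg_cong[OF k, of "map_poly to_ac"] by (simp add: to_ac_hom.hom_mult map_poly_to_ac_of_rat)
      then have G: "(map_poly of_rat g :: 'k alg_closure poly) = l * (l * (M2 * map_poly to_ac k))"
        by (simp only: M1 M2 mult.assoc l_def)
      have "poly (pderiv (map_poly of_rat g)) ?Y = 0"
        unfolding G pderiv_mult[of l] by (simp add: l)
      moreover have "qeval g ?Y = 0" using rootg[of ?Y] M1 by simp
      ultimately show False using minpoly_simple_root[OF g, of ?Y] by (simp add: poly_pderiv_qeval)
    qed
  qed
  then have "coeff m i = coeff [:coeff m 0, 1:] i" for i
    using mlc coeff_eq_0[of m i] by (cases i; cases "i - 1") (simp_all del: leading_coeff_0_iff)
  then have "m = [:coeff m 0, 1:]" by (rule poly_eqI)
  then have "poly [:coeff m 0, 1:] y = 0" using my by metis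
  then have "y = - coeff m 0" by (simp add: eq_neg_iff_add_eq_0 add.commute)
  moreover have "- coeff m 0 \<in> F"
    using mF Fdiff[OF F0(1), of "coeff m 0"] by (simp add: poly_over_def)
  ultimately have y: "y \<in> F" by simp
  have "x = \<theta> - of_nat c * y" by (simp add: \<theta>_def)
  then have "x \<in> F" using y Fdiff Fmult F0 rat_adjoin_self[of \<theta>] by (metis F_def)
  then show ?thesis using y F_def by blast
qed

lemma rat_adjoin_finite_union:
  fixes B :: "'k::field_char_0 set"
  assumes alg: "\<And>z::'k. \<exists>p. p \<noteq> 0 \<and> qeval p z = 0" and "finite B"
  shows "\<exists>\<theta>. B \<subseteq> rat_adjoin \<theta>"
  using assms(2)
proof (induction B)
  case (insert b B)
  then obtain \<theta> where t: "B \<subseteq> rat_adjoin \<theta>" by blast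
  obtain \<theta>' where "b \<in> rat_adjoin \<theta>'" "\<theta> \<in> rat_adjoin \<theta>'"
    using primitive_element_two[OF alg] by blast
  moreover have "B \<subseteq> rat_adjoin \<theta>'"
    using t rat_adjoin_trans[OF \<open>\<theta> \<in> rat_adjoin \<theta>'\<close>] by (meson subset_iff)
  ultimately show ?case by (meson insert_subset)
qed auto

text \<open>With \<open>a\<close> the leading coefficient and \<open>n\<close> the degree,
  multiplying the equation of \<open>x\<close> by \<open>a ^ (n - 1)\<close> gives a monic integral
  equation for \<open>a * x\<close>.\<close>

lemma algebraic_multiple_int:
  fixes x :: "'a::field_char_0"
  assumes "p \<noteq> 0" "qeval p x = 0"
  obtains N :: int where "N \<noteq> 0" "algebraic_int (of_int N * x)"
proof -
  have "algebraic x" unfolding algebraic_altdef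
    using assms by (intro exI[of _ "map_poly of_rat p"]) (auto simp: qeval_def coeff_map_poly)
  then obtain q where q: "\<And>i. coeff q i \<in> \<int>" "q \<noteq> 0" "poly q x = 0"
    unfolding algebraic_def by blast
  define n where "n = degree q"
  define a where "a = lead_coeff q"
  obtain N where N: "a = of_int N" using q(1) by (metis Ints_cases a_def)
  have a0: "a \<noteq> 0" using q(2) by (simp add: a_def)
  have n0: "n > 0"
  proof (rule ccontr)
    assume "\<not> n > 0"
    then obtain b where "q = [:b:]" unfolding n_def by (auto elim: degree_eq_zeroE)
    then show False using q by simp
  qed
  define r where "r = monom 1 n + (\<Sum>i<n. monom (coeff q i * a ^ (n - 1 - i)) i)"
  have cr: "coeff r i = (if i = n then 1 else if i < n then coeff q i * a ^ (n - 1 - i) else 0)" for i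
    by (auto simp: r_def coeff_sum)
  have "degree r = n"
    by (intro antisym degree_le le_degree) (auto simp: cr)
  moreover have "coeff r i \<in> \<int>" for i using q(1) by (auto simp: cr N)
  moreover have "poly r (a * x) = 0"
  proof -
    have "poly r (a * x) = (a * x) ^ n + (\<Sum>i<n. coeff q i * a ^ (n - 1 - i) * (a * x) ^ i)"
      by (simp add: r_def poly_sum poly_monom)
    also have "(\<Sum>i<n. coeff q i * a ^ (n - 1 - i) * (a * x) ^ i) = a ^ (n - 1) * (\<Sum>i<n. coeff q i * x ^ i)"
    proof -
      have *: "coeff q i * a ^ (n - 1 - i) * (a * x) ^ i = a ^ (n - 1) * (coeff q i * x ^ i)" if "i < n" for i
      proof -
        have "a ^ (n - 1) = a ^ (n - 1 - i) * a ^ i" using that by (simp flip: power_add)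
        then show ?thesis by (simp add: power_mult_distrib)
      qed
      show ?thesis unfolding sum_distrib_left by (rule sum.cong[OF refl], rule *) simp
    qed
    also have "(a * x) ^ n = a ^ (n - 1) * (coeff q n * x ^ n)"
      using n0 by (simp add: power_mult_distrib a_def n_def flip: power_Suc2 mult.assoc)
    also have "a ^ (n - 1) * (coeff q n * x ^ n) + a ^ (n - 1) * (\<Sum>i<n. coeff q i * x ^ i) =
        a ^ (n - 1) * poly q x"
      by (simp add: poly_altdef n_def lessThan_Suc_atMost[symmetric] algebra_simps)
    finally show ?thesis using q(3) by simp
  qed
  ultimately have "algebraic_int (a * x)"
    by (intro algebraic_int.intros[of r]) (auto simp: cr)
  then show thesis using that[of N] a0 N by auto
qed

section \<open>Embeddings and the norm\<close>

text \<open>The powers of \<open>z\<close> up to \<open>card B\<close> are more than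
  \<open>B\<close> can span independently. Coinciding powers have to be treated apart, because
  dependence is a property of the set of powers.\<close>

lemma number_field_algebraic:
  fixes z :: "'k::field_char_0"
  assumes "number_field TYPE('k)"
  shows "\<exists>p. p \<noteq> 0 \<and> qeval p z = 0"
proof -
  obtain B :: "'k set" where B: "finite B" "rat_vs.span B = UNIV"
    using assms unfolding number_field_def by blast
  define T where "T = (\<lambda>i. z ^ i) ` {..card B}"
  show ?thesis
  proof (cases "inj_on (\<lambda>i. z ^ i) {..card B}")
    case False
    then obtain i j where ij: "z ^ i = z ^ j" "i \<noteq> j" by (auto simp: inj_on_def)
    define p where "p = [:0, 1:] ^ i - [:0, 1::rat:] ^ j"
    have "p \<noteq> 0" using ij(2) by (auto simp: p_def dest: arg_cong[of _ _ degree] simp: degree_power_eq)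
    moreover have "qeval p z = 0" using ij by (simp add: p_def)
    ultimately show ?thesis by blast
  next
    case True
    then have "card T = Suc (card B)" by (simp add: T_def card_image)
    then have "rat_vs.dependent T"
      using rat_vs.independent_span_bound[OF B(1), of T] B(2) by auto
    then obtain u v where u: "v \<in> T" "u v \<noteq> 0" "(\<Sum>v\<in>T. of_rat (u v) * v) = 0"
      using rat_vs.dependent_finite[of T] by (auto simp: T_def)
    define p where "p = (\<Sum>i\<le>card B. monom (u (z ^ i)) i)"
    have "qeval p z = (\<Sum>i\<le>card B. of_rat (u (z ^ i)) * z ^ i)"
      by (simp add: p_def qeval_sum)
    also have "\<dots> = 0" using u(3) True by (simp add: T_def sum.reindex)
    finally have "qeval p z = 0" .
    moreover have "p \<noteq> 0"
    proof -
      obtain i where i: "i \<le> card B" "v = z ^ i" using u(1) by (auto simp: T_def)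
      have "coeff p i = u v" using i by (simp add: p_def coeff_sum)
      then show ?thesis using u(2) by auto
    qed
    ultimately show ?thesis by blast
  qed
qed

definition embeddings :: "('k::field_char_0 \<Rightarrow> complex) set" where
  "embeddings = {\<sigma>. field_embedding \<sigma>}"

lemma embedding_ring_map: "\<sigma> \<in> embeddings \<longleftrightarrow> ring_map \<sigma>"
  by (simp add: embeddings_def field_embedding_def ring_map_def)

text \<open>A number field written as Q(\<open>\<theta>\<close>) with an algebraic integer
  \<open>\<theta>\<close>; integrality makes all integer combinations of its powers algebraic
  integers.\<close>

locale integral_primitive =
  fixes \<theta> :: "'k::field_char_0" and f :: "rat poly" and n :: nat
  assumes minpoly: "is_minpoly f \<theta>" and integral: "algebraic_int \<theta>"
    and generates: "rat_adjoin \<theta> = UNIV" and degree_f: "degree f = n"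
begin

lemma n_pos: "n > 0"
  using minpoly_degree_pos[OF minpoly] degree_f by simp

lemma f_nz: "f \<noteq> 0"
  using minpoly by (simp add: is_minpoly_def)

lemma representation: "\<exists>p. degree p < n \<and> x = qeval p \<theta>"
proof -
  obtain p where p: "x = qeval p \<theta>" using generates rat_adjoinE[of x \<theta>] by blast
  have "qeval (p mod f) \<theta> = qeval p \<theta> - qeval (p div f) \<theta> * qeval f \<theta>"
    by (simp add: minus_div_mult_eq_mod[symmetric])
  then have "x = qeval (p mod f) \<theta>" using p minpoly by (simp add: is_minpoly_def)
  moreover have "degree (p mod f) < n"
    using degree_mod_less[OF f_nz, of p] n_pos degree_f by auto
  ultimately show ?thesis by blast
qed

lemma representation_unique: "degree p < n \<Longrightarrow> qeval p \<theta> = 0 \<Longrightarrow> p = 0"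
  using minpoly degree_f unfolding is_minpoly_def by (meson leD)

lemma powers_independent:
  assumes "(\<Sum>i<n. of_rat (u i) * \<theta> ^ i) = 0" "i < n"
  shows "u i = 0"
proof -
  define p where "p = (\<Sum>i<n. monom (u i) i)"
  have cp: "coeff p j = (if j < n then u j else 0)" for j
    by (auto simp: p_def coeff_sum)
  have "degree p < n"
    using n_pos by (intro degree_lessI) (auto simp: cp)
  moreover have "qeval p \<theta> = 0"
    using assms(1) qeval_altdef[OF \<open>degree p < n\<close>, of \<theta>] by (simp add: cp)
  ultimately have "p = 0" by (rule representation_unique)
  then show ?thesis using cp[of i] assms(2) by simp
qed

lemma inj_powers: "inj_on (\<lambda>i. \<theta> ^ i) {..<n}"
proof (rule inj_onI, rule ccontr)
  fix i j assume ij: "i \<in> {..<n}" "j \<in> {..<n}" "\<theta> ^ i = \<theta> ^ j" "i \<noteq> j"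
  have "(\<Sum>k<n. of_rat ((if k = i then 1 else 0) - (if k = j then 1 else 0)) * \<theta> ^ k) =
      (\<Sum>k<n. (if k = i then \<theta> ^ k else 0) - (if k = j then \<theta> ^ k else 0))"
    by (intro sum.cong) (auto simp: of_rat_minus)
  also have "\<dots> = 0" using ij by (simp add: sum_subtractf)
  finally have "(if i = i then 1 else 0) - (if i = j then 1 else 0) = (0::rat)"
    by (rule powers_independent) (use ij in auto)
  then show False using ij by simp
qed

lemma degree_eq: "number_field_degree TYPE('k) = n"
proof -
  let ?T = "(\<lambda>i. \<theta> ^ i) ` {..<n}"
  have "rat_vs.independent ?T"
  proof
    assume "rat_vs.dependent ?T"
    then obtain u v where u: "v \<in> ?T" "u v \<noteq> 0" "(\<Sum>v\<in>?T. of_rat (u v) * v) = 0"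
      using rat_vs.dependent_finite[of ?T] by auto
    then have "(\<Sum>i<n. of_rat (u (\<theta> ^ i)) * \<theta> ^ i) = 0"
      by (simp add: sum.reindex[OF inj_powers])
    then show False using powers_independent u(1,2) by fastforce
  qed
  moreover have "rat_vs.span ?T = UNIV"
  proof (rule UNIV_eq_I[symmetric])
    fix x
    obtain p where p: "degree p < n" "x = qeval p \<theta>" using representation by blast
    then have "x = (\<Sum>i<n. of_rat (coeff p i) * \<theta> ^ i)" using qeval_altdef by blast
    also have "\<dots> \<in> rat_vs.span ?T"
      by (intro rat_vs.span_sum rat_vs.span_scale rat_vs.span_base) auto
    finally show "x \<in> rat_vs.span ?T" .
  qed
  ultimately have "rat_vs.dim (UNIV :: 'k set) = card ?T"
    by (intro rat_vs.dim_eq_card) auto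
  then show ?thesis unfolding number_field_degree_def by (simp add: card_image[OF inj_powers])
qed

definition conj_roots :: "complex set" where
  "conj_roots = {z. qeval f z = 0}"

text \<open>As all roots are simple, \<open>f\<close> splits into distinct linear factors over the
  complex numbers.\<close>

lemma card_conj_roots: "card conj_roots = n"
proof -
  let ?p = "map_poly of_rat f :: complex poly"
  have p0: "?p \<noteq> 0" using f_nz by simp
  have "rsquarefree ?p"
    unfolding rsquarefree_roots using minpoly_simple_root[OF minpoly]
    by (auto simp: poly_pderiv_qeval simp flip: qeval_def)
  then have "Polynomial.smult (lead_coeff ?p) (\<Prod>z | poly ?p z = 0. [:-z, 1:]) = ?p"
    by (rule complex_poly_decompose_rsquarefree)
  then have "degree ?p = degree (Polynomial.smult (lead_coeff ?p) (\<Prod>z | poly ?p z = 0. [:-z, 1:]))"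
    by simp
  also have "\<dots> = (\<Sum>z | poly ?p z = 0. degree [:-z, 1:])"
    using p0 by (subst degree_smult_eq, subst degree_prod_sum_eq) auto
  also have "\<dots> = card conj_roots" by (simp add: conj_roots_def qeval_def)
  finally show ?thesis using degree_f by simp
qed

lemma finite_conj_roots: "finite conj_roots"
  unfolding conj_roots_def by (rule finite_qeval_roots[OF f_nz])

text \<open>An embedding is determined by the image of \<open>\<theta>\<close>, a root of
  \<open>f\<close>. Conversely, evaluation at a root \<open>z\<close> is well defined on the values
  \<open>qeval p \<theta>\<close>, since \<open>f\<close> divides the difference of two polynomials
  with the same value.\<close>

lemma embeddings_bij: "bij_betw (\<lambda>\<sigma>. \<sigma> \<theta>) embeddings conj_roots"
proof (rule bij_betw_imageI)
  show "inj_on (\<lambda>\<sigma>. \<sigma> \<theta>) embeddings"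
  proof (rule inj_onI, rule ext)
    fix \<sigma> \<sigma>' :: "'k \<Rightarrow> complex" and x
    assume "\<sigma> \<in> embeddings" "\<sigma>' \<in> embeddings" "\<sigma> \<theta> = \<sigma>' \<theta>"
    moreover obtain p where "x = qeval p \<theta>" using representation by blast
    ultimately show "\<sigma> x = \<sigma>' x" by (simp add: embedding_ring_map ring_map_qeval)
  qed
  show "(\<lambda>\<sigma>. \<sigma> \<theta>) ` embeddings = conj_roots"
  proof (intro equalityI subsetI)
    fix z assume "z \<in> (\<lambda>\<sigma>::'k \<Rightarrow> complex. \<sigma> \<theta>) ` embeddings"
    then obtain \<sigma> :: "'k \<Rightarrow> complex" where s: "ring_map \<sigma>" "z = \<sigma> \<theta>"
      by (auto simp: embedding_ring_map)
    have "qeval f z = \<sigma> (qeval f \<theta>)" using s by (simp add: ring_map_qeval)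
    then show "z \<in> conj_roots" using minpoly s by (simp add: conj_roots_def is_minpoly_def ring_map_0)
  next
    fix z assume z: "z \<in> conj_roots"
    have wd: "qeval p z = qeval q z" if "qeval p \<theta> = qeval q \<theta>" for p q
    proof -
      have "qeval (p - q) \<theta> = 0" using that by simp
      then have "f dvd p - q" by (rule minpoly_dvd[OF minpoly])
      then have "qeval (p - q) z = 0" using z by (auto elim!: dvdE simp: conj_roots_def simp del: qeval_diff)
      then show ?thesis by simp
    qed
    define \<sigma> where "\<sigma> x = qeval (SOME p. x = qeval p \<theta>) z" for x
    have sig: "\<sigma> (qeval p \<theta>) = qeval p z" for p
      unfolding \<sigma>_def by (rule wd, rule someI2[of _ p]) auto
    have "ring_map \<sigma>"
      unfolding ring_map_def
    proof (intro conjI allI)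
      show "\<sigma> 1 = 1" using sig[of 1] by simp
      fix x y
      obtain p q where "x = qeval p \<theta>" "y = qeval q \<theta>" using representation by meson
      then show "\<sigma> (x + y) = \<sigma> x + \<sigma> y" "\<sigma> (x * y) = \<sigma> x * \<sigma> y"
        using sig[of "p + q"] sig[of "p * q"] by (simp_all add: sig)
    qed
    moreover have "\<sigma> \<theta> = z" using sig[of "[:0, 1:]"] by simp
    ultimately show "z \<in> (\<lambda>\<sigma>. \<sigma> \<theta>) ` embeddings"
      by (intro image_eqI[of _ _ \<sigma>]) (auto simp: embedding_ring_map)
  qed
qed

lemma finite_embeddings: "finite (embeddings :: ('k \<Rightarrow> complex) set)"
  using embeddings_bij finite_conj_roots bij_betw_finite by blast

lemma card_embeddings: "card (embeddings :: ('k \<Rightarrow> complex) set) = n"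
  using bij_betw_same_card[OF embeddings_bij] card_conj_roots by simp

text \<open>Multiplication by \<open>x\<close> has a rational matrix \<open>M\<close> in the basis
  of powers of \<open>\<theta>\<close>. The Vandermonde matrix \<open>V\<close> of the conjugates
  carries it to the diagonal matrix \<open>D\<close> with entries \<open>\<sigma> x\<close>, so the
  product is the determinant of \<open>M\<close>.\<close>

lemma norm_rational:
  fixes x :: 'k
  shows "(\<Prod>\<sigma>\<in>embeddings. \<sigma> x) \<in> \<rat>"
proof -
  obtain e where e: "bij_betw e {0..<n} (embeddings :: ('k \<Rightarrow> complex) set)"
    using ex_bij_betw_nat_finite[OF finite_embeddings] card_embeddings by auto
  have eE: "ring_map (e s)" if "s < n" for s
    using e that by (auto simp: bij_betw_def simp flip: embedding_ring_map)
  have "\<forall>i. \<exists>p. degree p < n \<and> x * \<theta> ^ i = qeval p \<theta>" using representation by blast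
  then obtain P where P: "\<And>i. degree (P i) < n" "\<And>i. x * \<theta> ^ i = qeval (P i) \<theta>" by metis
  define V where "V = Matrix.mat n n (\<lambda>(s,j). e s \<theta> ^ j)"
  define M where "M = Matrix.mat n n (\<lambda>(j,i). coeff (P i) j)"
  define D where "D = Matrix.mat n n (\<lambda>(s,t). if s = t then e s x else 0)"
  have carr: "V \<in> carrier_mat n n" "map_mat of_rat M \<in> carrier_mat n n" "D \<in> carrier_mat n n"
    by (simp_all add: V_def M_def D_def)
  have "D * V = V * map_mat of_rat M"
  proof (rule eq_matI)
    fix s i assume "s < dim_row (V * map_mat of_rat M)" "i < dim_col (V * map_mat of_rat M)"
    then have si: "s < n" "i < n" by (simp_all add: V_def M_def)
    have "(D * V) $$ (s, i) = (\<Sum>j = 0..<n. (if s = j then e s x else 0) * e j \<theta> ^ i)"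
      using si by (simp add: D_def V_def scalar_prod_def)
    also have "\<dots> = (\<Sum>j = 0..<n. (if s = j then e s x * e j \<theta> ^ i else 0))"
      by (intro sum.cong) auto
    also have "\<dots> = e s x * e s \<theta> ^ i" using si by simp
    also have "\<dots> = e s (qeval (P i) \<theta>)"
      using eE[OF si(1)] by (simp add: ring_map_mult ring_map_power flip: P(2))
    also have "\<dots> = (\<Sum>j<n. of_rat (coeff (P i) j) * e s \<theta> ^ j)"
      unfolding ring_map_qeval[OF eE[OF si(1)]] by (rule qeval_altdef[OF P(1)])
    also have "\<dots> = (V * map_mat of_rat M) $$ (s, i)"
      using si by (simp add: V_def M_def scalar_prod_def atLeast0LessThan mult.commute)
    finally show "(D * V) $$ (s, i) = (V * map_mat of_rat M) $$ (s, i)" .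
  qed (simp_all add: V_def M_def D_def)
  then have "Determinant.det D * Determinant.det V =
      Determinant.det V * Determinant.det (map_mat of_rat M)"
    using carr by (metis Determinant.det_mult)
  \<comment> \<open>A kernel vector would be the coefficient list of a nonzero polynomial of degree
    below \<open>n\<close> vanishing at all \<open>n\<close> conjugates.\<close>
  moreover have "Determinant.det V \<noteq> 0"
  proof
    assume "Determinant.det V = 0"
    then obtain v where v: "v \<in> carrier_vec n" "v \<noteq> 0\<^sub>v n" "V *\<^sub>v v = 0\<^sub>v n"
      using det_0_iff_vec_prod_zero_field[OF carr(1)] by blast
    define q where "q = (\<Sum>i<n. monom (vec_index v i) i)"
    have cq: "coeff q j = (if j < n then vec_index v j else 0)" for j
      by (auto simp: q_def coeff_sum)
    have dq: "degree q < n" using n_pos by (intro degree_lessI) (auto simp: cq)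
    have "poly q z = 0" if z: "z \<in> conj_roots" for z
    proof -
      have "z \<in> (\<lambda>\<sigma>. \<sigma> \<theta>) ` e ` {0..<n}"
        using z embeddings_bij e by (simp add: bij_betw_def)
      then obtain s where s: "s < n" "z = e s \<theta>" by auto
      have "vec_index (V *\<^sub>v v) s = (\<Sum>j = 0..<n. e s \<theta> ^ j * vec_index v j)"
        using s v(1) by (simp add: V_def scalar_prod_def)
      then have "(\<Sum>j = 0..<n. e s \<theta> ^ j * vec_index v j) = 0" using v(3) s by simp
      then show ?thesis
        by (simp add: s q_def poly_sum poly_monom atLeast0LessThan mult.commute)
    qed
    then have sub: "conj_roots \<subseteq> {z. poly q z = 0}" by auto
    have q0: "q \<noteq> 0"
    proof
      assume "q = 0"
      then have "vec_index v j = 0" if "j < n" for j using cq[of j] that by simp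
      then have "v = 0\<^sub>v n" using v(1) by (intro eq_vecI) auto
      then show False using v(2) by simp
    qed
    have "card conj_roots \<le> degree q"
      using card_mono[OF poly_roots_finite[OF q0] sub] card_poly_roots_bound[OF q0] by linarith
    then show False using dq card_conj_roots by simp
  qed
  ultimately have "Determinant.det D = Determinant.det (map_mat of_rat M :: complex mat)" by simp
  moreover have "Determinant.det D = (\<Prod>\<sigma>\<in>embeddings. \<sigma> x)"
  proof -
    have "upper_triangular D" by (auto simp: upper_triangular_def D_def)
    then have "Determinant.det D = prod_list (diag_mat D)" using carr(3) by (rule det_upper_triangular)
    also have "\<dots> = (\<Prod>s = 0..<n. e s x)"
      by (simp add: diag_mat_def D_def prod.list_conv_set_nth)
    also have "\<dots> = (\<Prod>\<sigma>\<in>embeddings. \<sigma> x)"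
      using prod.reindex_bij_betw[OF e, of "\<lambda>\<sigma>. \<sigma> x"] .
    finally show ?thesis .
  qed
  ultimately show ?thesis by (simp add: of_rat_hom.hom_det)
qed

end

lemma ring_map_algebraic_int:
  assumes "ring_map h" "algebraic_int x"
  shows "algebraic_int (h x)"
proof -
  obtain p where p: "poly (map_poly of_int p) x = 0" "lead_coeff p = 1"
    using assms(2) unfolding algebraic_int_altdef_ipoly by blast
  have "h (poly (map_poly of_int q) x) = poly (map_poly of_int q) (h x)" for q
    by (induction q) (simp_all add: ring_map_0[OF assms(1)] ring_map_add[OF assms(1)]
        ring_map_mult[OF assms(1)] ring_map_of_int[OF assms(1)] of_int_hom.map_poly_pCons_hom)
  then have "poly (map_poly of_int p) (h x) = 0" using p(1) ring_map_0[OF assms(1)] by metis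
  then show ?thesis unfolding algebraic_int_altdef_ipoly using p(2) by blast
qed

text \<open>The norm is rational and an algebraic integer, hence an integer, and it is nonzero
  because embeddings are injective.\<close>

lemma (in integral_primitive) norm_ge_1:
  fixes x :: 'k
  assumes "algebraic_int x" "x \<noteq> 0"
  shows "1 \<le> (\<Prod>\<sigma>\<in>embeddings. cmod (\<sigma> x))"
proof -
  let ?N = "\<Prod>\<sigma>\<in>embeddings. \<sigma> x"
  have "algebraic_int ?N"
    using ring_map_algebraic_int[OF _ assms(1)] by (intro algebraic_int_prod) (simp add: embedding_ring_map)
  then have "?N \<in> \<int>" by (rule rational_algebraic_int_is_int[OF _ norm_rational])
  moreover have "?N \<noteq> 0"
    using finite_embeddings assms(2) by (simp add: embedding_ring_map ring_map_eq_0)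
  ultimately have "1 \<le> cmod ?N" by (auto elim!: Ints_cases simp flip: of_int_abs)
  then show ?thesis by (simp add: prod_norm)
qed

lemma number_field_integral_primitive:
  assumes "number_field TYPE('k::field_char_0)"
  obtains \<theta> :: "'k::field_char_0" and f n where "integral_primitive \<theta> f n"
proof -
  note alg = number_field_algebraic[OF assms]
  obtain B :: "'k set" where B: "finite B" "rat_vs.span B = UNIV"
    using assms unfolding number_field_def by blast
  obtain \<eta> where \<eta>: "B \<subseteq> rat_adjoin \<eta>" using rat_adjoin_finite_union[OF alg B(1)] by blast
  have "rat_vs.subspace (rat_adjoin \<eta>)"
    unfolding rat_vs.subspace_def
    using rat_adjoin_of_rat[of 0 \<eta>] by (auto intro: rat_adjoin_add rat_adjoin_mult rat_adjoin_of_rat)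
  then have U: "rat_adjoin \<eta> = UNIV" using rat_vs.span_minimal[OF \<eta>] B(2) by blast
  obtain p where "p \<noteq> 0" "qeval p \<eta> = 0" using alg by blast
  then obtain N :: int where N: "N \<noteq> 0" "algebraic_int (of_int N * \<eta>)"
    by (rule algebraic_multiple_int)
  define \<theta> where "\<theta> = of_int N * \<eta>"
  have "\<eta> = of_rat (1 / of_int N) * \<theta>" using N(1) by (simp add: \<theta>_def of_rat_divide)
  then have "\<eta> \<in> rat_adjoin \<theta>"
    by (metis rat_adjoin_mult rat_adjoin_of_rat rat_adjoin_self)
  then have "rat_adjoin \<theta> = UNIV" using rat_adjoin_trans[of \<eta> \<theta>] U by blast
  moreover obtain f where "is_minpoly f \<theta>" using alg[of \<theta>] minpoly_exists by blast
  ultimately have "integral_primitive \<theta> f (degree f)"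
    using N(2) by unfold_locales (auto simp: \<theta>_def)
  then show thesis by (rule that)
qed

text \<open>The local degree. A complex place represents two embeddings, so products over
  \<open>S\<close> with these exponents are products over all embeddings.\<close>

definition weight :: "('k \<Rightarrow> complex) \<Rightarrow> nat" where
  "weight \<sigma> = (if real_valued \<sigma> then 1 else 2)"

lemma cnj_embedding: "field_embedding \<sigma> \<Longrightarrow> field_embedding (cnj \<circ> \<sigma>)"
  by (simp add: field_embedding_def)

lemma cnj_comp_cnj [simp]: "cnj \<circ> (cnj \<circ> \<sigma>) = \<sigma>"
  by (simp add: fun_eq_iff)

lemma cnj_real_valued: "real_valued \<sigma> \<Longrightarrow> cnj \<circ> \<sigma> = \<sigma>"
  by (auto simp: real_valued_def fun_eq_iff image_subset_iff Reals_cnj_iff)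

lemma real_valued_cnj [simp]: "real_valued (cnj \<circ> \<sigma>) \<longleftrightarrow> real_valued \<sigma>"
  by (simp add: real_valued_def image_subset_iff complex_is_Real_iff)

lemma embeddings_eq:
  assumes "embedding_system S"
  shows "embeddings = S \<union> (\<lambda>\<sigma>. cnj \<circ> \<sigma>) ` {\<sigma>\<in>S. \<not> real_valued \<sigma>}" (is "_ = S \<union> ?T")
    and "S \<inter> (\<lambda>\<sigma>. cnj \<circ> \<sigma>) ` {\<sigma>\<in>S. \<not> real_valued \<sigma>} = {}"
proof -
  have S: "field_embedding \<sigma>" if "\<sigma> \<in> S" for \<sigma>
    using assms that unfolding embedding_system_def by blast
  have real: "\<sigma> \<in> S" if "field_embedding \<sigma>" "real_valued \<sigma>" for \<sigma>
    using assms that unfolding embedding_system_def by blast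
  have cplx: "\<sigma> \<in> S \<longleftrightarrow> cnj \<circ> \<sigma> \<notin> S" if "field_embedding \<sigma>" "\<not> real_valued \<sigma>" for \<sigma>
    using assms that unfolding embedding_system_def by blast
  show "embeddings = S \<union> ?T"
  proof (intro equalityI subsetI)
    fix \<sigma> :: "'a \<Rightarrow> complex" assume "\<sigma> \<in> embeddings"
    then have s: "field_embedding \<sigma>" by (simp add: embeddings_def)
    show "\<sigma> \<in> S \<union> ?T"
    proof (cases "\<sigma> \<in> S")
      case False
      then have "\<not> real_valued \<sigma>" using real s by blast
      then have "cnj \<circ> \<sigma> \<in> S" using cplx[OF s] False by blast
      then have "\<sigma> \<in> ?T" using \<open>\<not> real_valued \<sigma>\<close> by (intro image_eqI[of _ _ "cnj \<circ> \<sigma>"]) auto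
      then show ?thesis by simp
    qed simp
  next
    fix \<sigma> assume "\<sigma> \<in> S \<union> ?T"
    then show "\<sigma> \<in> embeddings" using S cnj_embedding by (auto simp: embeddings_def)
  qed
  show "S \<inter> ?T = {}" using S cplx by auto
qed

lemma prod_embeddings:
  fixes F :: "('k::field_char_0 \<Rightarrow> complex) \<Rightarrow> 'b::comm_monoid_mult"
  assumes S: "embedding_system S" and fin: "finite (embeddings :: ('k \<Rightarrow> complex) set)"
    and F: "\<And>\<sigma>. F (cnj \<circ> \<sigma>) = F \<sigma>"
  shows "(\<Prod>\<sigma>\<in>embeddings. F \<sigma>) = (\<Prod>\<sigma>\<in>S. F \<sigma> ^ weight \<sigma>)"
proof -
  let ?N = "{\<sigma>\<in>S. \<not> real_valued \<sigma>}"
  have finS: "finite S" using fin by (rule rev_finite_subset) (simp add: embeddings_eq(1)[OF S])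
  have "inj_on (\<lambda>\<sigma>. cnj \<circ> \<sigma>) ?N"
    by (rule inj_on_inverseI[of _ "\<lambda>\<sigma>. cnj \<circ> \<sigma>"]) simp
  then have "(\<Prod>\<sigma>\<in>(\<lambda>\<sigma>. cnj \<circ> \<sigma>) ` ?N. F \<sigma>) = (\<Prod>\<sigma>\<in>?N. F \<sigma>)"
    by (simp add: prod.reindex F)
  also have "\<dots> = (\<Prod>\<sigma>\<in>S. if \<not> real_valued \<sigma> then F \<sigma> else 1)"
    using finS by (simp add: prod.inter_filter)
  finally have "(\<Prod>\<sigma>\<in>embeddings. F \<sigma>) = (\<Prod>\<sigma>\<in>S. F \<sigma>) * (\<Prod>\<sigma>\<in>S. if \<not> real_valued \<sigma> then F \<sigma> else 1)"
    unfolding embeddings_eq(1)[OF S]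
    using finS embeddings_eq(2)[OF S] by (subst prod.union_disjoint) auto
  also have "\<dots> = (\<Prod>\<sigma>\<in>S. F \<sigma> ^ weight \<sigma>)"
    unfolding prod.distrib[symmetric]
    by (intro prod.cong) (auto simp: weight_def power2_eq_square)
  finally show ?thesis .
qed

text \<open>The bound is stated for coefficients because \<open>degree p < card R\<close> would fail
  for the empty set.\<close>

lemma lagrange_interpolation:
  fixes R :: "'a::field set"
  assumes "finite R"
  shows "\<exists>p. (\<forall>i\<ge>card R. coeff p i = 0) \<and> (\<forall>r\<in>R. poly p r = w r)"
  using assms
proof (induction R)
  case empty
  then show ?case by (intro exI[of _ 0]) simp
next
  case (insert r R)
  then obtain p where p: "\<And>i. i \<ge> card R \<Longrightarrow> coeff p i = 0" "\<And>s. s \<in> R \<Longrightarrow> poly p s = w s" by blast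
  define q where "q = (\<Prod>s\<in>R. [:- s, 1:])"
  have qr: "poly q r \<noteq> 0" using insert.hyps by (auto simp: q_def poly_prod)
  have qs: "poly q s = 0" if "s \<in> R" for s using that insert.hyps by (auto simp: q_def poly_prod)
  have dq: "degree q = card R" by (simp add: q_def degree_prod_sum_eq)
  define t where "t = (w r - poly p r) / poly q r"
  have "coeff (p + Polynomial.smult t q) i = 0" if "i \<ge> card (insert r R)" for i
    using that insert.hyps p(1)[of i] dq by (simp add: coeff_eq_0)
  moreover have "poly (p + Polynomial.smult t q) s = w s" if "s \<in> insert r R" for s
    using that qr qs p(2) by (auto simp: t_def)
  ultimately show ?case by blast
qed

section \<open>Algebraic integers as a lattice in \<open>K_S\<close>\<close>

context integral_primitive
begin

definition basis_bound :: real where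
  "basis_bound = (\<Sum>\<sigma>\<in>(embeddings :: ('k \<Rightarrow> complex) set). \<Sum>j<n. cmod (\<sigma> \<theta>) ^ j)"

lemma basis_bound_pos: "basis_bound > 0"
proof -
  have "1 \<le> (\<Sum>j<n. cmod (\<sigma> \<theta>) ^ j)" for \<sigma> :: "'k \<Rightarrow> complex"
    using member_le_sum[of 0 "{..<n}" "\<lambda>j. cmod (\<sigma> \<theta>) ^ j"] n_pos by simp
  then have "(\<Sum>\<sigma>\<in>(embeddings :: ('k \<Rightarrow> complex) set). 1) \<le> basis_bound"
    unfolding basis_bound_def by (intro sum_mono)
  then show ?thesis using n_pos card_embeddings by simp
qed

lemma combination_bound:
  fixes \<sigma> :: "'k \<Rightarrow> complex"
  assumes "\<sigma> \<in> embeddings" "\<And>j. j < n \<Longrightarrow> cmod (c j) \<le> M" "M \<ge> 0"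
  shows "cmod (\<Sum>j<n. c j * \<sigma> \<theta> ^ j) \<le> M * basis_bound"
proof -
  have "cmod (\<Sum>j<n. c j * \<sigma> \<theta> ^ j) \<le> (\<Sum>j<n. M * cmod (\<sigma> \<theta>) ^ j)"
    using assms(2) by (intro sum_norm_le) (auto simp: norm_mult norm_power intro!: mult_right_mono)
  also have "\<dots> = M * (\<Sum>j<n. cmod (\<sigma> \<theta>) ^ j)" by (simp add: sum_distrib_left)
  also have "\<dots> \<le> M * basis_bound"
    unfolding basis_bound_def
    using assms(1,3) finite_embeddings by (intro mult_left_mono member_le_sum) (auto intro: sum_nonneg)
  finally show ?thesis .
qed

lemma embedding_combination:
  "\<sigma> \<in> embeddings \<Longrightarrow> \<sigma> (\<Sum>j<n. of_int (c j) * \<theta> ^ j) = (\<Sum>j<n. of_int (c j) * \<sigma> \<theta> ^ j)"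
  by (simp add: embedding_ring_map ring_map_sum ring_map_mult ring_map_power ring_map_of_int)

lemma integral_combination: "algebraic_int (\<Sum>j<n. of_int (c j) * \<theta> ^ j)"
  by (intro algebraic_int_sum algebraic_int_mult algebraic_int_power algebraic_int_of_int integral)

text \<open>The powers of \<open>\<theta>\<close> span \<open>K_S\<close> over the reals.
  Prescribing conjugate values at conjugate embeddings gives an interpolating polynomial, and
  averaging its coefficients with their conjugates makes them real.\<close>

lemma real_interpolation:
  assumes S: "embedding_system S" and z: "\<And>\<sigma>. \<sigma> \<in> S \<Longrightarrow> z \<sigma> \<in> coord_field \<sigma>"
  shows "\<exists>a::nat \<Rightarrow> real. \<forall>\<sigma>\<in>S. z \<sigma> = (\<Sum>j<n. of_real (a j) * \<sigma> \<theta> ^ j)"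
proof -
  define y where "y \<sigma> = (if \<sigma> \<in> S then z \<sigma> else cnj (z (cnj \<circ> \<sigma>)))" for \<sigma>
  define g where "g = the_inv_into embeddings (\<lambda>\<sigma>::'k \<Rightarrow> complex. \<sigma> \<theta>)"
  have g: "g (\<sigma> \<theta>) = \<sigma>" if "\<sigma> \<in> embeddings" for \<sigma>
    unfolding g_def using that bij_betw_imp_inj_on[OF embeddings_bij] by (rule the_inv_into_f_f[rotated])
  obtain p where p: "\<And>i. i \<ge> n \<Longrightarrow> coeff p i = 0" "\<And>r. r \<in> conj_roots \<Longrightarrow> poly p r = y (g r)"
    using lagrange_interpolation[OF finite_conj_roots, of "\<lambda>r. y (g r)"] card_conj_roots by auto
  have pe: "poly p r = (\<Sum>j<n. coeff p j * r ^ j)" for r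
  proof -
    have "degree p \<le> n - 1" using p(1) n_pos by (intro degree_le) auto
    then have "(\<Sum>i\<le>degree p. coeff p i * r ^ i) = (\<Sum>j<n. coeff p j * r ^ j)"
      using n_pos by (intro sum.mono_neutral_left) (auto simp: coeff_eq_0)
    then show ?thesis by (simp add: poly_altdef)
  qed
  have py: "poly p (\<sigma> \<theta>) = y \<sigma>" if "\<sigma> \<in> embeddings" for \<sigma>
    using p(2)[of "\<sigma> \<theta>"] g[OF that] embeddings_bij that by (auto simp: bij_betw_def)
  have "z \<sigma> = (\<Sum>j<n. of_real (Re (coeff p j)) * \<sigma> \<theta> ^ j)" if s: "\<sigma> \<in> S" for \<sigma>
  proof -
    have SE: "\<sigma> \<in> embeddings" if "\<sigma> \<in> S" for \<sigma> using that embeddings_eq(1)[OF S] by blast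
    have e: "\<sigma> \<in> embeddings" "cnj \<circ> \<sigma> \<in> embeddings"
      using SE[OF s] cnj_embedding by (auto simp: embeddings_def)
    have "y (cnj \<circ> \<sigma>) = cnj (z \<sigma>)"
    proof (cases "real_valued \<sigma>")
      case True
      then show ?thesis
        using z[OF s] s cnj_real_valued[OF True] by (simp add: y_def coord_field_def Reals_cnj_iff)
    next
      case False
      then have "cnj \<circ> \<sigma> \<notin> S" using s S unfolding embedding_system_def by blast
      then show ?thesis by (simp add: y_def)
    qed
    then have "poly p (cnj (\<sigma> \<theta>)) = cnj (z \<sigma>)" using py[OF e(2)] by simp
    then have "cnj (\<Sum>j<n. coeff p j * cnj (\<sigma> \<theta>) ^ j) = z \<sigma>" by (simp add: pe)
    then have c: "z \<sigma> = (\<Sum>j<n. cnj (coeff p j) * \<sigma> \<theta> ^ j)" by simp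
    have "z \<sigma> = (\<Sum>j<n. coeff p j * \<sigma> \<theta> ^ j)" using py[OF e(1)] s by (simp add: pe y_def)
    then have "z \<sigma> + z \<sigma> = (\<Sum>j<n. (coeff p j + cnj (coeff p j)) * \<sigma> \<theta> ^ j)"
      using c by (simp add: sum.distrib distrib_right)
    also have "\<dots> = 2 * (\<Sum>j<n. of_real (Re (coeff p j)) * \<sigma> \<theta> ^ j)"
      by (simp add: complex_add_cnj sum_distrib_left mult.assoc)
    finally show ?thesis by simp
  qed
  then show ?thesis by (intro exI[of _ "\<lambda>j. Re (coeff p j)"] ballI)
qed

end

text \<open>Z[\<open>\<theta>\<close>] may be smaller than the ring of integers, but it is already
  cobounded in \<open>K_S\<close>, by rounding real coordinates down, and the combinations with
  coefficients from 0 to \<open>N\<close> already give enough integers of size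
  \<open>N\<close>.\<close>

lemma
  assumes K: "number_field TYPE('k::field_char_0)" and S: "embedding_system (S :: ('k \<Rightarrow> complex) set)"
  shows finite_embedding_system: "finite S"
    and sum_weight: "(\<Sum>\<sigma>\<in>S. weight \<sigma>) = number_field_degree TYPE('k)"
    and number_field_degree_pos: "number_field_degree TYPE('k) > 0"
    and weighted_norm_ge_1: "\<And>x. algebraic_int x \<Longrightarrow> x \<noteq> 0 \<Longrightarrow> 1 \<le> (\<Prod>\<sigma>\<in>S. cmod (\<sigma> x) ^ weight \<sigma>)"
    and integers_cobounded: "\<exists>C. \<forall>z. (\<forall>\<sigma>\<in>S. z \<sigma> \<in> coord_field \<sigma>) \<longrightarrow>
          (\<exists>x. algebraic_int x \<and> (\<forall>\<sigma>\<in>S. cmod (z \<sigma> - \<sigma> x) \<le> C))"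
    and many_integers: "\<exists>C>0. \<forall>N. \<exists>P. finite P \<and> card P = (N + 1) ^ number_field_degree TYPE('k) \<and>
          (\<forall>x\<in>P. algebraic_int x \<and> (\<forall>\<sigma>\<in>S. cmod (\<sigma> x) \<le> C * real N))"
proof -
  obtain \<theta> :: 'k and f n where "integral_primitive \<theta> f n"
    using number_field_integral_primitive[OF K] by blast
  then interpret integral_primitive \<theta> f n .
  have SE: "\<sigma> \<in> embeddings" if "\<sigma> \<in> S" for \<sigma> using that embeddings_eq(1)[OF S] by blast
  show "finite S" by (rule finite_subset[OF _ finite_embeddings]) (use SE in blast)
  show "number_field_degree TYPE('k) > 0" using degree_eq n_pos by simp
  \<comment> \<open>Counting by exponents: the product of the constant 2 over all embeddings is
    \<open>2 ^ n\<close>, and over \<open>S\<close> with weights it is 2 to the sum of the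
    weights.\<close>
  have "(\<Prod>\<sigma>\<in>(embeddings :: ('k \<Rightarrow> complex) set). (2::nat)) = (\<Prod>\<sigma>\<in>S. 2 ^ weight \<sigma>)"
    by (rule prod_embeddings[OF S finite_embeddings]) simp
  then have "(2::nat) ^ n = 2 ^ (\<Sum>\<sigma>\<in>S. weight \<sigma>)" by (simp add: card_embeddings power_sum)
  then show "(\<Sum>\<sigma>\<in>S. weight \<sigma>) = number_field_degree TYPE('k)" by (simp add: degree_eq)
  show "1 \<le> (\<Prod>\<sigma>\<in>S. cmod (\<sigma> x) ^ weight \<sigma>)" if "algebraic_int x" "x \<noteq> 0" for x
    using norm_ge_1[OF that] prod_embeddings[OF S finite_embeddings, of "\<lambda>\<sigma>. cmod (\<sigma> x)"] by simp
  show "\<exists>C. \<forall>z. (\<forall>\<sigma>\<in>S. z \<sigma> \<in> coord_field \<sigma>) \<longrightarrow>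
          (\<exists>x. algebraic_int x \<and> (\<forall>\<sigma>\<in>S. cmod (z \<sigma> - \<sigma> x) \<le> C))"
  proof (intro exI[of _ "1 * basis_bound"] allI impI)
    fix z assume "\<forall>\<sigma>\<in>S. z \<sigma> \<in> coord_field \<sigma>"
    then obtain a :: "nat \<Rightarrow> real" where a: "\<And>\<sigma>. \<sigma> \<in> S \<Longrightarrow> z \<sigma> = (\<Sum>j<n. of_real (a j) * \<sigma> \<theta> ^ j)"
      using real_interpolation[OF S, of z] by blast
    define x where "x = (\<Sum>j<n. of_int \<lfloor>a j\<rfloor> * \<theta> ^ j)"
    have "cmod (z \<sigma> - \<sigma> x) \<le> 1 * basis_bound" if s: "\<sigma> \<in> S" for \<sigma>
    proof -
      have "z \<sigma> - \<sigma> x = (\<Sum>j<n. of_real (a j - of_int \<lfloor>a j\<rfloor>) * \<sigma> \<theta> ^ j)"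
        by (simp add: a[OF s] x_def embedding_combination[OF SE[OF s]] sum_subtractf left_diff_distrib)
      then show ?thesis
        using combination_bound[OF SE[OF s], of "\<lambda>j. of_real (a j - of_int \<lfloor>a j\<rfloor>)" 1]
        by (simp add: norm_of_real del: of_real_diff) linarith
    qed
    moreover have "algebraic_int x" unfolding x_def by (rule integral_combination)
    ultimately show "\<exists>x. algebraic_int x \<and> (\<forall>\<sigma>\<in>S. cmod (z \<sigma> - \<sigma> x) \<le> 1 * basis_bound)"
      by (intro exI[of _ x] conjI ballI)
  qed
  show "\<exists>C>0. \<forall>N. \<exists>P. finite P \<and> card P = (N + 1) ^ number_field_degree TYPE('k) \<and>
          (\<forall>x\<in>P. algebraic_int x \<and> (\<forall>\<sigma>\<in>S. cmod (\<sigma> x) \<le> C * real N))"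
  proof (intro exI[of _ basis_bound] conjI allI basis_bound_pos)
    fix N
    define D where "D = (\<Pi>\<^sub>E j\<in>{..<n}. {0..int N})"
    define h where "h c = (\<Sum>j<n. of_int (c j) * \<theta> ^ j)" for c
    have "inj_on h D"
    proof (rule inj_onI, rule ccontr)
      fix c c' assume c: "c \<in> D" "c' \<in> D" "h c = h c'" "c \<noteq> c'"
      then obtain j where j: "j < n" "c j \<noteq> c' j"
        by (metis D_def PiE_ext lessThan_iff)
      have "(\<Sum>j<n. of_rat (of_int (c j - c' j)) * \<theta> ^ j) = 0"
        using c(3) by (simp add: h_def left_diff_distrib sum_subtractf of_rat_diff)
      then have "rat_of_int (c j - c' j) = 0"
        using j(1) by (rule powers_independent)
      then show False using j(2) by simp
    qed
    then have "card (h ` D) = (N + 1) ^ number_field_degree TYPE('k)"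
      by (simp add: card_image D_def card_PiE degree_eq nat_add_distrib)
    moreover have "finite (h ` D)" by (simp add: D_def finite_PiE)
    moreover have "cmod (\<sigma> x) \<le> basis_bound * real N" if "x \<in> h ` D" "\<sigma> \<in> S" for x \<sigma>
    proof -
      obtain c where c: "c \<in> D" "x = h c" using \<open>x \<in> h ` D\<close> by blast
      have "\<bar>real_of_int (c j)\<bar> \<le> real N" if "j < n" for j
      proof -
        have "c j \<in> {0..int N}" using PiE_mem[OF c(1)[unfolded D_def], of j] that by simp
        then show ?thesis by auto
      qed
      then have "cmod (\<Sum>j<n. of_int (c j) * \<sigma> \<theta> ^ j) \<le> real N * basis_bound"
        by (intro combination_bound SE that) auto
      then show ?thesis
        using c by (simp add: h_def embedding_combination[OF SE[OF that(2)]] mult.commute)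
    qed
    ultimately show "\<exists>P. finite P \<and> card P = (N + 1) ^ number_field_degree TYPE('k) \<and>
          (\<forall>x\<in>P. algebraic_int x \<and> (\<forall>\<sigma>\<in>S. cmod (\<sigma> x) \<le> basis_bound * real N))"
      by (intro exI[of _ "h ` D"] conjI ballI) (auto simp: h_def integral_combination)
  qed
qed

text \<open>Two integers in the same cell of side 1/4 differ by an integer of absolute value at most
  1/2 at every place, so its norm is below one.\<close>

lemma finite_bounded_integers:
  assumes K: "number_field TYPE('k::field_char_0)" and S: "embedding_system (S :: ('k \<Rightarrow> complex) set)"
  shows "finite {x. algebraic_int x \<and> (\<forall>\<sigma>\<in>S. cmod (\<sigma> x) \<le> R)}" (is "finite ?B")
proof -
  define M where "M = \<lceil>4 * R\<rceil> + 1"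
  define cell where "cell x = (\<lambda>\<sigma>\<in>S. (\<lfloor>4 * Re (\<sigma> x)\<rfloor>, \<lfloor>4 * Im (\<sigma> x)\<rfloor>))" for x
  have fl: "\<lfloor>4 * t\<rfloor> \<in> {-M..M}" if "\<bar>t\<bar> \<le> R" for t
    using that unfolding M_def by (auto; linarith)
  have "cell ` ?B \<subseteq> (\<Pi>\<^sub>E \<sigma>\<in>S. {-M..M} \<times> {-M..M})"
  proof (intro image_subsetI PiE_I)
    fix x \<sigma> assume "x \<in> ?B" "\<sigma> \<in> S"
    then have "\<bar>Re (\<sigma> x)\<bar> \<le> R" "\<bar>Im (\<sigma> x)\<bar> \<le> R"
      using abs_Re_le_cmod[of "\<sigma> x"] abs_Im_le_cmod[of "\<sigma> x"] by fastforce+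
    then show "cell x \<sigma> \<in> {-M..M} \<times> {-M..M}"
      using fl \<open>\<sigma> \<in> S\<close> by (simp add: cell_def)
  qed (simp add: cell_def)
  then have "finite (cell ` ?B)"
    by (rule finite_subset) (intro finite_PiE finite_embedding_system[OF K S], simp)
  moreover have "inj_on cell ?B"
  proof (rule inj_onI, rule ccontr)
    fix x y assume xy: "x \<in> ?B" "y \<in> ?B" "cell x = cell y" "x \<noteq> y"
    have "cmod (\<sigma> (x - y)) \<le> 1/2" if s: "\<sigma> \<in> S" for \<sigma>
    proof -
      have "ring_map \<sigma>"
        using s embeddings_eq(1)[OF S] embedding_ring_map by blast
      then have d: "\<sigma> (x - y) = \<sigma> x - \<sigma> y" by (rule ring_map_diff)
      have "\<lfloor>4 * Re (\<sigma> x)\<rfloor> = \<lfloor>4 * Re (\<sigma> y)\<rfloor>" "\<lfloor>4 * Im (\<sigma> x)\<rfloor> = \<lfloor>4 * Im (\<sigma> y)\<rfloor>"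
        using fun_cong[OF xy(3), of \<sigma>] s by (simp_all add: cell_def)
      then have "\<bar>Re (\<sigma> x) - Re (\<sigma> y)\<bar> \<le> 1/4" "\<bar>Im (\<sigma> x) - Im (\<sigma> y)\<bar> \<le> 1/4"
        by linarith+
      then show ?thesis
        using cmod_le[of "\<sigma> x - \<sigma> y"] by (simp add: d)
    qed
    then have "(\<Prod>\<sigma>\<in>S. cmod (\<sigma> (x - y)) ^ weight \<sigma>) \<le> (\<Prod>\<sigma>\<in>S. (1/2) ^ weight \<sigma>)"
      by (intro prod_mono conjI power_mono) auto
    also have "\<dots> = (1/2) ^ number_field_degree TYPE('k)"
      by (simp add: power_sum[symmetric] sum_weight[OF K S] flip: power_divide)
    also have "\<dots> < 1" using number_field_degree_pos[OF K S] by (simp add: power_less_one_iff)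
    finally show False
      using weighted_norm_ge_1[OF K S, of "x - y"] xy algebraic_int_diff[of x y] by auto
  qed
  ultimately show ?thesis by (rule finite_imageD)
qed

section \<open>Schmidt's game on the unit interval\<close>

text \<open>At an endpoint half of the ball is lost, but for \<open>r \<le> 1/2\<close> one of the
  two halves always lies in the unit interval.\<close>

lemma unit_interval_segment:
  fixes x r :: real
  assumes "x \<in> {0..1}" "0 < r" "r \<le> 1/2"
  obtains a where "{a..a + r} \<subseteq> {0..1} \<inter> cball x r"
proof (cases "x \<le> 1/2")
  case True
  have "{x..x + r} \<subseteq> {0..1} \<inter> cball x r" using assms True by (auto simp: dist_real_def)
  then show thesis by (rule that)
next
  case False
  have "{x - r..x - r + r} \<subseteq> {0..1} \<inter> cball x r" using assms False by (auto simp: dist_real_def)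
  then show thesis by (rule that)
qed

text \<open>\<open>M + 1\<close> candidate centres with spacing \<open>4 * \<alpha> * r\<close> fit
  into a segment of length \<open>r\<close>, whence the value of \<open>\<alpha>\<close>. A point of
  \<open>Z\<close> comes closer than \<open>2 * \<alpha> * r\<close> to at most one of them, so some
  candidate is free.\<close>

lemma avoiding_move:
  fixes x r :: real
  assumes x: "x \<in> {0..1}" "0 < r" "r \<le> 1/2" and Z: "finite Z" "card Z \<le> M"
    and \<alpha>: "\<alpha> = 1 / (4 * (real M + 1))"
  obtains y where "y \<in> {0..1}" "cball y (\<alpha> * r) \<subseteq> cball x r"
    "\<And>z p. z \<in> Z \<Longrightarrow> p \<in> cball y (\<alpha> * r) \<Longrightarrow> \<alpha> * r \<le> \<bar>p - z\<bar>"
proof -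
  obtain a where a: "{a..a + r} \<subseteq> {0..1} \<inter> cball x r" using unit_interval_segment[OF x] .
  define y where "y k = a + (4 * real k + 2) * (\<alpha> * r)" for k
  have \<alpha>0: "\<alpha> > 0" using \<alpha> by simp
  then have h: "\<alpha> * r > 0" using x by simp
  have "\<exists>k\<le>M. \<forall>z\<in>Z. \<bar>y k - z\<bar> \<ge> 2 * (\<alpha> * r)"
  proof (rule ccontr)
    assume "\<not> ?thesis"
    then have "\<forall>k. \<exists>z. k \<le> M \<longrightarrow> z \<in> Z \<and> \<bar>y k - z\<bar> < 2 * (\<alpha> * r)" by (meson not_le)
    then obtain w where w: "\<And>k. k \<le> M \<Longrightarrow> w k \<in> Z" "\<And>k. k \<le> M \<Longrightarrow> \<bar>y k - w k\<bar> < 2 * (\<alpha> * r)"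
      by metis
    have "inj_on w {..M}"
    proof (rule inj_onI, rule ccontr)
      fix j k assume jk: "j \<in> {..M}" "k \<in> {..M}" "w j = w k" "j \<noteq> k"
      then have "\<bar>y j - y k\<bar> < 4 * (\<alpha> * r)" using w(2)[of j] w(2)[of k] by auto
      moreover have "y j - y k = 4 * (real j - real k) * (\<alpha> * r)" by (simp add: y_def algebra_simps)
      moreover have "\<bar>real j - real k\<bar> \<ge> 1" using jk(4) by linarith
      moreover have "1 * (\<alpha> * r) \<le> \<bar>real j - real k\<bar> * \<bar>\<alpha> * r\<bar>"
        using calculation(3) h by (intro mult_mono) auto
      ultimately show False by (simp only: abs_mult[of _ "\<alpha> * r"] abs_mult[of 4])
    qed
    then have "card (w ` {..M}) = M + 1" by (simp add: card_image)
    moreover have "card (w ` {..M}) \<le> card Z" using w(1) Z(1) by (intro card_mono) auto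
    ultimately show False using Z(2) by simp
  qed
  then obtain k where k: "k \<le> M" "\<And>z. z \<in> Z \<Longrightarrow> \<bar>y k - z\<bar> \<ge> 2 * (\<alpha> * r)" by blast
  have "(4 * real k + 4) * (\<alpha> * r) \<le> 4 * (real M + 1) * (\<alpha> * r)"
    using k(1) h by (intro mult_right_mono) auto
  also have "\<dots> = r" by (simp add: \<alpha>)
  finally have up: "(4 * real k + 4) * (\<alpha> * r) \<le> r" .
  have sub: "cball (y k) (\<alpha> * r) \<subseteq> {a..a + r}"
  proof
    fix p assume "p \<in> cball (y k) (\<alpha> * r)"
    then have "\<bar>y k - p\<bar> \<le> \<alpha> * r" by (simp add: dist_real_def)
    moreover have "real k * (\<alpha> * r) \<ge> 0" using h by simp
    ultimately show "p \<in> {a..a + r}" using up h unfolding y_def by (simp add: algebra_simps) linarith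
  qed
  show thesis
  proof
    have "y k \<in> cball (y k) (\<alpha> * r)" using h by simp
    then show "y k \<in> {0..1}" using sub a by blast
    show "cball (y k) (\<alpha> * r) \<subseteq> cball x r" using sub a by blast
    fix z p assume "z \<in> Z" "p \<in> cball (y k) (\<alpha> * r)"
    then have "2 * (\<alpha> * r) \<le> \<bar>y k - z\<bar>" "\<bar>y k - p\<bar> \<le> \<alpha> * r" using k(2) by (auto simp: dist_real_def)
    then show "\<alpha> * r \<le> \<bar>p - z\<bar>" by linarith
  qed
qed

text \<open>Separates the game from the arithmetic: once A's radius is at most 1/2, B moves away
  from at most \<open>M\<close> points attached to A's ball, and \<open>win\<close> has to be
  checked for outcomes alone. The points \<open>Z x r\<close> depend on the current ball only, so
  the strategy has no memory.\<close>

lemma alpha_winning_by_avoidance: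
  fixes Z :: "real \<Rightarrow> real \<Rightarrow> real set"
  assumes Z: "\<And>x r. finite (Z x r)" "\<And>x r. card (Z x r) \<le> M" and W: "W \<subseteq> {0..1}"
    and \<alpha>: "\<alpha> = 1 / (4 * (real M + 1))"
    and win: "\<And>p \<rho> \<beta> x. 0 < \<rho> \<Longrightarrow> 0 < \<beta> \<Longrightarrow> \<beta> < 1 \<Longrightarrow> p \<in> {0..1} \<Longrightarrow>
        (\<And>n. x n \<in> {0..1}) \<Longrightarrow> (\<And>n. p \<in> cball (x n) ((\<alpha> * \<beta>) ^ n * \<rho>)) \<Longrightarrow>
        (\<And>n z. (\<alpha> * \<beta>) ^ n * \<rho> \<le> 1/2 \<Longrightarrow> z \<in> Z (x n) ((\<alpha> * \<beta>) ^ n * \<rho>) \<Longrightarrow>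
            \<alpha> * ((\<alpha> * \<beta>) ^ n * \<rho>) \<le> \<bar>p - z\<bar>) \<Longrightarrow> p \<in> W"
  shows "alpha_winning {0..1} \<alpha> W"
  unfolding alpha_winning_def
proof (intro allI impI)
  fix \<beta> :: real assume \<beta>: "0 < \<beta> \<and> \<beta> < 1"
  have \<alpha>01: "0 < \<alpha>" "\<alpha> < 1"
    using \<alpha> by (simp, unfold \<alpha>, subst divide_less_eq_1_pos) auto
  define good where "good x r y \<longleftrightarrow> y \<in> {0..1} \<and> cball y (\<alpha> * r) \<subseteq> cball x r \<and>
      (r \<le> 1/2 \<longrightarrow> (\<forall>z\<in>Z x r. \<forall>p\<in>cball y (\<alpha> * r). \<alpha> * r \<le> \<bar>p - z\<bar>))" for x r y
  have ex: "\<exists>y. good x r y" if xr: "x \<in> {0..1}" "0 < r" for x r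
  proof (cases "r \<le> 1/2")
    case True
    show ?thesis
    proof (rule avoiding_move[OF xr True Z[of x r] \<alpha>])
      fix y assume "y \<in> {0..1}" "cball y (\<alpha> * r) \<subseteq> cball x r"
        "\<And>z p. z \<in> Z x r \<Longrightarrow> p \<in> cball y (\<alpha> * r) \<Longrightarrow> \<alpha> * r \<le> \<bar>p - z\<bar>"
      then have "good x r y" unfolding good_def by blast
      then show ?thesis by (rule exI)
    qed
  next
    case False
    have "\<alpha> * r \<le> r" using \<alpha>01 that by simp
    then have "cball x (\<alpha> * r) \<subseteq> cball x r" by (rule subset_cball)
    then show ?thesis using False that by (auto simp: good_def intro!: exI[of _ x])
  qed
  \<comment> \<open>The length of the list of A's centres tells the stage and with it the
    radius.\<close>
  define f where "f \<rho> xs = (SOME y. good (last xs) ((\<alpha> * \<beta>) ^ (length xs - 1) * \<rho>) y)" for \<rho> xs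
  have "B_winning_strategy {0..1} W \<alpha> \<beta> f"
    unfolding B_winning_strategy_def
  proof (intro allI impI, elim conjE)
    fix \<rho> :: real and x y :: "nat \<Rightarrow> real"
    assume \<rho>: "\<rho> > 0" and y: "\<forall>n. y n = f \<rho> (map x [0..<Suc n])"
    define r where "r n = (\<alpha> * \<beta>) ^ n * \<rho>" for n
    have r0: "r n > 0" for n using \<alpha>01 \<beta> \<rho> by (simp add: r_def)
    have gd: "good (x n) (r n) (y n)" if "x n \<in> {0..1}" for n
    proof -
      have "y n = (SOME y. good (x n) (r n) y)" using y by (simp add: f_def r_def)
      then show ?thesis using someI_ex[OF ex[OF that r0]] by simp
    qed
    have Blegal: "B_legal {0..1} \<alpha> \<beta> \<rho> x y n" if "A_legal {0..1} \<alpha> \<beta> \<rho> x y n" for n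
      using gd[of n] that unfolding B_legal_def A_legal_def B_ball_def A_ball_def good_def r_def
      by (auto simp: mult.assoc)
    show "(\<forall>n. (\<forall>m\<le>n. A_legal {0..1} \<alpha> \<beta> \<rho> x y m) \<longrightarrow> B_legal {0..1} \<alpha> \<beta> \<rho> x y n) \<and>
        ((\<forall>n. A_legal {0..1} \<alpha> \<beta> \<rho> x y n) \<longrightarrow> (\<exists>p\<in>W. (\<Inter>n. A_ball {0..1} \<alpha> \<beta> \<rho> x n) = {p}))"
    proof (intro conjI allI impI)
      fix n assume "\<forall>m\<le>n. A_legal {0..1} \<alpha> \<beta> \<rho> x y m"
      then show "B_legal {0..1} \<alpha> \<beta> \<rho> x y n" using Blegal by simp
    next
      assume A: "\<forall>n. A_legal {0..1} \<alpha> \<beta> \<rho> x y n"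
      let ?A = "A_ball {0..1} \<alpha> \<beta> \<rho> x"
      have xin: "x n \<in> {0..1}" for n using A by (simp add: A_legal_def)
      have AB: "?A (Suc n) \<subseteq> B_ball {0..1} \<alpha> \<beta> \<rho> y n" for n
        using spec[OF A, of "Suc n"] by (simp add: A_legal_def)
      have dec: "decseq ?A"
        using AB Blegal A by (intro decseq_SucI) (meson B_legal_def order_trans)
      have "\<exists>p. \<Inter>(range ?A) = {p}"
      proof (rule decreasing_closed_nest_sing)
        show "closed (?A n)" for n by (simp add: A_ball_def closed_Int)
        show "?A n \<noteq> {}" for n using xin[of n] r0[of n] by (auto simp: A_ball_def r_def)
        show "?A n \<subseteq> ?A m" if "m \<le> n" for m n using decseqD[OF dec that] .
        fix e :: real assume e: "e > 0"
        have "\<alpha> * \<beta> < 1 * 1" using \<alpha>01 \<beta> by (intro mult_strict_mono) auto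
        then have "r \<longlonglongrightarrow> 0" unfolding r_def using \<alpha>01 \<beta> \<rho> by (intro tendsto_mult_left_zero LIMSEQ_realpow_zero) auto
        then have "eventually (\<lambda>n. r n < e / 2) sequentially" using e by (intro order_tendstoD) auto
        then obtain n where n: "r n < e / 2" by (auto simp: eventually_sequentially)
        have "dist u v < e" if "u \<in> ?A n" "v \<in> ?A n" for u v
        proof -
          have "dist (x n) u \<le> r n" "dist (x n) v \<le> r n" using that by (auto simp: A_ball_def r_def)
          then show ?thesis using n by (simp add: dist_real_def)
        qed
        then show "\<exists>n. \<forall>u\<in>?A n. \<forall>v\<in>?A n. dist u v < e" by blast
      qed
      then obtain p where p: "\<Inter>(range ?A) = {p}" by blast
      then have pA: "p \<in> ?A n" for n by blast
      have "p \<in> W"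
      proof (rule win[OF \<rho>])
        show "0 < \<beta>" "\<beta> < 1" using \<beta> by auto
        show "p \<in> {0..1}" using pA[of 0] by (simp add: A_ball_def)
        show "x n \<in> {0..1}" for n using xin .
        show "p \<in> cball (x n) ((\<alpha> * \<beta>) ^ n * \<rho>)" for n using pA[of n] by (simp add: A_ball_def)
        fix n z assume "(\<alpha> * \<beta>) ^ n * \<rho> \<le> 1/2" "z \<in> Z (x n) ((\<alpha> * \<beta>) ^ n * \<rho>)"
        moreover have "p \<in> cball (y n) (\<alpha> * r n)"
          using pA[of "Suc n"] AB[of n] by (auto simp: B_ball_def r_def mult.assoc)
        ultimately show "\<alpha> * ((\<alpha> * \<beta>) ^ n * \<rho>) \<le> \<bar>p - z\<bar>"
          using gd[OF xin, of n] by (simp add: good_def r_def)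
      qed
      then show "\<exists>p\<in>W. \<Inter>(range ?A) = {p}" using p by blast
    qed
  qed
  then show "alpha_beta_winning {0..1} \<alpha> \<beta> W" using W unfolding alpha_beta_winning_def by blast
qed

section \<open>Hausdorff dimension of winning sets\<close>

text \<open>\<open>N\<close> intervals of length \<open>1 / N\<close> have total weight
  \<open>N powr (1 - s)\<close>, which tends to 0.\<close>

lemma hausdorff_measure_unit_interval_zero:
  fixes E :: "real set"
  assumes E: "E \<subseteq> {0..1}" and s: "1 < s"
  shows "hausdorff_measure s E = 0"
proof -
  have bound: "hausdorff_premeasure \<delta> s E \<le> ennreal e" if \<delta>: "\<delta> > 0" and e: "e > 0" for \<delta> e
  proof -
    have "(\<lambda>N. (1 / real N) powr (s - 1)) \<longlonglongrightarrow> 0"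
    proof (rule tendsto_eq_rhs[OF tendsto_powr'[where a=0 and b="s - 1"]])
      show "(\<lambda>N. 1 / real N) \<longlonglongrightarrow> 0" by (rule lim_1_over_n)
    qed (use s in auto)
    then have "eventually (\<lambda>N. (1 / real N) powr (s - 1) < e) sequentially"
      using e by (intro order_tendstoD) auto
    moreover have "eventually (\<lambda>N. 1 / real N < \<delta>) sequentially"
      using lim_1_over_n \<delta> by (intro order_tendstoD) auto
    ultimately have "eventually (\<lambda>N. (1 / real N) powr (s - 1) < e \<and> 1 / real N < \<delta> \<and> N > 0) sequentially"
      by (intro eventually_conj eventually_gt_at_top)
    then obtain N where N: "(1 / real N) powr (s - 1) < e" "1 / real N < \<delta>" "N > 0"
      by (auto simp: eventually_sequentially)
    define U where "U i = (if i < N then {real i / real N..real i / real N + 1 / real N} else {})" for i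
    have diam: "diameter (U i) = (if i < N then 1 / real N else 0)" for i
      using N(3) by (simp add: U_def diameter_closed_interval)
    have cover: "E \<subseteq> (\<Union>i. U i)"
    proof
      fix x assume "x \<in> E"
      then have x: "0 \<le> x" "x \<le> 1" using E by auto
      \<comment> \<open>At \<open>x = 1\<close> the floor would be \<open>N\<close>, one past the
        last interval.\<close>
      define i where "i = (if x = 1 then N - 1 else nat \<lfloor>x * real N\<rfloor>)"
      have "i < N \<and> real i \<le> x * real N \<and> x * real N \<le> real i + 1"
      proof (cases "x = 1")
        case False
        then have "x * real N < real N" using x N(3) by simp
        then have "\<lfloor>x * real N\<rfloor> < int N" by (simp add: floor_less_iff)
        moreover have "0 \<le> \<lfloor>x * real N\<rfloor>" using x N(3) by simp
        ultimately show ?thesis using False unfolding i_def by (simp; linarith)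
      qed (use N(3) in \<open>auto simp: i_def of_nat_diff\<close>)
      then have "x \<in> U i" using N(3) by (auto simp: U_def field_simps)
      then show "x \<in> (\<Union>i. U i)" by blast
    qed
    have "hausdorff_premeasure \<delta> s E \<le> (\<Sum>i. ennreal (diameter (U i) powr s))"
      unfolding hausdorff_premeasure_def
      by (rule INF_lower) (use cover N \<delta> in \<open>auto simp: diam, auto simp: U_def\<close>)
    also have "\<dots> = (\<Sum>i<N. ennreal (diameter (U i) powr s))"
      by (rule suminf_finite) (auto simp: diam)
    also have "\<dots> = ennreal (\<Sum>i<N. (1 / real N) powr s)"
      by (subst sum_ennreal) (auto simp: diam)
    also have "(\<Sum>i<N. (1 / real N) powr s) = (1 / real N) powr (s - 1)"
      using N(3) by (simp add: powr_diff)
    also have "ennreal \<dots> \<le> ennreal e" using N(1) by (intro ennreal_leI) simp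
    finally show ?thesis .
  qed
  have "hausdorff_premeasure \<delta> s E \<le> 0" if "\<delta> > 0" for \<delta>
  proof (rule ennreal_le_epsilon)
    show "hausdorff_premeasure \<delta> s E \<le> 0 + ennreal e" if "e > 0" for e
      using bound[OF \<open>\<delta> > 0\<close> that] by simp
  qed
  then have "hausdorff_measure s E \<le> 0"
    unfolding hausdorff_measure_def by (intro SUP_least) simp
  then show ?thesis by simp
qed

section \<open>Lower bound for the dimension of winning sets\<close>

lemma hausdorff_measure_zero_cover:
  assumes "hausdorff_measure s E = 0" "c > 0"
  obtains U :: "nat \<Rightarrow> 'a::metric_space set"
  where "E \<subseteq> (\<Union>i. U i)" "\<And>i. bounded (U i)" "(\<Sum>i. ennreal (diameter (U i) powr s)) < ennreal c"
proof -
  have "hausdorff_premeasure 1 s E \<le> hausdorff_measure s E"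
    unfolding hausdorff_measure_def by (rule SUP_upper) simp
  then have "hausdorff_premeasure 1 s E < ennreal c" using assms by simp
  then obtain U where "E \<subseteq> (\<Union>i. U i)" "\<forall>i. bounded (U i) \<and> diameter (U i) \<le> 1"
    "(\<Sum>i. ennreal (diameter (U i) powr s)) < ennreal c"
    unfolding hausdorff_premeasure_def INF_less_iff by blast
  then show thesis using that by blast
qed

text \<open>The weights exceed the \<open>s\<close>-th powers of the diameters and are positive, so that covering
  sets reduced to a point cannot catch the outcome of the play.\<close>

lemma hausdorff_measure_zero_weights:
  fixes E :: "'a::metric_space set"
  assumes "hausdorff_measure s E = 0" "c > 0"
  obtains U w where "E \<subseteq> (\<Union>i::nat. U i)" "\<And>i. bounded (U i)" "\<And>i. w i > (0::real)"
    "\<And>i. diameter (U i) powr s \<le> w i" "summable w" "suminf w \<le> c"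
proof -
  have "c / 2 > 0" using assms(2) by simp
  then obtain U where U: "E \<subseteq> (\<Union>i. U i)" "\<And>i. bounded (U i)"
    "(\<Sum>i. ennreal (diameter (U i) powr s)) < ennreal (c / 2)"
    by (rule hausdorff_measure_zero_cover[OF assms(1)]) (rule that, assumption+)
  define d where "d i = diameter (U i) powr s" for i
  have sd: "summable d"
    by (rule summable_suminf_not_top) (use U(3) in \<open>auto simp: d_def top_unique\<close>)
  have "ennreal (suminf d) < ennreal (c / 2)"
    using U(3) sd by (subst suminf_ennreal2[symmetric]) (auto simp: d_def)
  then have d: "suminf d < c / 2" by (subst (asm) ennreal_less_iff) (auto intro!: suminf_nonneg sd simp: d_def)
  define g where "g i = c / 2 * (1 / 2) ^ Suc i" for i
  have g: "g sums (c / 2 * 1)" unfolding g_def by (intro sums_mult power_half_series)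
  show thesis
  proof (rule that[of U "\<lambda>i. d i + g i"])
    show "0 < d i + g i" for i using assms(2) by (auto simp: d_def g_def intro!: add_nonneg_pos)
    show "diameter (U i) powr s \<le> d i + g i" for i using assms(2) by (simp add: d_def g_def)
    show "summable (\<lambda>i. d i + g i)" using sd g by (intro summable_add) (auto simp: sums_iff)
    have "suminf (\<lambda>i. d i + g i) = suminf d + c / 2"
      using sd g by (subst suminf_add[symmetric]) (auto simp: sums_iff)
    then show "suminf (\<lambda>i. d i + g i) \<le> c" using d by simp
  qed (use U in auto)
qed

text \<open>For one covering set: the balls into which A may move are so far apart that the set
  meets at most one of them, so its weight is counted at most once.\<close>

lemma sum_if_unique_le:
  fixes w :: real and N :: nat
  assumes "w \<ge> 0" "\<And>j k. j < N \<Longrightarrow> k < N \<Longrightarrow> P j \<Longrightarrow> P k \<Longrightarrow> j = k" "\<And>k. k < N \<Longrightarrow> P k \<Longrightarrow> Q"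
  shows "(\<Sum>k<N. if P k then w else 0) \<le> (if Q then w else 0)"
proof (cases "\<exists>k<N. P k")
  case True
  then obtain k where k: "k < N" "P k" by blast
  have "(\<Sum>j<N. if P j then w else 0) = (\<Sum>j<N. if j = k then w else 0)"
    using assms(2) k by (intro sum.cong) auto
  then show ?thesis using k assms(3)[OF k] by simp
next
  case False
  then have "(\<Sum>j<N. if P j then w else 0) = 0" by (intro sum.neutral) auto
  then show ?thesis using assms(1) by simp
qed

text \<open>With \<open>\<beta> = 1 / (4 * N)\<close> each radius of A is
  \<open>\<alpha> * \<beta>\<close> times the last one; the choice among \<open>N\<close> balls
  outweighs this shrinking in dimension \<open>s\<close> once
  \<open>N * (\<alpha> * \<beta>) powr s \<ge> 1\<close>, that is
  \<open>N powr (1 - s) \<ge> (4 / \<alpha>) powr s\<close>. This is where \<open>s < 1\<close>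
  enters.\<close>

lemma exists_branching_number:
  fixes \<alpha> s :: real
  assumes "0 < \<alpha>" "0 < s" "s < 1"
  obtains N :: nat where "N > 0" "1 / real N \<le> (\<alpha> * (1 / (4 * real N))) powr s"
proof -
  define A where "A = 4 / \<alpha>"
  define N where "N = nat \<lceil>A powr (s / (1 - s))\<rceil> + 1"
  have A: "A > 0" using assms by (simp add: A_def)
  have N0: "real N > 0" unfolding N_def by linarith
  have "A powr (s / (1 - s)) \<le> real N" unfolding N_def by linarith
  then have "(A powr (s / (1 - s))) powr (1 - s) \<le> real N powr (1 - s)"
    using assms by (intro powr_mono2) auto
  then have "A powr s \<le> real N powr (1 - s)" using assms by (simp add: powr_powr)
  then have "A powr s * real N powr s \<le> real N powr (1 - s) * real N powr s"
    by (intro mult_right_mono) auto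
  also have "\<dots> = real N" using N0 by (simp flip: powr_add)
  finally have "(A * real N) powr s \<le> real N" using A by (simp add: powr_mult)
  then have "1 / real N \<le> 1 / (A * real N) powr s" using A N0 by (intro divide_left_mono) auto
  also have "\<dots> = (1 / (A * real N)) powr s" using A N0 by (subst powr_divide) auto
  also have "1 / (A * real N) = \<alpha> * (1 / (4 * real N))" by (simp add: A_def)
  finally show thesis using that[of N] N0 by simp
qed

text \<open>Player A descends, among many disjoint balls inside the last ball of Player B, to one that
  meets little of the cover; the outcome of the play then lies outside the cover.\<close>

lemma winning_hausdorff_measure_pos:
  assumes win: "alpha_winning {0..1} \<alpha> W" and \<alpha>: "0 < \<alpha>" "\<alpha> < 1" and s: "0 < s" "s < 1"
  shows "hausdorff_measure s (W :: real set) \<noteq> 0"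
proof
  assume zero: "hausdorff_measure s W = 0"
  obtain N :: nat where N: "N > 0" "1 / real N \<le> (\<alpha> * (1 / (4 * real N))) powr s"
    using exists_branching_number[OF \<alpha>(1) s] .
  define \<beta> where "\<beta> = 1 / (4 * real N)"
  have \<beta>: "0 < \<beta>" "\<beta> < 1" using N(1) by (auto simp: \<beta>_def)
  define \<kappa> where "\<kappa> = \<alpha> * \<beta>"
  have "\<kappa> < 1 * 1" unfolding \<kappa>_def using \<alpha> \<beta> by (intro mult_strict_mono) auto
  then have \<kappa>: "0 < \<kappa>" "\<kappa> < 1" using \<alpha> \<beta> by (simp_all add: \<kappa>_def)
  have N\<kappa>: "1 \<le> real N * \<kappa> powr s" using N by (simp add: \<kappa>_def \<beta>_def field_simps)
  define r where "r n = \<kappa> ^ n * (1/2)" for n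
  have r: "0 < r n" "r n \<le> 1/2" "r (Suc n) = \<kappa> * r n" for n
    using \<kappa> power_le_one[of \<kappa> n] by (auto simp: r_def)
  \<comment> \<open>If \<open>w i \<le> c0 * q powr s\<close>, then the diameter of
    \<open>U i\<close> is at most \<open>\<kappa> * q\<close>, the radius of A's next ball.\<close>
  define c0 where "c0 = \<kappa> powr s"
  have c0: "c0 > 0" using \<kappa> by (simp add: c0_def)
  \<comment> \<open>Makes the invariant \<open>wt T \<le> c0 * q powr s\<close> hold at the first
    ball, of radius \<open>q = 1/2\<close>.\<close>
  define c where "c = c0 * (1/2) powr s"
  have "c > 0" using c0 by (simp add: c_def)
  then obtain U w where Uw: "W \<subseteq> (\<Union>i::nat. U i)" "\<And>i. bounded (U i)" "\<And>i. w i > (0::real)"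
    "\<And>i. diameter (U i) powr s \<le> w i" "summable w" "suminf w \<le> c"
    by (rule hausdorff_measure_zero_weights[OF zero]) (rule that, assumption+)
  define wt where "wt T = (\<Sum>i. if U i \<inter> T \<noteq> {} then w i else 0)" for T
  have wt_summable: "summable (\<lambda>i. if U i \<inter> T \<noteq> {} then w i else 0)" for T
    by (rule summable_comparison_test'[OF Uw(5), of 0]) (use Uw(3) in \<open>auto intro: less_imp_le\<close>)
  have wt_ge: "w i \<le> wt T" if "U i \<inter> T \<noteq> {}" for i T
  proof -
    have "(\<Sum>j\<in>{i}. if U j \<inter> T \<noteq> {} then w j else 0) \<le> wt T"
      unfolding wt_def by (intro sum_le_suminf wt_summable) (use Uw(3) in \<open>auto intro: less_imp_le\<close>)
    then show ?thesis using that by simp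
  qed
  \<comment> \<open>One round: A answers B's ball by one of \<open>N\<close> smaller balls, in such
    a way that the invariant passes from radius \<open>q\<close> to radius
    \<open>\<kappa> * q\<close>.\<close>
  have child: "\<exists>c\<in>{0..1}. {0..1} \<inter> cball c (\<kappa> * q) \<subseteq> {0..1} \<inter> cball y (\<alpha> * q) \<and>
      wt ({0..1} \<inter> cball c (\<kappa> * q)) \<le> c0 * (\<kappa> * q) powr s"
    if y: "y \<in> {0..1}" and sub: "{0..1} \<inter> cball y (\<alpha> * q) \<subseteq> T" and T: "wt T \<le> c0 * q powr s"
      and q: "0 < q" "q \<le> 1/2" for y T q
  proof -
    have "\<alpha> * q \<le> 1 * (1/2)" using \<alpha> q by (intro mult_mono) auto
    then obtain a where a: "{a..a + \<alpha> * q} \<subseteq> {0..1} \<inter> cball y (\<alpha> * q)"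
      using unit_interval_segment[OF y, of "\<alpha> * q"] \<alpha> q by auto
    define h where "h = \<kappa> * q"
    have h: "h > 0" using \<kappa> q by (simp add: h_def)
    have Nh: "4 * real N * h = \<alpha> * q" using N(1) by (simp add: h_def \<kappa>_def \<beta>_def)
    define m where "m k = a + (4 * real k + 2) * h" for k
    define ch where "ch k = {0..1} \<inter> cball (m k) h" for k
    have chsub: "cball (m k) h \<subseteq> {a..a + \<alpha> * q}" if "k < N" for k
    proof
      fix p assume "p \<in> cball (m k) h"
      then have "\<bar>m k - p\<bar> \<le> h" by (simp add: dist_real_def)
      moreover have "real k * h \<ge> 0" using h by simp
      moreover have "(4 * real k + 4) * h \<le> 4 * real N * h"
        using that h by (intro mult_right_mono) auto
      moreover have "m k = a + 4 * (real k * h) + 2 * h" "(4 * real k + 4) * h = 4 * (real k * h) + 4 * h"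
        by (simp_all add: m_def algebra_simps)
      ultimately have "a \<le> p" "p \<le> a + \<alpha> * q" using h Nh by linarith+
      then show "p \<in> {a..a + \<alpha> * q}" by simp
    qed
    have unique: "j = k" if jk: "j < N" "k < N" "U i \<inter> ch j \<noteq> {}" "U i \<inter> ch k \<noteq> {}" for i j k
    proof (rule ccontr)
      assume "j \<noteq> k"
      obtain p p' where p: "p \<in> U i" "p \<in> ch j" "p' \<in> U i" "p' \<in> ch k" using jk by blast
      have "p \<in> T" using p(2) chsub[OF jk(1)] a sub unfolding ch_def by blast
      then have "w i \<le> wt T" using p(1) by (intro wt_ge) blast
      then have "diameter (U i) powr s \<le> (\<kappa> * q) powr s"
        using Uw(4)[of i] T \<kappa> q by (simp add: c0_def powr_mult)
      then have "diameter (U i) \<le> h"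
        using powr_less_mono2[of s h "diameter (U i)"] s h unfolding h_def by (meson less_imp_le not_le)
      moreover have "dist p p' \<le> diameter (U i)" using diameter_bounded_bound[OF Uw(2)] p by blast
      ultimately have "\<bar>p - p'\<bar> \<le> h" by (simp add: dist_real_def)
      moreover have "\<bar>m j - p\<bar> \<le> h" "\<bar>m k - p'\<bar> \<le> h" using p by (auto simp: ch_def dist_real_def)
      \<comment> \<open>Impossible, as distinct centres are at least \<open>4 * h\<close>
        apart.\<close>
      ultimately have "\<bar>m j - m k\<bar> \<le> 3 * h" by linarith
      moreover have "m j - m k = 4 * (real j - real k) * h" by (simp add: m_def algebra_simps)
      moreover have "1 * h \<le> \<bar>real j - real k\<bar> * h"
        using \<open>j \<noteq> k\<close> h by (intro mult_right_mono) linarith+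
      ultimately show False using h by (simp add: abs_mult)
    qed
    have meets: "U i \<inter> T \<noteq> {}" if "k < N" "U i \<inter> ch k \<noteq> {}" for i k
      using that chsub[of k] a sub unfolding ch_def by blast
    have "(\<Sum>k<N. wt (ch k)) = (\<Sum>i. \<Sum>k<N. if U i \<inter> ch k \<noteq> {} then w i else 0)"
      unfolding wt_def by (rule suminf_sum[symmetric]) (rule wt_summable)
    also have "\<dots> \<le> wt T"
      unfolding wt_def
      by (intro suminf_le sum_if_unique_le summable_sum wt_summable less_imp_le[OF Uw(3)])
        (use unique meets in blast)+
    finally have le: "(\<Sum>k<N. wt (ch k)) \<le> c0 * q powr s" using T by simp
    \<comment> \<open>Otherwise the \<open>N\<close> children together would exceed the bound for
      \<open>T\<close>, by the choice of \<open>N\<close>.\<close>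
    have "\<exists>k<N. wt (ch k) \<le> c0 * (\<kappa> * q) powr s"
    proof (rule ccontr)
      assume "\<not> ?thesis"
      then have "(\<Sum>k<N. c0 * (\<kappa> * q) powr s) < (\<Sum>k<N. wt (ch k))"
        using N(1) by (intro sum_strict_mono) auto
      then have "real N * (c0 * (\<kappa> * q) powr s) < c0 * q powr s" using le by simp
      also have "c0 * q powr s * 1 \<le> c0 * q powr s * (real N * \<kappa> powr s)"
        using N\<kappa> c0 by (intro mult_left_mono) auto
      also have "\<dots> = real N * (c0 * (\<kappa> * q) powr s)" using \<kappa> q by (simp add: powr_mult)
      finally show False by simp
    qed
    then obtain k where k: "k < N" "wt (ch k) \<le> c0 * (\<kappa> * q) powr s" by blast
    have "m k \<in> {0..1}" using chsub[OF k(1)] a h centre_in_cball[of "m k" h] by (meson IntD1 less_imp_le subsetD)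
    then show ?thesis
      using k(2) chsub[OF k(1)] a unfolding ch_def h_def by (intro bexI[of _ "m k"]) auto
  qed
  have "alpha_beta_winning {0..1} \<alpha> \<beta> W" using win \<beta> by (simp add: alpha_winning_def)
  then obtain f where f: "B_winning_strategy {0..1} W \<alpha> \<beta> f" by (auto simp: alpha_beta_winning_def)
  define good where "good n y c \<longleftrightarrow> c \<in> {0..1} \<and> {0..1} \<inter> cball c (r (Suc n)) \<subseteq> {0..1} \<inter> cball y (\<alpha> * r n) \<and>
      wt ({0..1} \<inter> cball c (r (Suc n))) \<le> c0 * r (Suc n) powr s" for n y c
  define nxt where "nxt n y = (SOME c. good n y c)" for n y
  \<comment> \<open>A's moves are recorded as a list, since \<open>f\<close> takes the whole
    history; the centres are the last entries of these lists.\<close>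
  define hist where "hist = rec_nat [1/2] (\<lambda>n h. h @ [nxt n (f (1/2) h)])"
  have hist: "hist 0 = [1/2]" "\<And>n. hist (Suc n) = hist n @ [nxt n (f (1/2) (hist n))]"
    by (simp_all add: hist_def)
  define x where "x n = last (hist n)" for n
  have map_x: "map x [0..<Suc n] = hist n" for n
    by (induction n) (simp_all add: x_def hist)
  define y where "y n = f (1/2) (hist n)" for n
  have yf: "\<forall>n. y n = f (1/2) (map x [0..<Suc n])" using map_x by (simp add: y_def del: upt_Suc)
  have x0: "x 0 = 1/2" and xS: "x (Suc n) = nxt n (y n)" for n by (simp_all add: x_def hist y_def)
  have rball: "(\<alpha> * \<beta>) ^ n * (1/2) = r n" "\<alpha> * (\<alpha> * \<beta>) ^ n * (1/2) = \<alpha> * r n" for n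
    by (simp_all add: r_def \<kappa>_def)
  have strat: "(\<forall>n. (\<forall>m\<le>n. A_legal {0..1} \<alpha> \<beta> (1/2) x y m) \<longrightarrow> B_legal {0..1} \<alpha> \<beta> (1/2) x y n) \<and>
        ((\<forall>n. A_legal {0..1} \<alpha> \<beta> (1/2) x y n) \<longrightarrow> (\<exists>p\<in>W. (\<Inter>n. A_ball {0..1} \<alpha> \<beta> (1/2) x n) = {p}))"
    by (rule f[unfolded B_winning_strategy_def, THEN spec, THEN spec, THEN spec, THEN mp]) (rule conjI[OF _ yf], simp)
  have inv: "(\<forall>m\<le>n. A_legal {0..1} \<alpha> \<beta> (1/2) x y m) \<and> wt ({0..1} \<inter> cball (x n) (r n)) \<le> c0 * r n powr s" for n
  proof (induction n)
    case 0
    have "wt ({0..1} \<inter> cball (x 0) (r 0)) \<le> suminf w"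
      unfolding wt_def by (intro suminf_le wt_summable Uw(5)) (use Uw(3) in \<open>auto intro: less_imp_le\<close>)
    then show ?case using Uw(6) by (simp add: A_legal_def x0 c_def r_def)
  next
    case (Suc n)
    then have "B_legal {0..1} \<alpha> \<beta> (1/2) x y n" using strat by blast
    then have B: "y n \<in> {0..1}" "{0..1} \<inter> cball (y n) (\<alpha> * r n) \<subseteq> {0..1} \<inter> cball (x n) (r n)"
      unfolding B_legal_def A_ball_def B_ball_def rball by blast+
    have "\<exists>c. good n (y n) c"
      using child[OF B conjunct2[OF Suc.IH] r(1,2)] unfolding good_def r(3) Bex_def .
    then have "good n (y n) (x (Suc n))" unfolding xS nxt_def by (rule someI_ex)
    moreover from this have "A_legal {0..1} \<alpha> \<beta> (1/2) x y (Suc n)"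
      unfolding A_legal_def A_ball_def B_ball_def rball good_def by auto
    ultimately show ?case using Suc.IH by (auto simp: le_Suc_eq good_def)
  qed
  then have "\<forall>n. A_legal {0..1} \<alpha> \<beta> (1/2) x y n" by blast
  then obtain p where p: "p \<in> W" "(\<Inter>n. A_ball {0..1} \<alpha> \<beta> (1/2) x n) = {p}" using strat by blast
  obtain i where i: "p \<in> U i" using p(1) Uw(1) by blast
  \<comment> \<open>Every ball of A contains \<open>p\<close>, so it meets \<open>U i\<close> and
    carries at least the fixed positive weight \<open>w i\<close>, although the bounds tend to
    0.\<close>
  have "w i \<le> c0 * r n powr s" for n
  proof -
    have "p \<in> A_ball {0..1} \<alpha> \<beta> (1/2) x n" using p(2) by blast
    then have "p \<in> {0..1} \<inter> cball (x n) (r n)" unfolding A_ball_def rball .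
    then have "w i \<le> wt ({0..1} \<inter> cball (x n) (r n))" using i by (intro wt_ge) blast
    then show ?thesis using inv[of n] by linarith
  qed
  moreover have "(\<lambda>n. c0 * r n powr s) \<longlonglongrightarrow> c0 * 0"
  proof (intro tendsto_mult tendsto_const)
    have "r \<longlonglongrightarrow> 0"
      unfolding r_def using \<kappa> by (intro tendsto_mult_left_zero LIMSEQ_realpow_zero) auto
    then show "(\<lambda>n. r n powr s) \<longlonglongrightarrow> 0"
      by (rule tendsto_eq_rhs[OF tendsto_powr'[where a=0 and b=s]]) (use s less_imp_le[OF r(1)] in auto)
  qed
  ultimately have "w i \<le> c0 * 0" by (intro LIMSEQ_le_const) auto
  then show False using Uw(3)[of i] by simp
qed

lemma winning_hausdorff_dimension:
  assumes "schmidt_winning {0..1} (W :: real set)"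
  shows "hausdorff_dimension W = 1"
proof -
  obtain \<alpha> where \<alpha>: "0 < \<alpha>" "\<alpha> < 1" "alpha_winning {0..1} \<alpha> W"
    using assms by (auto simp: schmidt_winning_def)
  then have "alpha_beta_winning {0..1} \<alpha> (1/2) W" by (simp add: alpha_winning_def)
  then have W: "W \<subseteq> {0..1}" by (simp add: alpha_beta_winning_def)
  have "hausdorff_dimension W \<le> 1"
  proof (rule ennreal_le_epsilon)
    fix e :: real assume "e > 0"
    then have "hausdorff_dimension W \<le> ennreal (1 + e)"
      unfolding hausdorff_dimension_def
      by (intro INF_lower) (simp add: hausdorff_measure_unit_interval_zero[OF W])
    then show "hausdorff_dimension W \<le> 1 + ennreal e" using \<open>e > 0\<close> by simp
  qed
  moreover have "1 \<le> hausdorff_dimension W"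
    unfolding hausdorff_dimension_def
  proof (rule INF_greatest)
    fix s assume s: "s \<in> {s. s > 0 \<and> hausdorff_measure s W = 0}"
    then have "1 \<le> s" using winning_hausdorff_measure_pos[OF \<alpha>(3,1,2), of s] by force
    then show "1 \<le> ennreal s" by (metis ennreal_1 ennreal_leI)
  qed
  ultimately show ?thesis by (rule antisym)
qed

section \<open>The homogeneous space\<close>

definition subring_set :: "'a::comm_ring_1 set \<Rightarrow> bool" where
  "subring_set R \<longleftrightarrow> 0 \<in> R \<and> 1 \<in> R \<and> (\<forall>x\<in>R. \<forall>y\<in>R. x + y \<in> R) \<and> (\<forall>x\<in>R. \<forall>y\<in>R. x * y \<in> R) \<and> (\<forall>x\<in>R. - x \<in> R)"

lemma subring_coord_field: "subring_set (coord_field \<sigma>)"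
  by (auto simp: subring_set_def coord_field_def)

lemma subring_ring_of_integers: "subring_set (ring_of_integers :: 'k::field_char_0 set)"
  by (auto simp: subring_set_def ring_of_integers_def algebraic_int_add algebraic_int_mult
      intro: int_imp_algebraic_int)

text \<open>The adjugate: the inverse for determinant one, with entries in the same subring and of
  the same size.\<close>

definition adj2 :: "'a::comm_ring_1^2^2 \<Rightarrow> 'a^2^2" where
  "adj2 A = vector [vector [A$2$2, - A$1$2], vector [- A$2$1, A$1$1]]"

lemma adj2_nth [simp]:
  "adj2 A $ 1 $ 1 = A$2$2" "adj2 A $ 1 $ 2 = - A$1$2" "adj2 A $ 2 $ 1 = - A$2$1" "adj2 A $ 2 $ 2 = A$1$1"
  by (simp_all add: adj2_def)

lemma matrix_mult_2_nth:
  fixes A B :: "'a::comm_ring_1^2^2"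
  shows "(A ** B) $ i $ j = A$i$1 * B$1$j + A$i$2 * B$2$j"
  by (simp add: matrix_matrix_mult_def sum_2)

lemma mat1_2_nth [simp]:
  "(mat 1 :: 'a::comm_ring_1^2^2) $ 1 $ 1 = 1" "(mat 1 :: 'a::comm_ring_1^2^2) $ 1 $ 2 = 0"
  "(mat 1 :: 'a::comm_ring_1^2^2) $ 2 $ 1 = 0" "(mat 1 :: 'a::comm_ring_1^2^2) $ 2 $ 2 = 1"
  by (simp_all add: Finite_Cartesian_Product.mat_def)

lemma matrix_2_eq_iff:
  "(A :: 'a^2^2) = B \<longleftrightarrow> A$1$1 = B$1$1 \<and> A$1$2 = B$1$2 \<and> A$2$1 = B$2$1 \<and> A$2$2 = B$2$2"
  by (auto simp: Finite_Cartesian_Product.vec_eq_iff forall_2)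

lemma adj2_mult: "det A = 1 \<Longrightarrow> adj2 A ** A = mat 1" "det A = 1 \<Longrightarrow> A ** adj2 A = mat 1"
  by (simp_all add: matrix_2_eq_iff matrix_mult_2_nth det_2 algebra_simps)

lemma SL2_carrier: "A \<in> carrier (SL2 R) \<longleftrightarrow> det A = 1 \<and> (\<forall>i j. A $ i $ j \<in> R)"
  by (simp add: SL2_def)

lemma SL2_mult: "A \<otimes>\<^bsub>SL2 R\<^esub> B = A ** B"
  by (simp add: SL2_def)

lemma SL2_mult_closed:
  assumes "subring_set R" "A \<in> carrier (SL2 R)" "B \<in> carrier (SL2 R)"
  shows "A ** B \<in> carrier (SL2 R)"
  using assms by (simp add: SL2_carrier det_mul matrix_mult_2_nth subring_set_def)

lemma SL2_adj2_closed: "subring_set R \<Longrightarrow> A \<in> carrier (SL2 R) \<Longrightarrow> adj2 A \<in> carrier (SL2 R)"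
  by (simp add: SL2_carrier forall_2 subring_set_def) (simp add: det_2 algebra_simps)

lemma SL2_group:
  assumes R: "subring_set R"
  shows "group (SL2 R)"
proof (rule groupI)
  show "\<one>\<^bsub>SL2 R\<^esub> \<in> carrier (SL2 R)"
    using R by (simp add: SL2_def forall_2 subring_set_def)
  fix A assume A: "A \<in> carrier (SL2 R)"
  show "\<one>\<^bsub>SL2 R\<^esub> \<otimes>\<^bsub>SL2 R\<^esub> A = A" by (simp add: SL2_def)
  show "\<exists>B\<in>carrier (SL2 R). B \<otimes>\<^bsub>SL2 R\<^esub> A = \<one>\<^bsub>SL2 R\<^esub>"
    using SL2_adj2_closed[OF R A] A
    by (intro bexI[of _ "adj2 A"]) (simp_all add: SL2_def adj2_mult)
qed (simp_all add: SL2_mult SL2_mult_closed[OF R] matrix_mul_assoc)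

lemma SL2_KS_group: "group (SL2_KS S)"
  by (simp add: SL2_KS_def SL2_group subring_coord_field)

lemma SL2_KS_carrier: "carrier (SL2_KS S) = (\<Pi>\<^sub>E \<sigma>\<in>S. carrier (SL2 (coord_field \<sigma>)))"
  by (simp add: SL2_KS_def)

lemma SL2_KS_mult: "g \<otimes>\<^bsub>SL2_KS S\<^esub> h = (\<lambda>\<sigma>\<in>S. g \<sigma> ** h \<sigma>)"
  by (simp add: SL2_KS_def SL2_mult)

lemma SL2_KS_coord: "h \<in> carrier (SL2_KS S) \<Longrightarrow> \<sigma> \<in> S \<Longrightarrow> h \<sigma> \<in> carrier (SL2 (coord_field \<sigma>))"
  by (auto simp: SL2_KS_carrier)

lemma flow_carrier: "flow S t \<in> carrier (SL2_KS S)"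
  by (auto simp: SL2_KS_carrier flow_def SL2_carrier det_2 forall_2 coord_field_def
      simp flip: of_real_mult exp_add)

lemma unipotent_carrier:
  assumes "v \<in> K_S S"
  shows "unipotent S v \<in> carrier (SL2_KS S)"
  using assms by (auto simp: SL2_KS_carrier unipotent_def SL2_carrier det_2 forall_2 coord_field_def K_S_def
      dest!: PiE_mem)

definition emb :: "('k \<Rightarrow> complex) \<Rightarrow> 'k^2^2 \<Rightarrow> complex^2^2" where
  "emb \<sigma> A = (\<chi> i j. \<sigma> (A $ i $ j))"

lemma emb_nth [simp]: "emb \<sigma> A $ i $ j = \<sigma> (A $ i $ j)"
  by (simp add: emb_def)

lemma tau_matrix_eq: "tau_matrix S A = (\<lambda>\<sigma>\<in>S. emb \<sigma> A)"
  by (rule ext) (simp add: tau_matrix_def tau_def emb_def)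

lemma emb_mult: "ring_map \<sigma> \<Longrightarrow> emb \<sigma> (A ** B) = emb \<sigma> A ** emb \<sigma> B"
  by (simp add: matrix_2_eq_iff matrix_mult_2_nth ring_map_add ring_map_mult)

lemma det_emb: "ring_map \<sigma> \<Longrightarrow> det (emb \<sigma> A) = \<sigma> (det A)"
  by (simp add: det_2 ring_map_diff ring_map_mult)

lemma embedding_system_ring_map: "embedding_system S \<Longrightarrow> \<sigma> \<in> S \<Longrightarrow> ring_map \<sigma>"
  using embeddings_eq(1)[of S] embedding_ring_map by blast

lemma emb_SL2:
  assumes "ring_map \<sigma>" "det A = 1"
  shows "emb \<sigma> A \<in> carrier (SL2 (coord_field \<sigma>))"
  using assms by (auto simp: SL2_carrier det_emb ring_map_1 coord_field_def real_valued_def)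

lemma SL2_OK_subgroup:
  assumes S: "embedding_system (S :: ('k::field_char_0 \<Rightarrow> complex) set)"
  shows "subgroup (SL2_OK S) (SL2_KS S)"
proof -
  note rm = embedding_system_ring_map[OF S]
  interpret G: group "SL2_KS S" by (rule SL2_KS_group)
  have sub: "SL2_OK S \<subseteq> carrier (SL2_KS S)"
    using emb_SL2[OF rm] by (auto simp: SL2_OK_def tau_matrix_eq SL2_KS_carrier SL2_carrier)
  have mult: "tau_matrix S A \<otimes>\<^bsub>SL2_KS S\<^esub> tau_matrix S B = tau_matrix S (A ** B)" for A B
    using rm by (auto simp: tau_matrix_eq SL2_KS_mult emb_mult)
  have one: "tau_matrix S (mat 1) = \<one>\<^bsub>SL2_KS S\<^esub>"
    using rm by (auto simp: tau_matrix_eq SL2_KS_def SL2_def matrix_2_eq_iff ring_map_1 ring_map_0 fun_eq_iff)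
  show ?thesis
  proof (rule G.subgroupI)
    show "SL2_OK S \<noteq> {}"
      using group.is_monoid[OF SL2_group[OF subring_ring_of_integers]] monoid.one_closed
      unfolding SL2_OK_def by blast
    fix a assume "a \<in> SL2_OK S"
    then obtain A where A: "A \<in> carrier (SL2 ring_of_integers)" "a = tau_matrix S A"
      by (auto simp: SL2_OK_def)
    have adj: "tau_matrix S (adj2 A) \<in> SL2_OK S"
      using SL2_adj2_closed[OF subring_ring_of_integers A(1)] by (simp add: SL2_OK_def)
    have "tau_matrix S (adj2 A) \<otimes>\<^bsub>SL2_KS S\<^esub> a = \<one>\<^bsub>SL2_KS S\<^esub>"
      using A one by (simp add: mult SL2_carrier adj2_mult)
    then have "inv\<^bsub>SL2_KS S\<^esub> a = tau_matrix S (adj2 A)"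
      by (rule G.inv_equality) (use sub adj \<open>a \<in> SL2_OK S\<close> in blast)+
    then show "inv\<^bsub>SL2_KS S\<^esub> a \<in> SL2_OK S" using adj by simp
    fix b assume "b \<in> SL2_OK S"
    then obtain B where B: "B \<in> carrier (SL2 ring_of_integers)" "b = tau_matrix S B"
      by (auto simp: SL2_OK_def)
    show "a \<otimes>\<^bsub>SL2_KS S\<^esub> b \<in> SL2_OK S"
      using SL2_mult_closed[OF subring_ring_of_integers A(1) B(1)] A B
      by (simp add: mult SL2_OK_def)
  qed (rule sub)
qed

section \<open>Bounded parts of the group and their images in the quotient\<close>

definition bounded_coord :: "real \<Rightarrow> ('k \<Rightarrow> complex) \<Rightarrow> (complex^2^2) set" where
  "bounded_coord R \<sigma> = {A \<in> carrier (SL2 (coord_field \<sigma>)). \<forall>i j. cmod (A $ i $ j) \<le> R}"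

lemma compact_bounded_coord: "compact (bounded_coord R \<sigma>)"
proof -
  have cl: "closed (coord_field \<sigma>)" by (simp add: coord_field_def closed_complex_Reals)
  have cont: "continuous_on UNIV (\<lambda>A::complex^2^2. A $ i $ j)" for i j
    by (intro continuous_intros)
  have eq: "bounded_coord R \<sigma> = {A. det A = 1} \<inter> (\<Inter>i. \<Inter>j. (\<lambda>A. A $ i $ j) -` (coord_field \<sigma> \<inter> cball 0 R))"
    by (auto simp: bounded_coord_def SL2_carrier)
  have c1: "closed ((\<lambda>A::complex^2^2. A $ i $ j) -` (coord_field \<sigma> \<inter> cball 0 R))" for i j
    by (rule closed_vimage[OF _ cont]) (intro closed_Int cl closed_cball)
  have c2: "closed {A::complex^2^2. det A = 1}"
    unfolding det_2 by (intro closed_Collect_eq continuous_intros)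
  have "closed (bounded_coord R \<sigma>)"
    unfolding eq by (intro closed_Int closed_INT ballI c1 c2)
  moreover have "bounded (bounded_coord R \<sigma>)"
  proof (rule boundedI)
    fix A assume "A \<in> bounded_coord R \<sigma>"
    then have A: "cmod (A $ i $ j) \<le> R" for i j by (simp add: bounded_coord_def)
    have "norm A \<le> (\<Sum>i\<in>UNIV. norm (A $ i))" by (simp add: norm_vec_def L2_set_le_sum)
    also have "\<dots> \<le> (\<Sum>i\<in>UNIV. \<Sum>j\<in>UNIV. cmod (A $ i $ j))"
      by (intro sum_mono) (simp add: norm_vec_def L2_set_le_sum)
    also have "\<dots> \<le> (\<Sum>i\<in>(UNIV::2 set). \<Sum>j\<in>(UNIV::2 set). R)" by (intro sum_mono A)
    finally show "norm A \<le> (\<Sum>i\<in>(UNIV::2 set). \<Sum>j\<in>(UNIV::2 set). R)" .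
  qed
  ultimately show ?thesis by (simp add: compact_eq_bounded_closed)
qed

definition bounded_part :: "('k \<Rightarrow> complex) set \<Rightarrow> real \<Rightarrow> (('k \<Rightarrow> complex) \<Rightarrow> complex^2^2) set" where
  "bounded_part S R = (\<Pi>\<^sub>E \<sigma>\<in>S. bounded_coord R \<sigma>)"

lemma topspace_SL2_KS: "topspace (SL2_KS_topology S) = carrier (SL2_KS S)"
  by (simp add: SL2_KS_topology_def SL2_KS_carrier)

lemma bounded_part_subset: "bounded_part S R \<subseteq> carrier (SL2_KS S)"
  unfolding bounded_part_def SL2_KS_carrier by (rule PiE_mono) (auto simp: bounded_coord_def)

lemma compactin_bounded_part: "compactin (SL2_KS_topology S) (bounded_part S R)"
  unfolding SL2_KS_topology_def bounded_part_def compactin_PiE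
  using compact_bounded_coord
  by (auto simp: compactin_subtopology bounded_coord_def)

lemma matrix_mult_bound:
  fixes A B :: "complex^2^2"
  assumes "\<And>i j. cmod (A $ i $ j) \<le> a" "\<And>i j. cmod (B $ i $ j) \<le> b"
  shows "cmod ((A ** B) $ i $ j) \<le> 2 * a * b"
proof -
  have 0: "0 \<le> a" using assms(1)[of 1 1] norm_ge_zero order_trans by blast
  have "cmod (A $ i $ k * B $ k $ j) \<le> a * b" for k
    unfolding norm_mult using assms 0 by (intro mult_mono) auto
  then show ?thesis
    unfolding matrix_mult_2_nth using norm_triangle_mono[of _ "a * b" _ "a * b"] by (simp add: algebra_simps) force
qed

lemma adj2_bound: "(\<And>i j. cmod (A $ i $ j) \<le> a) \<Longrightarrow> cmod (adj2 A $ i $ j) \<le> a"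
proof -
  assume "\<And>i j. cmod (A $ i $ j) \<le> a"
  then have "\<forall>i j. cmod (adj2 A $ i $ j) \<le> a" by (simp add: forall_2)
  then show ?thesis by blast
qed

lemma finite_integral_matrices:
  assumes K: "number_field TYPE('k::field_char_0)" and S: "embedding_system (S :: ('k \<Rightarrow> complex) set)"
  shows "finite {A :: 'k^2^2. \<forall>i j. A $ i $ j \<in> ring_of_integers \<and> (\<forall>\<sigma>\<in>S. cmod (\<sigma> (A $ i $ j)) \<le> R)}" (is "finite ?M")
proof -
  let ?B = "{x. algebraic_int x \<and> (\<forall>\<sigma>\<in>S. cmod (\<sigma> x) \<le> R)}"
  let ?f = "\<lambda>(a,b,c,e). (vector [vector [a, b], vector [c, e]] :: 'k^2^2)"
  have "?M \<subseteq> ?f ` (?B \<times> ?B \<times> ?B \<times> ?B)"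
  proof
    fix A assume A: "A \<in> ?M"
    have "A = ?f (A$1$1, A$1$2, A$2$1, A$2$2)" by (simp add: matrix_2_eq_iff)
    moreover have "(A$1$1, A$1$2, A$2$1, A$2$2) \<in> ?B \<times> ?B \<times> ?B \<times> ?B"
      using A by (simp add: ring_of_integers_def)
    ultimately show "A \<in> ?f ` (?B \<times> ?B \<times> ?B \<times> ?B)" by (rule image_eqI)
  qed
  then show ?thesis
    by (rule finite_subset) (intro finite_imageI finite_cartesian_product finite_bounded_integers[OF K S])
qed

text \<open>Proper discontinuity. If \<open>h\<close> runs through a bounded neighbourhood and
  \<open>\<gamma> h\<close> is bounded by \<open>R\<close>, then \<open>\<gamma>\<close>, being
  \<open>\<gamma> h\<close> times the adjugate of \<open>h\<close>, has bounded integral entries; so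
  only finitely many \<open>\<gamma>\<close> matter near a point, and the union of closed sets is
  locally finite.\<close>

lemma closedin_orbit_bounded_part:
  assumes K: "number_field TYPE('k::field_char_0)" and S: "embedding_system (S :: ('k \<Rightarrow> complex) set)"
  shows "closedin (SL2_KS_topology S)
    (\<Union>\<gamma>\<in>SL2_OK S. {h \<in> carrier (SL2_KS S). \<gamma> \<otimes>\<^bsub>SL2_KS S\<^esub> h \<in> bounded_part S R})" (is "closedin ?X (\<Union>\<gamma>\<in>_. ?F \<gamma>)")
proof (rule closedin_locally_finite_Union)
  note rm = embedding_system_ring_map[OF S]
  note finS = finite_embedding_system[OF K S]
  have sub: "SL2_OK S \<subseteq> carrier (SL2_KS S)" by (rule subgroup.subset[OF SL2_OK_subgroup[OF S]])
  fix T assume "T \<in> ?F ` SL2_OK S"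
  then obtain \<gamma> where \<gamma>: "\<gamma> \<in> SL2_OK S" "T = ?F \<gamma>" by blast
  have "T = (\<Pi>\<^sub>E \<sigma>\<in>S. {A \<in> carrier (SL2 (coord_field \<sigma>)). \<gamma> \<sigma> ** A \<in> bounded_coord R \<sigma>})"
    unfolding \<gamma>(2) SL2_KS_carrier bounded_part_def SL2_KS_mult
    by (auto simp: PiE_iff extensional_def)
  moreover have "closedin (top_of_set (carrier (SL2 (coord_field \<sigma>))))
      {A \<in> carrier (SL2 (coord_field \<sigma>)). \<gamma> \<sigma> ** A \<in> bounded_coord R \<sigma>}" for \<sigma>
  proof -
    have "continuous_on (carrier (SL2 (coord_field \<sigma>))) (\<lambda>A. \<gamma> \<sigma> ** A)"
      unfolding matrix_matrix_mult_def by (intro continuous_intros)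
    then have "closedin (top_of_set (carrier (SL2 (coord_field \<sigma>))))
        (carrier (SL2 (coord_field \<sigma>)) \<inter> (\<lambda>A. \<gamma> \<sigma> ** A) -` bounded_coord R \<sigma>)"
      by (rule continuous_closedin_preimage) (rule compact_imp_closed[OF compact_bounded_coord])
    then show ?thesis by (simp add: vimage_def Collect_conj_eq)
  qed
  ultimately show "closedin ?X T"
    unfolding SL2_KS_topology_def by (simp add: closedin_product_topology)
next
  note rm = embedding_system_ring_map[OF S]
  note finS = finite_embedding_system[OF K S]
  show "locally_finite_in ?X (?F ` SL2_OK S)"
    unfolding locally_finite_in_def
  proof (intro conjI ballI)
    show "\<Union> (?F ` SL2_OK S) \<subseteq> topspace ?X" by (auto simp: topspace_SL2_KS)
    fix x assume "x \<in> topspace ?X"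
    then have x: "x \<in> carrier (SL2_KS S)" by (simp add: topspace_SL2_KS)
    define Q where "Q = 1 + (\<Sum>\<sigma>\<in>S. \<Sum>i\<in>UNIV. \<Sum>j\<in>UNIV. cmod (x \<sigma> $ i $ j))"
    define V where "V = (\<Pi>\<^sub>E \<sigma>\<in>S. {A \<in> carrier (SL2 (coord_field \<sigma>)). \<forall>i j. cmod (A $ i $ j) < Q})"
    have xQ: "cmod (x \<sigma> $ i $ j) < Q" if "\<sigma> \<in> S" for \<sigma> i j
    proof -
      have "cmod (x \<sigma> $ i $ j) \<le> (\<Sum>j\<in>UNIV. cmod (x \<sigma> $ i $ j))" by (rule member_le_sum) auto
      also have "\<dots> \<le> (\<Sum>i\<in>UNIV. \<Sum>j\<in>UNIV. cmod (x \<sigma> $ i $ j))"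
        by (rule member_le_sum) (auto intro: sum_nonneg)
      also have "\<dots> \<le> (\<Sum>\<sigma>\<in>S. \<Sum>i\<in>UNIV. \<Sum>j\<in>UNIV. cmod (x \<sigma> $ i $ j))"
        by (rule member_le_sum[OF that]) (auto intro!: sum_nonneg finS)
      finally show ?thesis by (simp add: Q_def)
    qed
    have "x \<in> V" using x xQ by (auto simp: V_def SL2_KS_carrier PiE_iff)
    moreover have "openin ?X V"
      unfolding SL2_KS_topology_def V_def
    proof (rule openin_PiE[OF finS, THEN iffD2], rule disjI2, intro ballI)
      fix \<sigma>
      have "open {A::complex^2^2. \<forall>i j. cmod (A $ i $ j) < Q}"
        unfolding forall_2 by (intro open_Collect_conj open_Collect_less continuous_intros)
      then have "openin (top_of_set (carrier (SL2 (coord_field \<sigma>))))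
        (carrier (SL2 (coord_field \<sigma>)) \<inter> {A. \<forall>i j. cmod (A $ i $ j) < Q})" by (rule openin_open_Int)
      then show "openin (top_of_set (carrier (SL2 (coord_field \<sigma>))))
        {A \<in> carrier (SL2 (coord_field \<sigma>)). \<forall>i j. cmod (A $ i $ j) < Q}" by (simp add: Collect_conj_eq)
    qed
    moreover have "finite {U \<in> ?F ` SL2_OK S. U \<inter> V \<noteq> {}}"
    proof (rule finite_subset)
      let ?M = "{A :: 'k^2^2. \<forall>i j. A $ i $ j \<in> ring_of_integers \<and> (\<forall>\<sigma>\<in>S. cmod (\<sigma> (A $ i $ j)) \<le> 2 * R * Q)}"
      show "finite ((\<lambda>A. ?F (tau_matrix S A)) ` ?M)" by (intro finite_imageI finite_integral_matrices[OF K S])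
      show "{U \<in> ?F ` SL2_OK S. U \<inter> V \<noteq> {}} \<subseteq> (\<lambda>A. ?F (tau_matrix S A)) ` ?M"
      proof
        fix U assume "U \<in> {U \<in> ?F ` SL2_OK S. U \<inter> V \<noteq> {}}"
        then obtain \<gamma> h where g: "\<gamma> \<in> SL2_OK S" "U = ?F \<gamma>" "h \<in> ?F \<gamma>" "h \<in> V" by blast
        obtain A where A: "A \<in> carrier (SL2 ring_of_integers)" "\<gamma> = tau_matrix S A"
          using g(1) by (auto simp: SL2_OK_def)
        have "cmod (\<sigma> (A $ i $ j)) \<le> 2 * R * Q" if s: "\<sigma> \<in> S" for \<sigma> i j
        proof -
          have "(\<gamma> \<otimes>\<^bsub>SL2_KS S\<^esub> h) \<sigma> \<in> bounded_coord R \<sigma>" using g(3) s by (auto simp: bounded_part_def)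
          then have 1: "cmod ((emb \<sigma> A ** h \<sigma>) $ i $ j) \<le> R" for i j
            using s by (simp add: SL2_KS_mult A(2) tau_matrix_eq bounded_coord_def)
          have "h \<sigma> \<in> {A \<in> carrier (SL2 (coord_field \<sigma>)). \<forall>i j. cmod (A $ i $ j) < Q}"
            using g(4) s unfolding V_def by blast
          then have 2: "det (h \<sigma>) = 1" "\<And>i j. cmod (h \<sigma> $ i $ j) \<le> Q"
            by (auto simp: SL2_carrier intro: less_imp_le)
          have "emb \<sigma> A = (emb \<sigma> A ** h \<sigma>) ** adj2 (h \<sigma>)"
            using adj2_mult(2)[OF 2(1)] by (simp flip: matrix_mul_assoc)
          then have "emb \<sigma> A $ i $ j = ((emb \<sigma> A ** h \<sigma>) ** adj2 (h \<sigma>)) $ i $ j" by simp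
          then show ?thesis
            using matrix_mult_bound[OF 1 adj2_bound[OF 2(2)], of i j] by simp
        qed
        then have "A \<in> ?M" using A(1) by (simp add: SL2_carrier)
        then show "U \<in> (\<lambda>A. ?F (tau_matrix S A)) ` ?M" using g(2) A(2) by blast
      qed
    qed
    ultimately show "\<exists>V. openin ?X V \<and> x \<in> V \<and> finite {U \<in> ?F ` SL2_OK S. U \<inter> V \<noteq> {}}" by blast
  qed
qed

text \<open>The image of \<open>bounded_part\<close> is compact and contains the orbit. It is closed
  by \<open>closedin_orbit_bounded_part\<close>, because its preimage in the group is exactly that
  union of translates; hence the closure of the orbit stays inside.\<close>

lemma bounded_trajectory_if_bounded:
  assumes K: "number_field TYPE('k::field_char_0)" and S: "embedding_system (S :: ('k \<Rightarrow> complex) set)"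
    and h: "h \<in> carrier (SL2_KS S)"
    and bnd: "\<And>t. t \<ge> 0 \<Longrightarrow> \<exists>A\<in>carrier (SL2 ring_of_integers). \<forall>\<sigma>\<in>S. \<forall>i j.
        cmod ((emb \<sigma> A ** (h \<sigma> ** flow S t \<sigma>)) $ i $ j) \<le> R"
  shows "bounded_trajectory S (SL2_OK S #>\<^bsub>SL2_KS S\<^esub> h)"
proof -
  let ?G = "SL2_KS S" and ?X = "SL2_KS_topology S" and ?H = "homogeneous_space S"
  interpret G: group ?G by (rule SL2_KS_group)
  have sg: "subgroup (SL2_OK S) ?G" by (rule SL2_OK_subgroup[OF S])
  then have sub: "SL2_OK S \<subseteq> carrier ?G" by (rule subgroup.subset)
  let ?q = "\<lambda>g. SL2_OK S #>\<^bsub>?G\<^esub> g"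
  have qm: "quotient_map ?X ?H ?q"
    unfolding homogeneous_space_def by (rule quotient_map_quotient_topology)
  let ?C = "bounded_part S R"
  have invar: "?q (\<gamma> \<otimes>\<^bsub>?G\<^esub> g) = ?q g" if "\<gamma> \<in> SL2_OK S" "g \<in> carrier ?G" for \<gamma> g
    using G.coset_mult_assoc[OF sub, of \<gamma> g] G.coset_join2[OF _ sg that(1)] sub that by auto
  have pre: "{g \<in> topspace ?X. ?q g \<in> ?q ` ?C} =
      (\<Union>\<gamma>\<in>SL2_OK S. {g \<in> carrier ?G. \<gamma> \<otimes>\<^bsub>?G\<^esub> g \<in> ?C})"
  proof (intro equalityI subsetI)
    fix g assume "g \<in> {g \<in> topspace ?X. ?q g \<in> ?q ` ?C}"
    then obtain c where c: "g \<in> carrier ?G" "c \<in> ?C" "?q g = ?q c" by (auto simp: topspace_SL2_KS)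
    then have cc: "c \<in> carrier ?G" using bounded_part_subset by blast
    have "c \<in> ?q c" using G.rcos_self[OF cc sg] .
    then have "c \<in> ?q g" using c by simp
    then obtain \<gamma> where "\<gamma> \<in> SL2_OK S" "c = \<gamma> \<otimes>\<^bsub>?G\<^esub> g" by (auto simp: r_coset_def)
    then show "g \<in> (\<Union>\<gamma>\<in>SL2_OK S. {g \<in> carrier ?G. \<gamma> \<otimes>\<^bsub>?G\<^esub> g \<in> ?C})" using c by blast
  next
    fix g assume "g \<in> (\<Union>\<gamma>\<in>SL2_OK S. {g \<in> carrier ?G. \<gamma> \<otimes>\<^bsub>?G\<^esub> g \<in> ?C})"
    then obtain \<gamma> where \<gamma>: "\<gamma> \<in> SL2_OK S" "g \<in> carrier ?G" "\<gamma> \<otimes>\<^bsub>?G\<^esub> g \<in> ?C" by blast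
    have "?q g = ?q (\<gamma> \<otimes>\<^bsub>?G\<^esub> g)" using invar \<gamma> by simp
    then show "g \<in> {g \<in> topspace ?X. ?q g \<in> ?q ` ?C}"
      using \<gamma> by (auto simp: topspace_SL2_KS)
  qed
  have "?q ` ?C \<subseteq> topspace ?H"
    unfolding homogeneous_space_def topspace_quotient_topology topspace_SL2_KS
    using bounded_part_subset by blast
  then have closed: "closedin ?H (?q ` ?C)"
    using qm closedin_orbit_bounded_part[OF K S, of R] unfolding quotient_map_closedin
    by (simp only: pre[symmetric])
  have compact: "compactin ?H (?q ` ?C)"
    using image_compactin[OF compactin_bounded_part quotient_imp_continuous_map[OF qm]] .
  have "{?q h #>\<^bsub>?G\<^esub> flow S t | t. t \<ge> 0} \<subseteq> ?q ` ?C"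
  proof
    fix y assume "y \<in> {?q h #>\<^bsub>?G\<^esub> flow S t | t. t \<ge> 0}"
    then obtain t where t: "t \<ge> 0" "y = ?q h #>\<^bsub>?G\<^esub> flow S t" by blast
    obtain A where A: "A \<in> carrier (SL2 ring_of_integers)"
      "\<And>\<sigma> i j. \<sigma> \<in> S \<Longrightarrow> cmod ((emb \<sigma> A ** (h \<sigma> ** flow S t \<sigma>)) $ i $ j) \<le> R"
      using bnd[OF t(1)] by blast
    define g where "g = h \<otimes>\<^bsub>?G\<^esub> flow S t"
    have g: "g \<in> carrier ?G" unfolding g_def by (intro G.m_closed h flow_carrier)
    define \<gamma> where "\<gamma> = tau_matrix S A"
    have \<gamma>: "\<gamma> \<in> SL2_OK S" using A(1) by (simp add: \<gamma>_def SL2_OK_def)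
    have "y = ?q g" unfolding t(2) g_def using G.coset_mult_assoc[OF sub h flow_carrier] .
    also have "\<dots> = ?q (\<gamma> \<otimes>\<^bsub>?G\<^esub> g)" using invar[OF \<gamma> g] by simp
    finally have y: "y = ?q (\<gamma> \<otimes>\<^bsub>?G\<^esub> g)" .
    have gg: "\<gamma> \<otimes>\<^bsub>?G\<^esub> g \<in> carrier ?G" using \<gamma> g sub by blast
    have "\<gamma> \<otimes>\<^bsub>?G\<^esub> g \<in> ?C"
      unfolding bounded_part_def
    proof (rule PiE_I)
      fix \<sigma> assume s: "\<sigma> \<in> S"
      have "(\<gamma> \<otimes>\<^bsub>?G\<^esub> g) \<sigma> = emb \<sigma> A ** (h \<sigma> ** flow S t \<sigma>)"
        using s by (simp add: SL2_KS_mult \<gamma>_def tau_matrix_eq g_def)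
      then show "(\<gamma> \<otimes>\<^bsub>?G\<^esub> g) \<sigma> \<in> bounded_coord R \<sigma>"
        using A(2)[OF s] SL2_KS_coord[OF gg s] by (simp add: bounded_coord_def)
    qed (simp add: SL2_KS_mult)
    then show "y \<in> ?q ` ?C" using y by blast
  qed
  then have "?H closure_of {?q h #>\<^bsub>?G\<^esub> flow S t | t. t \<ge> 0} \<subseteq> ?q ` ?C"
    using closed by (rule closure_of_minimal)
  then show ?thesis
    unfolding bounded_trajectory_def using closed_compactin[OF compact] by simp
qed

section \<open>A compactness criterion for diagonal trajectories\<close>

lemma pigeonhole_fibre:
  fixes k :: real
  assumes "finite A" "finite B" "f ` A \<subseteq> B" "A \<noteq> {}" "k * real (card B) \<le> real (card A)"
  obtains b where "b \<in> B" "k \<le> real (card {a\<in>A. f a = b})"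
proof -
  have B: "B \<noteq> {}" using assms by blast
  have "\<exists>b\<in>B. k \<le> real (card {a\<in>A. f a = b})"
  proof (rule ccontr)
    assume "\<not> ?thesis"
    then have "(\<Sum>b\<in>B. real (card {a\<in>A. f a = b})) < (\<Sum>b\<in>B. k)"
      using assms(2) B by (intro sum_strict_mono) auto
    moreover have "card A = (\<Sum>b\<in>B. card {a\<in>A. f a = b})"
      using sum.group[OF assms(1-3), of "\<lambda>_. 1 :: nat"] by simp
    ultimately show False using assms(5) by (simp add: mult.commute)
  qed
  then show thesis using that by blast
qed

section \<open>Counting integral vectors in cells\<close>

definition cell :: "real \<Rightarrow> complex \<Rightarrow> int \<times> int" where
  "cell \<epsilon> z = (\<lfloor>Re z / \<epsilon>\<rfloor>, \<lfloor>Im z / \<epsilon>\<rfloor>)"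

text \<open>At a real place the imaginary index is 0, which makes the number of cells of order
  \<open>Y ^ weight \<sigma>\<close>.\<close>

definition cells :: "('k \<Rightarrow> complex) \<Rightarrow> real \<Rightarrow> (int \<times> int) set" where
  "cells \<sigma> Y = {- ceiling Y..ceiling Y} \<times> (if real_valued \<sigma> then {0} else {- ceiling Y..ceiling Y})"

lemma finite_cells: "finite (cells \<sigma> Y)"
  by (simp add: cells_def)

lemma card_cells: "Y \<ge> 0 \<Longrightarrow> real (card (cells \<sigma> Y)) \<le> (2 * Y + 3) ^ weight \<sigma>"
proof -
  assume Y: "Y \<ge> 0"
  then have "0 \<le> \<lceil>Y\<rceil>" by simp
  then have 1: "real (card {- ceiling Y..ceiling Y}) \<le> 2 * Y + 3" by simp linarith
  show ?thesis
  proof (cases "real_valued \<sigma>")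
    case True
    then show ?thesis using 1 by (simp add: cells_def weight_def card_cartesian_product)
  next
    case False
    then have "real (card (cells \<sigma> Y)) = real (card {- ceiling Y..ceiling Y}) ^ 2"
      by (simp only: cells_def card_cartesian_product if_False of_nat_mult power2_eq_square)
    also have "\<dots> \<le> (2 * Y + 3) ^ 2" using 1 by (intro power_mono) auto
    finally show ?thesis using False by (simp add: weight_def)
  qed
qed

lemma cell_in_cells:
  assumes "\<epsilon> > 0" "z \<in> coord_field \<sigma>" "cmod z \<le> Y"
  shows "cell \<epsilon> z \<in> cells \<sigma> (Y / \<epsilon>)"
proof -
  have fl: "\<lfloor>t / \<epsilon>\<rfloor> \<in> {- ceiling (Y / \<epsilon>)..ceiling (Y / \<epsilon>)}" if "\<bar>t\<bar> \<le> Y" for t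
  proof -
    have "(- Y) / \<epsilon> \<le> t / \<epsilon>" "t / \<epsilon> \<le> Y / \<epsilon>"
      using that assms(1) by (intro divide_right_mono; linarith)+
    then have "- ceiling (Y / \<epsilon>) \<le> \<lfloor>t / \<epsilon>\<rfloor>" "\<lfloor>t / \<epsilon>\<rfloor> \<le> ceiling (Y / \<epsilon>)"
      unfolding minus_divide_left[symmetric] by linarith+
    then show ?thesis by simp
  qed
  have "Im z = 0" if "real_valued \<sigma>"
    using assms(2) that by (simp add: coord_field_def complex_is_Real_iff)
  moreover have "\<bar>Re z\<bar> \<le> Y" "\<bar>Im z\<bar> \<le> Y"
    using abs_Re_le_cmod[of z] abs_Im_le_cmod[of z] assms(3) by linarith+
  ultimately show ?thesis using fl by (auto simp: cell_def cells_def)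
qed

lemma cell_eq_bound:
  assumes "\<epsilon> > 0" "cell \<epsilon> z = cell \<epsilon> z'"
  shows "cmod (z - z') \<le> 2 * \<epsilon>"
proof -
  have *: "\<bar>s - t\<bar> \<le> \<epsilon>" if "\<lfloor>s / \<epsilon>\<rfloor> = \<lfloor>t / \<epsilon>\<rfloor>" for s t
  proof -
    have "\<bar>s / \<epsilon> - t / \<epsilon>\<bar> \<le> 1" using that by linarith
    then have "\<bar>s - t\<bar> / \<epsilon> \<le> 1" using assms(1) by (simp flip: diff_divide_distrib)
    then show ?thesis using assms(1) by (simp add: divide_le_eq)
  qed
  have "\<bar>Re z - Re z'\<bar> \<le> \<epsilon>" "\<bar>Im z - Im z'\<bar> \<le> \<epsilon>"
    using assms(2) * by (auto simp: cell_def)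
  then show ?thesis using cmod_le[of "z - z'"] by simp
qed

text \<open>Entry \<open>j\<close> of the row vector \<open>u\<close> times \<open>h\<close>, at the
  place \<open>\<sigma>\<close>.\<close>

definition linform :: "(('k \<Rightarrow> complex) \<Rightarrow> complex^2^2) \<Rightarrow> 2 \<Rightarrow> ('k \<Rightarrow> complex) \<Rightarrow> 'k \<times> 'k \<Rightarrow> complex" where
  "linform h j \<sigma> u = \<sigma> (fst u) * h \<sigma> $ 1 $ j + \<sigma> (snd u) * h \<sigma> $ 2 $ j"

lemma linform_diff:
  assumes "ring_map \<sigma>"
  shows "linform h j \<sigma> (u - v) = linform h j \<sigma> u - linform h j \<sigma> v"
  by (simp add: linform_def ring_map_diff[OF assms] algebra_simps)

text \<open>Multiplicativity of the determinant; through it the integrality of the determinant of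
  two vectors is felt at every place.\<close>

lemma linform_det:
  assumes "ring_map \<sigma>" "det (h \<sigma>) = 1"
  shows "linform h 1 \<sigma> u * linform h 2 \<sigma> v - linform h 2 \<sigma> u * linform h 1 \<sigma> v =
    \<sigma> (fst u * snd v - snd u * fst v)"
proof -
  have "linform h 1 \<sigma> u * linform h 2 \<sigma> v - linform h 2 \<sigma> u * linform h 1 \<sigma> v =
      (\<sigma> (fst u) * \<sigma> (snd v) - \<sigma> (snd u) * \<sigma> (fst v)) * det (h \<sigma>)"
    by (simp add: linform_def det_2 algebra_simps)
  then show ?thesis using assms by (simp add: ring_map_diff ring_map_mult)
qed

lemma linform_coord_field:
  assumes "h \<in> carrier (SL2_KS S)" "\<sigma> \<in> S"
  shows "linform h j \<sigma> u \<in> coord_field \<sigma>"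
proof -
  have "h \<sigma> $ i $ j \<in> coord_field \<sigma>" for i
    using SL2_KS_coord[OF assms] by (simp add: SL2_carrier)
  moreover have "\<sigma> x \<in> coord_field \<sigma>" for x by (auto simp: coord_field_def real_valued_def)
  ultimately show ?thesis
    using subring_coord_field[of \<sigma>] by (simp add: linform_def subring_set_def)
qed

definition integral_pair :: "'k::field_char_0 \<times> 'k \<Rightarrow> bool" where
  "integral_pair u \<longleftrightarrow> algebraic_int (fst u) \<and> algebraic_int (snd u)"

lemma integral_pair_diff: "integral_pair u \<Longrightarrow> integral_pair v \<Longrightarrow> integral_pair (u - v)"
  by (simp add: integral_pair_def algebraic_int_diff)

text \<open>The weighted product over the places of the sup norms of the vector \<open>u h\<close>,
  moved by the flow for time \<open>t\<close>.\<close>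

definition height :: "('k \<Rightarrow> complex) set \<Rightarrow> (('k \<Rightarrow> complex) \<Rightarrow> complex^2^2) \<Rightarrow> real \<Rightarrow> 'k \<times> 'k \<Rightarrow> real" where
  "height S h t u = (\<Prod>\<sigma>\<in>S. max (exp (- t) * cmod (linform h 1 \<sigma> u)) (exp t * cmod (linform h 2 \<sigma> u)) ^ weight \<sigma>)"

text \<open>The points of a \<open>K\<close>-line inside a ball are separated already by one dominating coordinate at
  each place, so there are few of them.\<close>

lemma card_short_collinear:
  assumes K: "number_field TYPE('k::field_char_0)" and S: "embedding_system (S :: ('k \<Rightarrow> complex) set)"
    and h: "h \<in> carrier (SL2_KS S)"
    and ht: "\<And>u. integral_pair u \<Longrightarrow> u \<noteq> 0 \<Longrightarrow> c \<le> height S h t u"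
    and \<epsilon>: "\<epsilon> > 0" "(2 * \<epsilon>) ^ number_field_degree TYPE('k) < c"
    and T: "finite T" "\<And>u. u \<in> T \<Longrightarrow> integral_pair u"
    and short: "\<And>u \<sigma>. u \<in> T \<Longrightarrow> \<sigma> \<in> S \<Longrightarrow> exp (- t) * cmod (linform h 1 \<sigma> u) \<le> R"
      "\<And>u \<sigma>. u \<in> T \<Longrightarrow> \<sigma> \<in> S \<Longrightarrow> exp t * cmod (linform h 2 \<sigma> u) \<le> R"
    and coll: "\<And>u v. u \<in> T \<Longrightarrow> v \<in> T \<Longrightarrow> fst u * snd v - snd u * fst v = 0"
    and R: "R \<ge> 0"
  shows "real (card T) \<le> (2 * R / \<epsilon> + 3) ^ number_field_degree TYPE('k)"
proof (cases "T \<subseteq> {0}")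
  case True
  then have "card T \<le> 1" by (metis card.empty card_insert_disjoint card_mono finite.emptyI finite_insert empty_iff One_nat_def)
  moreover have "1 \<le> (2 * R / \<epsilon> + 3) ^ number_field_degree TYPE('k)"
    using R \<epsilon> by (intro one_le_power) (simp add: add_increasing)
  ultimately show ?thesis by linarith
next
  case False
  then obtain w where w: "w \<in> T" "w \<noteq> 0" by auto
  note rm = embedding_system_ring_map[OF S]
  note finS = finite_embedding_system[OF K S]
  \<comment> \<open>At each place only the coordinate in which \<open>w\<close> is larger is
    recorded. The vectors of \<open>T\<close> are proportional to \<open>w\<close>, so this
    coordinate controls the other one, and one cell index per place suffices instead of two; this
    yields the exponent \<open>d\<close> instead of \<open>2 * d\<close>.\<close>
  define x where "x \<sigma> u = (if exp (- t) * cmod (linform h 1 \<sigma> w) \<ge> exp t * cmod (linform h 2 \<sigma> w)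
      then of_real (exp (- t)) * linform h 1 \<sigma> u else of_real (exp t) * linform h 2 \<sigma> u)" for \<sigma> u
  define f where "f u = (\<lambda>\<sigma>\<in>S. cell \<epsilon> (x \<sigma> u))" for u
  let ?B = "\<Pi>\<^sub>E \<sigma>\<in>S. cells \<sigma> (R / \<epsilon>)"
  have "f ` T \<subseteq> ?B"
  proof (intro image_subsetI PiE_I)
    fix u \<sigma> assume u: "u \<in> T" "\<sigma> \<in> S"
    have r: "of_real s * linform h j \<sigma> u \<in> coord_field \<sigma>" for s j
      using linform_coord_field[OF h u(2), of j u] by (auto simp: coord_field_def)
    have "x \<sigma> u \<in> coord_field \<sigma>" using r[of "exp (- t)" 1] r[of "exp t" 2] by (simp add: x_def)
    moreover have "cmod (x \<sigma> u) \<le> R" using short[OF u] by (simp add: x_def norm_mult)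
    ultimately show "f u \<sigma> \<in> cells \<sigma> (R / \<epsilon>)" using cell_in_cells[OF \<epsilon>(1)] u(2) by (simp add: f_def)
  qed (simp add: f_def)
  moreover have "inj_on f T"
  proof (rule inj_onI, rule ccontr)
    fix u v assume uv: "u \<in> T" "v \<in> T" "f u = f v" "u \<noteq> v"
    have c0: "fst (u - v) * snd w - snd (u - v) * fst w = 0"
      using coll[OF uv(1) w(1)] coll[OF uv(2) w(1)] by (simp add: algebra_simps)
    have "max (exp (- t) * cmod (linform h 1 \<sigma> (u - v))) (exp t * cmod (linform h 2 \<sigma> (u - v))) \<le> 2 * \<epsilon>" if s: "\<sigma> \<in> S" for \<sigma>
    proof -
      have rs: "ring_map \<sigma>" using rm s .
      have dh: "det (h \<sigma>) = 1" using SL2_KS_coord[OF h s] by (simp add: SL2_carrier)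
      let ?a = "exp (- t) * cmod (linform h 1 \<sigma> (u - v))" and ?b = "exp t * cmod (linform h 2 \<sigma> (u - v))"
      let ?a' = "exp (- t) * cmod (linform h 1 \<sigma> w)" and ?b' = "exp t * cmod (linform h 2 \<sigma> w)"
      have "linform h 1 \<sigma> (u - v) * linform h 2 \<sigma> w = linform h 2 \<sigma> (u - v) * linform h 1 \<sigma> w"
        using linform_det[of \<sigma> h, OF rs dh, of "u - v" w] c0 ring_map_0[OF rs] by simp
      then have "cmod (linform h 1 \<sigma> (u - v)) * cmod (linform h 2 \<sigma> w) = cmod (linform h 2 \<sigma> (u - v)) * cmod (linform h 1 \<sigma> w)"
        by (metis norm_mult)
      then have ab: "?a * ?b' = ?b * ?a'" by (simp add: mult.commute mult.left_commute)
      have "x \<sigma> u - x \<sigma> v = x \<sigma> (u - v)" by (simp add: x_def linform_diff[OF rs] algebra_simps)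
      then have xb: "cmod (x \<sigma> (u - v)) \<le> 2 * \<epsilon>"
        using cell_eq_bound[OF \<epsilon>(1), of "x \<sigma> u" "x \<sigma> v"] fun_cong[OF uv(3), of \<sigma>] s by (simp add: f_def)
      have nn: "?a' \<ge> 0" "?b' \<ge> 0" by simp_all
      have nz: "?a' \<noteq> 0 \<or> ?b' \<noteq> 0"
      proof (rule ccontr)
        assume "\<not> ?thesis"
        then have "linform h j \<sigma> w = 0" for j by (cases "j = 1"; cases j rule: exhaust_2[THEN disjE]) auto
        then have "\<sigma> (fst u' * snd w - snd u' * fst w) = 0" for u'
          using linform_det[of \<sigma> h, OF rs dh, of u' w] by simp
        then have "fst u' * snd w - snd u' * fst w = 0" for u' using ring_map_eq_0[OF rs] by blast
        from this[of "(1, 0)"] this[of "(0, 1)"] have "w = 0" by (simp add: prod_eq_iff)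
        then show False using w by simp
      qed
      show ?thesis
      proof (cases "?a' \<ge> ?b'")
        case True
        have a0: "?a' > 0"
        proof (rule ccontr)
          assume "\<not> ?a' > 0"
          then have "?a' = 0" "?b' = 0" using True nn by linarith+
          then show False using nz by blast
        qed
        have "?b * ?a' \<le> ?a * ?a'" unfolding ab[symmetric] using True by (intro mult_left_mono) auto
        then have "?b \<le> ?a" using a0 by (simp only: mult_le_cancel_right_pos)
        moreover have "?a \<le> 2 * \<epsilon>" using xb True by (simp add: x_def norm_mult)
        ultimately show ?thesis by linarith
      next
        case False
        then have b0: "?b' > 0" using nn by linarith
        have "?a * ?b' \<le> ?b * ?b'" unfolding ab using False by (intro mult_left_mono) auto
        then have "?a \<le> ?b" using b0 by (simp only: mult_le_cancel_right_pos)
        moreover have "?b \<le> 2 * \<epsilon>" using xb False by (simp add: x_def norm_mult)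
        ultimately show ?thesis by linarith
      qed
    qed
    \<comment> \<open>Distinct vectors in the same cells would differ by a vector of height below
      \<open>c\<close>.\<close>
    then have "height S h t (u - v) \<le> (\<Prod>\<sigma>\<in>S. (2 * \<epsilon>) ^ weight \<sigma>)"
      unfolding height_def by (intro prod_mono conjI power_mono zero_le_power) (auto simp: le_max_iff_disj)
    also have "\<dots> = (2 * \<epsilon>) ^ number_field_degree TYPE('k)"
      by (simp only: power_sum[symmetric] sum_weight[OF K S])
    also have "\<dots> < c" by (rule \<epsilon>(2))
    finally have "height S h t (u - v) < c" .
    moreover have "c \<le> height S h t (u - v)"
      using uv by (intro ht integral_pair_diff T(2)) auto
    ultimately show False by simp
  qed
  moreover have "finite ?B" using finS finite_cells by (intro finite_PiE) auto
  ultimately have "card T \<le> card ?B" by (meson card_inj_on_le)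
  then have "real (card T) \<le> (\<Prod>\<sigma>\<in>S. real (card (cells \<sigma> (R / \<epsilon>))))"
    using finS by (simp add: card_PiE flip: of_nat_prod)
  also have "\<dots> \<le> (\<Prod>\<sigma>\<in>S. (2 * (R / \<epsilon>) + 3) ^ weight \<sigma>)"
    using R \<epsilon>(1) by (intro prod_mono conjI card_cells) auto
  also have "\<dots> = (2 * R / \<epsilon> + 3) ^ number_field_degree TYPE('k)"
    by (simp only: power_sum[symmetric] sum_weight[OF K S] times_divide_eq_right)
  finally show ?thesis .
qed

text \<open>Pigeonhole on \<open>(N + 1) ^ (2 * d)\<close> integral vectors. Their images at time
  \<open>t\<close> lie in a box with sizes \<open>X1\<close> and \<open>X2\<close> at each place,
  whose product \<open>(D * N)\<^sup>2\<close> does not involve \<open>exp t\<close>. So the number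
  of cells of side \<open>R / 2\<close> is at most of order \<open>N ^ (2 * d)\<close>, and this
  factor cancels.\<close>

lemma many_short_vectors:
  assumes K: "number_field TYPE('k::field_char_0)" and S: "embedding_system (S :: ('k \<Rightarrow> complex) set)"
    and h: "h \<in> carrier (SL2_KS S)"
  shows "\<exists>D>0. \<forall>R>0. \<forall>t\<ge>0. \<exists>T. finite T \<and> T \<noteq> {} \<and> (R / D) ^ (2 * number_field_degree TYPE('k)) \<le> real (card T) \<and>
    (\<forall>u\<in>T. integral_pair u) \<and>
    (\<forall>u\<in>T. \<forall>v\<in>T. \<forall>\<sigma>\<in>S. exp (- t) * cmod (linform h 1 \<sigma> (u - v)) \<le> R \<and> exp t * cmod (linform h 2 \<sigma> (u - v)) \<le> R)"
proof -
  note rm = embedding_system_ring_map[OF S]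
  note finS = finite_embedding_system[OF K S]
  let ?d = "number_field_degree TYPE('k)"
  obtain C where C: "C > 0" "\<And>N. \<exists>P. finite P \<and> card P = (N + 1) ^ ?d \<and>
      (\<forall>x\<in>P. algebraic_int x \<and> (\<forall>\<sigma>\<in>S. cmod (\<sigma> x) \<le> C * real N))"
    using many_integers[OF K S] by blast
  define H where "H = 1 + (\<Sum>\<sigma>\<in>S. \<Sum>i\<in>UNIV. \<Sum>j\<in>UNIV. cmod (h \<sigma> $ i $ j))"
  have hH: "cmod (h \<sigma> $ i $ j) \<le> H" if "\<sigma> \<in> S" for \<sigma> i j
  proof -
    have "cmod (h \<sigma> $ i $ j) \<le> (\<Sum>j\<in>UNIV. cmod (h \<sigma> $ i $ j))" by (rule member_le_sum) auto
    also have "\<dots> \<le> (\<Sum>i\<in>UNIV. \<Sum>j\<in>UNIV. cmod (h \<sigma> $ i $ j))"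
      by (rule member_le_sum) (auto intro: sum_nonneg)
    also have "\<dots> \<le> (\<Sum>\<sigma>\<in>S. \<Sum>i\<in>UNIV. \<Sum>j\<in>UNIV. cmod (h \<sigma> $ i $ j))"
      by (rule member_le_sum[OF that]) (auto intro!: sum_nonneg finS)
    finally show ?thesis by (simp add: H_def)
  qed
  have H0: "H > 0" unfolding H_def by (intro add_pos_nonneg sum_nonneg) auto
  \<comment> \<open>\<open>D * N\<close> bounds both linear forms on the chosen vectors: two terms,
    each at most \<open>C * N * H\<close>.\<close>
  define D where "D = 2 * C * H"
  have D0: "D > 0" using C H0 by (simp add: D_def)
  show ?thesis
  proof (intro exI[of _ "7 * D"] conjI allI impI)
    show "7 * D > 0" using D0 by simp
    fix R t :: real assume R: "R > 0" and t: "t \<ge> 0"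
    \<comment> \<open>Large enough that even the contracted size \<open>X1\<close> is at least
      \<open>R\<close>; for thinner boxes the number of cells would not be comparable with the
      volume.\<close>
    define N where "N = nat \<lceil>R * exp t / D\<rceil> + 1"
    have N: "R * exp t / D \<le> real N" "N > 0" unfolding N_def by linarith+
    then have DN: "R * exp t \<le> D * real N" using D0 by (simp add: divide_le_eq mult.commute)
    obtain P where P: "finite P" "card P = (N + 1) ^ ?d"
      "\<And>x. x \<in> P \<Longrightarrow> algebraic_int x" "\<And>x \<sigma>. x \<in> P \<Longrightarrow> \<sigma> \<in> S \<Longrightarrow> cmod (\<sigma> x) \<le> C * real N"
      using C(2)[of N] by blast
    define X1 where "X1 = exp (- t) * (D * real N)"
    define X2 where "X2 = exp t * (D * real N)"
    have "exp (- t) * (R * exp t) \<le> X1" unfolding X1_def using DN by (intro mult_left_mono) auto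
    then have X1: "R \<le> X1" by (simp add: exp_minus field_simps)
    have "1 * (D * real N) \<le> X2"
      unfolding X2_def using t D0 by (intro mult_right_mono) auto
    moreover have "R * 1 \<le> R * exp t" using t R by (intro mult_left_mono) auto
    ultimately have X2: "R \<le> X2" using DN by simp
    have X12: "X1 * X2 = (D * real N)\<^sup>2" by (simp add: X1_def X2_def exp_minus power2_eq_square field_simps)
    have rowb: "cmod (linform h j \<sigma> u) \<le> D * real N" if "u \<in> P \<times> P" "\<sigma> \<in> S" for u \<sigma> j
    proof -
      have "cmod (\<sigma> (fst u) * h \<sigma> $ 1 $ j) \<le> C * real N * H" "cmod (\<sigma> (snd u) * h \<sigma> $ 2 $ j) \<le> C * real N * H"
        unfolding norm_mult using that P(4) hH C(1) by (intro mult_mono; auto)+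
      then have "cmod (linform h j \<sigma> u) \<le> C * real N * H + C * real N * H"
        unfolding linform_def by (rule norm_triangle_mono)
      then show ?thesis by (simp add: D_def algebra_simps)
    qed
    define f where "f u = (\<lambda>\<sigma>\<in>S. (cell (R / 2) (of_real (exp (- t)) * linform h 1 \<sigma> u), cell (R / 2) (of_real (exp t) * linform h 2 \<sigma> u)))" for u
    let ?B = "\<Pi>\<^sub>E \<sigma>\<in>S. cells \<sigma> (X1 / (R / 2)) \<times> cells \<sigma> (X2 / (R / 2))"
    have R2: "R / 2 > 0" using R by simp
    have fB: "f ` (P \<times> P) \<subseteq> ?B"
    proof (intro image_subsetI PiE_I)
      fix u \<sigma> assume u: "u \<in> P \<times> P" "\<sigma> \<in> S"
      have r: "of_real s * linform h j \<sigma> u \<in> coord_field \<sigma>" for s j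
        using linform_coord_field[OF h u(2), of j u] by (auto simp: coord_field_def)
      have "cmod (of_real (exp (- t)) * linform h 1 \<sigma> u) \<le> X1" "cmod (of_real (exp t) * linform h 2 \<sigma> u) \<le> X2"
        unfolding X1_def X2_def norm_mult using rowb[OF u] by simp_all
      then show "f u \<sigma> \<in> cells \<sigma> (X1 / (R / 2)) \<times> cells \<sigma> (X2 / (R / 2))"
        using cell_in_cells[OF R2 r] u(2) by (simp add: f_def)
    qed (simp add: f_def)
    have finB: "finite ?B" using finS finite_cells by (intro finite_PiE finite_cartesian_product) auto
    have "7 * X1 / R * (7 * X2 / R) = 49 * (X1 * X2) / (R * R)" by simp
    then have X127: "7 * X1 / R * (7 * X2 / R) = (7 * D * real N / R)\<^sup>2"
      unfolding X12 by (simp add: power2_eq_square mult.assoc mult.left_commute)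
    \<comment> \<open>Origin of the 7: the left side is \<open>4 * z / R + 3\<close>, and the 3 is
      absorbed because \<open>z / R \<ge> 1\<close>.\<close>
    have num: "2 * (z / (R / 2)) + 3 \<le> 7 * z / R" if "R \<le> z" for z
    proof -
      have "1 \<le> z / R" using that R by simp
      then show ?thesis by simp
    qed
    have cardB: "real (card ?B) \<le> (7 * D * real N / R) ^ (2 * ?d)"
    proof -
      have "real (card ?B) = (\<Prod>\<sigma>\<in>S. real (card (cells \<sigma> (X1 / (R / 2)))) * real (card (cells \<sigma> (X2 / (R / 2)))))"
        using finS by (simp add: card_PiE card_cartesian_product)
      also have "\<dots> \<le> (\<Prod>\<sigma>\<in>S. ((7 * D * real N / R)\<^sup>2) ^ weight \<sigma>)"
      proof (intro prod_mono conjI)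
        fix \<sigma>
        have "real (card (cells \<sigma> (X1 / (R / 2)))) * real (card (cells \<sigma> (X2 / (R / 2)))) \<le>
            (2 * (X1 / (R / 2)) + 3) ^ weight \<sigma> * (2 * (X2 / (R / 2)) + 3) ^ weight \<sigma>"
          using X1 X2 R by (intro mult_mono card_cells) auto
        also have "\<dots> \<le> (7 * X1 / R) ^ weight \<sigma> * (7 * X2 / R) ^ weight \<sigma>"
          using X1 X2 R by (intro mult_mono power_mono num zero_le_power add_nonneg_nonneg) simp_all
        also have "\<dots> = ((7 * D * real N / R)\<^sup>2) ^ weight \<sigma>"
          unfolding power_mult_distrib[symmetric] X127 ..
        finally show "real (card (cells \<sigma> (X1 / (R / 2)))) * real (card (cells \<sigma> (X2 / (R / 2)))) \<le>
          ((7 * D * real N / R)\<^sup>2) ^ weight \<sigma>" .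
      qed auto
      also have "\<dots> = ((7 * D * real N / R)\<^sup>2) ^ ?d"
        by (simp only: power_sum[symmetric] sum_weight[OF K S])
      finally show ?thesis by (simp only: power_mult)
    qed
    have "(R / (7 * D)) ^ (2 * ?d) * real (card ?B) \<le> (R / (7 * D)) ^ (2 * ?d) * (7 * D * real N / R) ^ (2 * ?d)"
      using cardB R D0 by (intro mult_left_mono) auto
    also have "\<dots> = real N ^ (2 * ?d)"
      unfolding power_mult_distrib[symmetric] using R D0 by simp
    also have "\<dots> \<le> (real N + 1) ^ (2 * ?d)" by (intro power_mono) auto
    also have "\<dots> = real (card (P \<times> P))"
      by (simp add: card_cartesian_product P(2) mult_2 power_add add.commute)
    finally have cnt: "(R / (7 * D)) ^ (2 * ?d) * real (card ?B) \<le> real (card (P \<times> P))" .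
    have "P \<noteq> {}" using P(2) by auto
    then have ne: "P \<times> P \<noteq> {}" by auto
    have finP: "finite (P \<times> P)" using P(1) by simp
    obtain b where b: "b \<in> ?B" "(R / (7 * D)) ^ (2 * ?d) \<le> real (card {u \<in> P \<times> P. f u = b})"
      by (rule pigeonhole_fibre[OF finP finB fB ne cnt])
    define T where "T = {u \<in> P \<times> P. f u = b}"
    have "(0::real) < (R / (7 * D)) ^ (2 * ?d)" using R D0 by simp
    then have "card T \<noteq> 0" using b(2) unfolding T_def by linarith
    then have "T \<noteq> {}" by auto
    moreover have "finite T" using P(1) by (simp add: T_def)
    moreover have "integral_pair u" if "u \<in> T" for u
      using that P(3) by (auto simp: T_def integral_pair_def)
    moreover have "exp (- t) * cmod (linform h 1 \<sigma> (u - v)) \<le> R \<and> exp t * cmod (linform h 2 \<sigma> (u - v)) \<le> R"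
      if uv: "u \<in> T" "v \<in> T" and s: "\<sigma> \<in> S" for u v \<sigma>
    proof -
      have "f u \<sigma> = f v \<sigma>" using uv by (simp add: T_def)
      then have eq: "cell (R / 2) (of_real (exp (- t)) * linform h 1 \<sigma> u) = cell (R / 2) (of_real (exp (- t)) * linform h 1 \<sigma> v)"
        "cell (R / 2) (of_real (exp t) * linform h 2 \<sigma> u) = cell (R / 2) (of_real (exp t) * linform h 2 \<sigma> v)"
        using s by (simp_all add: f_def)
      show ?thesis
        using cell_eq_bound[OF R2 eq(1)] cell_eq_bound[OF R2 eq(2)]
        by (simp add: linform_diff[OF rm[OF s]] norm_mult flip: right_diff_distrib)
    qed
    ultimately show "\<exists>T. finite T \<and> T \<noteq> {} \<and> (R / (7 * D)) ^ (2 * ?d) \<le> real (card T) \<and>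
      (\<forall>u\<in>T. integral_pair u) \<and>
      (\<forall>u\<in>T. \<forall>v\<in>T. \<forall>\<sigma>\<in>S. exp (- t) * cmod (linform h 1 \<sigma> (u - v)) \<le> R \<and> exp t * cmod (linform h 2 \<sigma> (u - v)) \<le> R)"
      using b(2) unfolding T_def[symmetric] by (intro exI[of _ T] conjI ballI) auto
  qed
qed

text \<open>For \<open>R\<close> large the lower count of \<open>many_short_vectors\<close> exceeds
  the upper count of \<open>card_short_collinear\<close>, uniformly in \<open>t\<close>.\<close>

lemma two_short_vectors:
  assumes K: "number_field TYPE('k::field_char_0)" and S: "embedding_system (S :: ('k \<Rightarrow> complex) set)"
    and h: "h \<in> carrier (SL2_KS S)" and c: "c > 0"
    and ht: "\<And>t u. t \<ge> 0 \<Longrightarrow> integral_pair u \<Longrightarrow> u \<noteq> 0 \<Longrightarrow> c \<le> height S h t u"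
  obtains R where "R > 0" "\<And>t. t \<ge> 0 \<Longrightarrow> \<exists>u v. integral_pair u \<and> integral_pair v \<and> fst u * snd v - snd u * fst v \<noteq> 0 \<and>
    (\<forall>\<sigma>\<in>S. exp (- t) * cmod (linform h 1 \<sigma> u) \<le> R \<and> exp t * cmod (linform h 2 \<sigma> u) \<le> R \<and>
      exp (- t) * cmod (linform h 1 \<sigma> v) \<le> R \<and> exp t * cmod (linform h 2 \<sigma> v) \<le> R)"
proof -
  let ?d = "number_field_degree TYPE('k)"
  have d0: "?d > 0" by (rule number_field_degree_pos[OF K S])
  \<comment> \<open>\<open>2 * \<epsilon> \<le> 1\<close> and \<open>2 * \<epsilon> < c\<close>,
    hence \<open>(2 * \<epsilon>) ^ d \<le> 2 * \<epsilon> < c\<close>.\<close>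
  define \<epsilon> where "\<epsilon> = min 1 (c / 2) / 2"
  have \<epsilon>: "\<epsilon> > 0" using c by (simp add: \<epsilon>_def)
  have "(2 * \<epsilon>) ^ ?d \<le> (2 * \<epsilon>) ^ 1" using \<epsilon> d0 by (intro power_decreasing) (auto simp: \<epsilon>_def)
  then have \<epsilon>c: "(2 * \<epsilon>) ^ ?d < c" using c by (simp add: \<epsilon>_def)
  obtain D where D: "D > 0" "\<And>R t. R > 0 \<Longrightarrow> t \<ge> 0 \<Longrightarrow> \<exists>T. finite T \<and> T \<noteq> {} \<and> (R / D) ^ (2 * ?d) \<le> real (card T) \<and>
    (\<forall>u\<in>T. integral_pair u) \<and>
    (\<forall>u\<in>T. \<forall>v\<in>T. \<forall>\<sigma>\<in>S. exp (- t) * cmod (linform h 1 \<sigma> (u - v)) \<le> R \<and> exp t * cmod (linform h 2 \<sigma> (u - v)) \<le> R)"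
    using many_short_vectors[OF K S h] by blast
  \<comment> \<open>Makes \<open>(R / D)\<^sup>2\<close> exceed
    \<open>R * (2 / \<epsilon> + 3)\<close>, which is at least \<open>2 * R / \<epsilon> + 3\<close>
    as \<open>R \<ge> 1\<close>.\<close>
  define R where "R = 1 + D\<^sup>2 * (2 / \<epsilon> + 3)"
  have R1: "R \<ge> 1" using \<epsilon> by (simp add: R_def)
  have "2 * R / \<epsilon> + 3 \<le> R * (2 / \<epsilon> + 3)" using R1 by (simp add: algebra_simps)
  also have "\<dots> < R * (R / D\<^sup>2)"
    using R1 D(1) by (intro mult_strict_left_mono) (auto simp: R_def field_simps)
  finally have "2 * R / \<epsilon> + 3 < (R / D)\<^sup>2" by (simp add: power2_eq_square)
  then have big: "(2 * R / \<epsilon> + 3) ^ ?d < (R / D) ^ (2 * ?d)"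
    unfolding power_mult using d0 R1 \<epsilon> by (intro power_strict_mono) auto
  show thesis
  proof (rule that[of R])
    show "R > 0" using R1 by simp
    fix t :: real assume t: "t \<ge> 0"
    have R0: "R > 0" using R1 by simp
    obtain T where T: "finite T" "T \<noteq> {}" "(R / D) ^ (2 * ?d) \<le> real (card T)" "\<And>u. u \<in> T \<Longrightarrow> integral_pair u"
      "\<And>u v \<sigma>. u \<in> T \<Longrightarrow> v \<in> T \<Longrightarrow> \<sigma> \<in> S \<Longrightarrow> exp (- t) * cmod (linform h 1 \<sigma> (u - v)) \<le> R"
      "\<And>u v \<sigma>. u \<in> T \<Longrightarrow> v \<in> T \<Longrightarrow> \<sigma> \<in> S \<Longrightarrow> exp t * cmod (linform h 2 \<sigma> (u - v)) \<le> R"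
      using D(2)[OF R0 t] by blast
    obtain u0 where u0: "u0 \<in> T" using T(2) by blast
    \<comment> \<open>Only differences are known to be short, so one vector of \<open>T\<close> is
      moved to 0.\<close>
    define T' where "T' = (\<lambda>u. u - u0) ` T"
    have "card T' = card T" unfolding T'_def by (rule card_image) (simp add: inj_on_def)
    then have big': "(2 * R / \<epsilon> + 3) ^ ?d < real (card T')" using T(3) big by simp
    have T': "integral_pair u" "\<And>\<sigma>. \<sigma> \<in> S \<Longrightarrow> exp (- t) * cmod (linform h 1 \<sigma> u) \<le> R"
      "\<And>\<sigma>. \<sigma> \<in> S \<Longrightarrow> exp t * cmod (linform h 2 \<sigma> u) \<le> R" if "u \<in> T'" for u
      using that T(4-6) u0 integral_pair_diff unfolding T'_def by blast+
    have finT': "finite T'" using T(1) by (simp add: T'_def)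
    have "\<exists>u\<in>T'. \<exists>v\<in>T'. fst u * snd v - snd u * fst v \<noteq> 0"
    proof (rule ccontr)
      assume "\<not> ?thesis"
      then have coll: "\<And>u v. u \<in> T' \<Longrightarrow> v \<in> T' \<Longrightarrow> fst u * snd v - snd u * fst v = 0" by blast
      have "real (card T') \<le> (2 * R / \<epsilon> + 3) ^ ?d"
        by (rule card_short_collinear[OF K S h ht[OF t] \<epsilon> \<epsilon>c finT' T' coll less_imp_le[OF R0]])
      then show False using big' by simp
    qed
    then obtain u v where "u \<in> T'" "v \<in> T'" "fst u * snd v - snd u * fst v \<noteq> 0" by blast
    then show "\<exists>u v. integral_pair u \<and> integral_pair v \<and> fst u * snd v - snd u * fst v \<noteq> 0 \<and>
    (\<forall>\<sigma>\<in>S. exp (- t) * cmod (linform h 1 \<sigma> u) \<le> R \<and> exp t * cmod (linform h 2 \<sigma> u) \<le> R \<and>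
      exp (- t) * cmod (linform h 1 \<sigma> v) \<le> R \<and> exp t * cmod (linform h 2 \<sigma> v) \<le> R)"
      using T'(1)[of u] T'(1)[of v] T'(2)[of u] T'(2)[of v] T'(3)[of u] T'(3)[of v]
      by (intro exI[of _ u] exI[of _ v] conjI ballI) simp_all
  qed
qed

text \<open>Matrices of equal determinant \<open>\<delta>\<close> that agree modulo a multiple of \<open>\<delta>\<close> differ by a factor
  in \<open>SL\<^sub>2\<close>, and residues have representatives of bounded size.\<close>

lemma finite_integral_matrix_classes:
  assumes K: "number_field TYPE('k::field_char_0)" and S: "embedding_system (S :: ('k \<Rightarrow> complex) set)"
  obtains F :: "('k::field_char_0^2^2) set" where "finite F" "\<And>A. A \<in> F \<Longrightarrow> det A \<noteq> 0"
    "\<And>A. (\<And>i j. A $ i $ j \<in> ring_of_integers) \<Longrightarrow> det A \<noteq> 0 \<Longrightarrow> (\<And>\<sigma>. \<sigma> \<in> S \<Longrightarrow> cmod (\<sigma> (det A)) \<le> Q) \<Longrightarrow>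
      \<exists>A0\<in>F. \<exists>\<gamma>\<in>carrier (SL2 ring_of_integers). A = A0 ** \<gamma>"
proof -
  note rm = embedding_system_ring_map[OF S]
  define \<O> where "\<O> = (ring_of_integers :: 'k set)"
  have \<O>: "x \<in> \<O> \<longleftrightarrow> algebraic_int x" for x by (simp add: \<O>_def ring_of_integers_def)
  have \<O>c: "0 \<in> \<O>" "1 \<in> \<O>" "x \<in> \<O> \<Longrightarrow> y \<in> \<O> \<Longrightarrow> x + y \<in> \<O>" "x \<in> \<O> \<Longrightarrow> y \<in> \<O> \<Longrightarrow> x - y \<in> \<O>"
    "x \<in> \<O> \<Longrightarrow> y \<in> \<O> \<Longrightarrow> x * y \<in> \<O>" "x \<in> \<O> \<Longrightarrow> - x \<in> \<O>" for x y
    by (auto simp: \<O> algebraic_int_add algebraic_int_diff algebraic_int_mult intro: int_imp_algebraic_int)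
  obtain C where C: "\<forall>z. (\<forall>\<sigma>\<in>S. z \<sigma> \<in> coord_field \<sigma>) \<longrightarrow>
      (\<exists>x. algebraic_int x \<and> (\<forall>\<sigma>\<in>S. cmod (z \<sigma> - \<sigma> x) \<le> C))"
    using integers_cobounded[OF K S] by (rule exE)
  \<comment> \<open>A rational integer \<open>m \<delta>\<close> divisible by
    \<open>\<delta>\<close>, with cofactor \<open>\<kappa> \<delta>\<close>; congruences modulo
    \<open>\<delta>\<close> are replaced by congruences modulo \<open>m \<delta>\<close>, for which
    residues can be chosen by rounding.\<close>
  have "\<exists>m \<kappa>. \<delta> \<in> \<O> \<longrightarrow> \<delta> \<noteq> 0 \<longrightarrow> m \<noteq> (0::int) \<and> \<kappa> \<in> \<O> \<and> \<delta> * \<kappa> = of_int m" for \<delta>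
  proof (cases "\<delta> \<in> \<O> \<and> \<delta> \<noteq> 0")
    case True
    then have "algebraic_int \<delta>" "\<delta> \<noteq> 0" by (auto simp: \<O>)
    then obtain m \<kappa> where "m \<noteq> (0::int)" "algebraic_int \<kappa>" "\<delta> * \<kappa> = of_int m"
      by (rule algebraic_int_dvd_int)
    then show ?thesis by (intro exI[of _ m] exI[of _ \<kappa>]) (simp add: \<O>)
  qed auto
  then obtain m \<kappa> where m: "\<And>\<delta>. \<delta> \<in> \<O> \<Longrightarrow> \<delta> \<noteq> 0 \<Longrightarrow> m \<delta> \<noteq> (0::int)"
    and \<kappa>: "\<And>\<delta>. \<delta> \<in> \<O> \<Longrightarrow> \<delta> \<noteq> 0 \<Longrightarrow> \<kappa> \<delta> \<in> \<O>" "\<And>\<delta>. \<delta> \<in> \<O> \<Longrightarrow> \<delta> \<noteq> 0 \<Longrightarrow> \<delta> * \<kappa> \<delta> = of_int (m \<delta>)"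
    by metis
  \<comment> \<open>Rounding \<open>e / k\<close> to an algebraic integer leaves a representative of
    \<open>e\<close> modulo \<open>k\<close> of bounded size.\<close>
  have "\<exists>y. k \<noteq> 0 \<longrightarrow> y \<in> \<O> \<and> (\<forall>\<sigma>\<in>S. cmod (\<sigma> (e - of_int k * y)) \<le> \<bar>of_int k\<bar> * C)" for e :: 'k and k :: int
  proof (cases "k = 0")
    case False
    have "\<forall>\<sigma>\<in>S. \<sigma> e / of_int k \<in> coord_field \<sigma>"
      by (auto simp: coord_field_def real_valued_def image_subset_iff Reals_divide)
    then obtain y where y: "algebraic_int y" "\<And>\<sigma>. \<sigma> \<in> S \<Longrightarrow> cmod (\<sigma> e / of_int k - \<sigma> y) \<le> C"
      using C[THEN spec, THEN mp, of "\<lambda>\<sigma>. \<sigma> e / of_int k"] by auto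
    have "cmod (\<sigma> (e - of_int k * y)) \<le> \<bar>of_int k\<bar> * C" if s: "\<sigma> \<in> S" for \<sigma>
    proof -
      have "\<sigma> (e - of_int k * y) = of_int k * (\<sigma> e / of_int k - \<sigma> y)"
        using False by (simp add: ring_map_diff[OF rm[OF s]] ring_map_mult[OF rm[OF s]]
            ring_map_of_int[OF rm[OF s]] right_diff_distrib)
      then have "cmod (\<sigma> (e - of_int k * y)) = \<bar>of_int k\<bar> * cmod (\<sigma> e / of_int k - \<sigma> y)"
        by (simp add: norm_mult)
      then show ?thesis using y(2)[OF s] by (simp add: mult_left_mono)
    qed
    then show ?thesis using y(1) by (intro exI[of _ y]) (simp add: \<O>)
  qed auto
  then obtain Y where Y: "\<And>k e. k \<noteq> 0 \<Longrightarrow> Y k e \<in> \<O>"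
    "\<And>k e \<sigma>. k \<noteq> 0 \<Longrightarrow> \<sigma> \<in> S \<Longrightarrow> cmod (\<sigma> (e - of_int k * Y k e)) \<le> \<bar>of_int k\<bar> * C"
    by metis
  define \<M> where "\<M> = {A :: 'k^2^2. (\<forall>i j. A $ i $ j \<in> \<O>) \<and> det A \<noteq> 0 \<and> (\<forall>\<sigma>\<in>S. cmod (\<sigma> (det A)) \<le> Q)}"
  define red where "red A = (\<chi> i j. A $ i $ j - of_int (m (det A)) * Y (m (det A)) (A $ i $ j))" for A :: "'k^2^2"
  \<comment> \<open>Equal keys mean equal determinants and equal residues of all entries; there are
    finitely many keys, and \<open>F\<close> contains a matrix for each.\<close>
  define key where "key A = (det A, red A)" for A :: "'k^2^2"
  have detO: "det A \<in> \<O>" if "A \<in> \<M>" for A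
    using that by (auto simp: \<M>_def det_2 intro!: \<O>c)
  define \<Delta> where "\<Delta> = {x. algebraic_int x \<and> (\<forall>\<sigma>\<in>S. cmod (\<sigma> x) \<le> Q)}"
  have "key ` \<M> \<subseteq> (\<Union>\<delta>\<in>\<Delta>. {\<delta>} \<times> {A :: 'k^2^2. \<forall>i j. A $ i $ j \<in> ring_of_integers \<and>
      (\<forall>\<sigma>\<in>S. cmod (\<sigma> (A $ i $ j)) \<le> \<bar>of_int (m \<delta>)\<bar> * C)})"
  proof
    fix x assume "x \<in> key ` \<M>"
    then obtain A where A: "A \<in> \<M>" "x = key A" by blast
    have d: "det A \<in> \<O>" "det A \<noteq> 0" using detO A(1) by (auto simp: \<M>_def)
    have "det A \<in> \<Delta>" using A(1) d(1) by (auto simp: \<Delta>_def \<M>_def \<O>)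
    moreover have "red A $ i $ j \<in> ring_of_integers" for i j
      using A(1) Y(1)[OF m[OF d]] unfolding \<O>_def[symmetric]
      by (auto simp: red_def \<M>_def \<O> intro!: algebraic_int_diff algebraic_int_mult algebraic_int_of_int)
    moreover have "cmod (\<sigma> (red A $ i $ j)) \<le> \<bar>of_int (m (det A))\<bar> * C" if "\<sigma> \<in> S" for i j \<sigma>
      using Y(2)[OF m[OF d] that] by (simp add: red_def)
    ultimately show "x \<in> (\<Union>\<delta>\<in>\<Delta>. {\<delta>} \<times> {A :: 'k^2^2. \<forall>i j. A $ i $ j \<in> ring_of_integers \<and>
      (\<forall>\<sigma>\<in>S. cmod (\<sigma> (A $ i $ j)) \<le> \<bar>of_int (m \<delta>)\<bar> * C)})"
      unfolding A(2) key_def by (intro UN_I[of "det A"]) auto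
  qed
  moreover have "finite \<Delta>" unfolding \<Delta>_def by (rule finite_bounded_integers[OF K S])
  ultimately have "finite (key ` \<M>)"
    by (elim finite_subset) (intro finite_UN_I finite_cartesian_product finite_integral_matrices[OF K S]; simp)
  then obtain F where F: "F \<subseteq> \<M>" "finite F" "key ` \<M> = key ` F"
    using finite_subset_image[OF _ subset_refl, of key \<M>] by auto
  show thesis
  proof (rule that[OF F(2)])
    show "det A \<noteq> 0" if "A \<in> F" for A using that F(1) by (auto simp: \<M>_def)
    fix A :: "'k^2^2"
    assume "\<And>i j. A $ i $ j \<in> ring_of_integers" "det A \<noteq> 0" "\<And>\<sigma>. \<sigma> \<in> S \<Longrightarrow> cmod (\<sigma> (det A)) \<le> Q"
    then have A: "A \<in> \<M>" by (simp add: \<M>_def \<O>_def)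
    then have "key A \<in> key ` F" using F(3) by blast
    then obtain A0 where A0: "A0 \<in> F" "key A = key A0" by blast
    have A0M: "A0 \<in> \<M>" using A0 F(1) by blast
    define \<delta> where "\<delta> = det A0"
    have \<delta>: "\<delta> \<in> \<O>" "\<delta> \<noteq> 0" using detO[OF A0M] A0M by (auto simp: \<delta>_def \<M>_def)
    have dA: "det A = \<delta>" and r: "red A = red A0" using A0(2) by (auto simp: key_def \<delta>_def)
    define W where "W = (\<chi> i j. Y (m \<delta>) (A $ i $ j) - Y (m \<delta>) (A0 $ i $ j))"
    have W: "W $ i $ j \<in> \<O>" for i j
      using Y(1)[OF m[OF \<delta>]] \<O>c by (simp add: W_def)
    have AW: "A $ i $ j = A0 $ i $ j + of_int (m \<delta>) * W $ i $ j" for i j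
    proof -
      have "red A $ i $ j = red A0 $ i $ j" using r by simp
      then show ?thesis unfolding red_def W_def dA by (simp add: \<delta>_def[symmetric] algebra_simps)
    qed
    \<comment> \<open>From \<open>A - A0 = m W = \<delta> \<kappa> W\<close> and
      \<open>A0 adj(A0) = \<delta>\<close>: the quotient of \<open>A\<close> by \<open>A0\<close> on
      the left is \<open>1 + \<kappa> adj(A0) W\<close>, which is integral.\<close>
    define \<gamma> where "\<gamma> = mat 1 + (\<chi> i j. \<kappa> \<delta> * (adj2 A0 ** W) $ i $ j)"
    have \<kappa>\<delta>: "\<kappa> \<delta> * (A0$1$1 * A0$2$2 - A0$1$2 * A0$2$1) = of_int (m \<delta>)"
      using \<kappa>(2)[OF \<delta>] by (simp add: \<delta>_def det_2 mult.commute)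
    have eq: "A = A0 ** \<gamma>"
      unfolding matrix_2_eq_iff matrix_mult_2_nth AW \<gamma>_def \<kappa>\<delta>[symmetric]
      by (simp add: matrix_mult_2_nth algebra_simps)
    have "\<gamma> $ i $ j \<in> \<O>" for i j
    proof -
      have "A0 $ i $ j \<in> \<O>" for i j using A0M by (simp add: \<M>_def)
      then have "adj2 A0 $ i $ j \<in> \<O>" for i j using \<O>c(6) exhaust_2[of i] exhaust_2[of j] by auto
      then have "\<kappa> \<delta> * (adj2 A0 ** W) $ i $ j \<in> \<O>"
        unfolding matrix_mult_2_nth using W \<kappa>(1)[OF \<delta>] by (intro \<O>c)
      moreover have "(mat 1 :: 'k^2^2) $ i $ j \<in> \<O>" using exhaust_2[of i] exhaust_2[of j] \<O>c(1,2) by auto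
      ultimately show ?thesis unfolding \<gamma>_def using \<O>c(3) by simp
    qed
    moreover have "det \<gamma> = 1" using eq dA \<delta>(2) by (simp add: det_mul \<delta>_def)
    ultimately show "\<exists>A0\<in>F. \<exists>\<gamma>\<in>carrier (SL2 ring_of_integers). A = A0 ** \<gamma>"
      using A0(1) eq by (intro bexI[of _ A0] bexI[of _ \<gamma>]) (simp_all add: SL2_carrier \<O>_def)
  qed
qed

text \<open>The two short vectors are the rows of an integral matrix \<open>A\<close> for which
  \<open>A h\<close> is bounded at time \<open>t\<close>. Writing \<open>A = A0 \<gamma>\<close>
  with \<open>A0\<close> from a finite list, \<open>\<gamma>\<close> moves the orbit point into a
  bounded set, at the cost of the inverse of \<open>A0\<close>.\<close>

theorem bounded_trajectory_if_height_bounded: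
  assumes K: "number_field TYPE('k::field_char_0)" and S: "embedding_system (S :: ('k \<Rightarrow> complex) set)"
    and h: "h \<in> carrier (SL2_KS S)" and c: "c > 0"
    and ht: "\<And>t u. t \<ge> 0 \<Longrightarrow> integral_pair u \<Longrightarrow> u \<noteq> 0 \<Longrightarrow> c \<le> height S h t u"
  shows "bounded_trajectory S (SL2_OK S #>\<^bsub>SL2_KS S\<^esub> h)"
proof -
  note rm = embedding_system_ring_map[OF S]
  note finS = finite_embedding_system[OF K S]
  show ?thesis
  proof (rule two_short_vectors[OF K S h c ht])
    fix R :: real
    assume R: "R > 0" and short: "\<And>t. t \<ge> 0 \<Longrightarrow> \<exists>u v. integral_pair u \<and> integral_pair v \<and> fst u * snd v - snd u * fst v \<noteq> 0 \<and>
      (\<forall>\<sigma>\<in>S. exp (- t) * cmod (linform h 1 \<sigma> u) \<le> R \<and> exp t * cmod (linform h 2 \<sigma> u) \<le> R \<and>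
      exp (- t) * cmod (linform h 1 \<sigma> v) \<le> R \<and> exp t * cmod (linform h 2 \<sigma> v) \<le> R)"
    show ?thesis
    \<comment> \<open>Bound for \<open>\<sigma> (det A)\<close>: \<open>h\<close> and the flow have
      determinant one, so it is the determinant of a matrix with entries at most
      \<open>R\<close>.\<close>
    proof (rule finite_integral_matrix_classes[OF K S, of "2 * R * R"])
      fix F :: "('k^2^2) set"
      assume F: "finite F" "\<And>A. A \<in> F \<Longrightarrow> det A \<noteq> 0"
        "\<And>A. (\<And>i j. A $ i $ j \<in> ring_of_integers) \<Longrightarrow> det A \<noteq> 0 \<Longrightarrow> (\<And>\<sigma>. \<sigma> \<in> S \<Longrightarrow> cmod (\<sigma> (det A)) \<le> 2 * R * R) \<Longrightarrow>
          \<exists>A0\<in>F. \<exists>\<gamma>\<in>carrier (SL2 ring_of_integers). A = A0 ** \<gamma>"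
      define b where "b A \<sigma> = (\<Sum>i\<in>UNIV. \<Sum>j\<in>UNIV. cmod (\<sigma> (A $ i $ j)))" for A :: "'k^2^2" and \<sigma> :: "'k \<Rightarrow> complex"
      have b: "cmod (\<sigma> (A $ i $ j)) \<le> b A \<sigma>" for A \<sigma> i j
      proof -
        have "cmod (\<sigma> (A $ i $ j)) \<le> (\<Sum>j\<in>UNIV. cmod (\<sigma> (A $ i $ j)))" by (rule member_le_sum) auto
        also have "\<dots> \<le> b A \<sigma>"
          unfolding b_def by (rule member_le_sum) (auto intro: sum_nonneg)
        finally show ?thesis .
      qed
      have b0: "b A \<sigma> \<ge> 0" for A \<sigma> unfolding b_def by (intro sum_nonneg) auto
      define R' where "R' = (\<Sum>A\<in>F. \<Sum>\<sigma>\<in>S. 2 * b A \<sigma> * R / cmod (\<sigma> (det A)))"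
      have R': "2 * b A \<sigma> * R / cmod (\<sigma> (det A)) \<le> R'" if "A \<in> F" "\<sigma> \<in> S" for A \<sigma>
      proof -
        have "2 * b A \<sigma> * R / cmod (\<sigma> (det A)) \<le> (\<Sum>\<sigma>\<in>S. 2 * b A \<sigma> * R / cmod (\<sigma> (det A)))"
          by (rule member_le_sum[OF that(2)]) (use b0 R finS in auto)
        also have "\<dots> \<le> R'"
          unfolding R'_def by (rule member_le_sum[OF that(1)]) (use b0 R F(1) in \<open>auto intro!: sum_nonneg\<close>)
        finally show ?thesis .
      qed
      show ?thesis
      proof (rule bounded_trajectory_if_bounded[OF K S h, of R'])
        fix t :: real assume t: "t \<ge> 0"
        obtain u v where uv: "integral_pair u" "integral_pair v" "fst u * snd v - snd u * fst v \<noteq> 0"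
          and sh: "\<And>\<sigma>. \<sigma> \<in> S \<Longrightarrow> exp (- t) * cmod (linform h 1 \<sigma> u) \<le> R \<and> exp t * cmod (linform h 2 \<sigma> u) \<le> R \<and>
            exp (- t) * cmod (linform h 1 \<sigma> v) \<le> R \<and> exp t * cmod (linform h 2 \<sigma> v) \<le> R"
          using short[OF t] by blast
        define A :: "'k^2^2" where "A = vector [vector [fst u, snd u], vector [fst v, snd v]]"
        have A: "A$1$1 = fst u" "A$1$2 = snd u" "A$2$1 = fst v" "A$2$2 = snd v" by (simp_all add: A_def)
        have fl: "flow S t \<sigma> $ 1 $ 1 = of_real (exp (- t))" "flow S t \<sigma> $ 1 $ 2 = 0" "flow S t \<sigma> $ 2 $ 1 = 0"
          "flow S t \<sigma> $ 2 $ 2 = of_real (exp t)" if "\<sigma> \<in> S" for \<sigma>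
          using that by (simp_all add: flow_def)
        have Ash: "cmod ((emb \<sigma> A ** (h \<sigma> ** flow S t \<sigma>)) $ i $ j) \<le> R" if s: "\<sigma> \<in> S" for \<sigma> i j
        proof -
          have "(emb \<sigma> A ** (h \<sigma> ** flow S t \<sigma>)) $ 1 $ 1 = of_real (exp (- t)) * linform h 1 \<sigma> u"
            "(emb \<sigma> A ** (h \<sigma> ** flow S t \<sigma>)) $ 1 $ 2 = of_real (exp t) * linform h 2 \<sigma> u"
            "(emb \<sigma> A ** (h \<sigma> ** flow S t \<sigma>)) $ 2 $ 1 = of_real (exp (- t)) * linform h 1 \<sigma> v"
            "(emb \<sigma> A ** (h \<sigma> ** flow S t \<sigma>)) $ 2 $ 2 = of_real (exp t) * linform h 2 \<sigma> v"
            by (simp_all add: matrix_mult_2_nth fl[OF s] A linform_def algebra_simps)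
          then show ?thesis
            using sh[OF s] exhaust_2[of i] exhaust_2[of j] by (auto simp: norm_mult)
        qed
        have hf: "det (h \<sigma> ** flow S t \<sigma>) = 1" if "\<sigma> \<in> S" for \<sigma>
          using SL2_KS_coord[OF h that] SL2_KS_coord[OF flow_carrier that] by (simp add: SL2_carrier det_mul)
        have "det A \<noteq> 0" using uv(3) by (simp add: det_2 A)
        moreover have "A $ i $ j \<in> ring_of_integers" for i j
          using uv(1,2) exhaust_2[of i] exhaust_2[of j] by (auto simp: A ring_of_integers_def integral_pair_def)
        moreover have "cmod (\<sigma> (det A)) \<le> 2 * R * R" if s: "\<sigma> \<in> S" for \<sigma>
        proof -
          let ?M = "emb \<sigma> A ** (h \<sigma> ** flow S t \<sigma>)"
          have "\<sigma> (det A) = det ?M" by (simp only: det_mul[of "emb \<sigma> A"] hf[OF s] det_emb[OF rm[OF s]] mult_1_right)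
          also have "\<dots> = ?M$1$1 * ?M$2$2 - ?M$1$2 * ?M$2$1" by (rule det_2)
          finally have "cmod (\<sigma> (det A)) \<le> cmod (?M$1$1 * ?M$2$2) + cmod (?M$1$2 * ?M$2$1)"
            by (simp only: norm_triangle_ineq4)
          also have "\<dots> \<le> R * R + R * R"
            unfolding norm_mult using Ash[OF s] R by (intro add_mono mult_mono) auto
          finally show ?thesis by simp
        qed
        ultimately obtain A0 \<gamma> where A0: "A0 \<in> F" "\<gamma> \<in> carrier (SL2 ring_of_integers)" "A = A0 ** \<gamma>"
          using F(3)[of A] by blast
        have "cmod ((emb \<sigma> \<gamma> ** (h \<sigma> ** flow S t \<sigma>)) $ i $ j) \<le> R'" if s: "\<sigma> \<in> S" for \<sigma> i j
        proof -
          let ?N = "emb \<sigma> \<gamma> ** (h \<sigma> ** flow S t \<sigma>)"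
          have rs: "ring_map \<sigma>" using rm[OF s] .
          have MN: "emb \<sigma> A ** (h \<sigma> ** flow S t \<sigma>) = emb \<sigma> A0 ** ?N"
            by (simp add: A0(3) emb_mult[OF rs] matrix_mul_assoc)
          have "(adj2 (emb \<sigma> A0) ** (emb \<sigma> A0 ** ?N)) $ i $ j = det (emb \<sigma> A0) * ?N $ i $ j"
          proof -
            have "(adj2 B ** (B ** X')) $ i $ j = det B * X' $ i $ j" for B X' :: "complex^2^2"
              using exhaust_2[of i] by (auto simp: matrix_mult_2_nth det_2 algebra_simps)
            then show ?thesis .
          qed
          then have "cmod (\<sigma> (det A0)) * cmod (?N $ i $ j) = cmod ((adj2 (emb \<sigma> A0) ** (emb \<sigma> A ** (h \<sigma> ** flow S t \<sigma>))) $ i $ j)"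
            by (simp only: MN det_emb[OF rs] norm_mult)
          also have "\<dots> \<le> 2 * b A0 \<sigma> * R"
          proof (rule matrix_mult_bound[OF adj2_bound Ash[OF s]])
            show "cmod (emb \<sigma> A0 $ i $ j) \<le> b A0 \<sigma>" for i j using b by simp
          qed
          finally have "cmod (?N $ i $ j) \<le> 2 * b A0 \<sigma> * R / cmod (\<sigma> (det A0))"
            using F(2)[OF A0(1)] ring_map_eq_0[OF rs] by (simp add: field_simps)
          then show ?thesis using R'[OF A0(1) s] by linarith
        qed
        then show "\<exists>A\<in>carrier (SL2 ring_of_integers). \<forall>\<sigma>\<in>S. \<forall>i j.
            cmod ((emb \<sigma> A ** (h \<sigma> ** flow S t \<sigma>)) $ i $ j) \<le> R'"
          using A0(2) by blast
      qed
    qed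
  qed
qed

section \<open>Trajectories along a curve\<close>

lemma has_vector_derivative_lipschitz:
  fixes f :: "real \<Rightarrow> 'a::real_normed_vector"
  assumes "convex I" "\<And>u. u \<in> I \<Longrightarrow> (f has_vector_derivative f' u) (at u within I)"
    and "\<And>u. u \<in> I \<Longrightarrow> norm (f' u) \<le> B" and "x \<in> I" "y \<in> I"
  shows "norm (f x - f y) \<le> B * \<bar>x - y\<bar>"
proof -
  have "norm (f x - f y) \<le> B * norm (x - y)"
  proof (rule differentiable_bound[OF assms(1) _ _ assms(4,5)])
    fix u assume u: "u \<in> I"
    show "(f has_derivative (\<lambda>h. h *\<^sub>R f' u)) (at u within I)"
      using assms(2)[OF u] by (simp add: has_vector_derivative_def)
    show "onorm (\<lambda>h. h *\<^sub>R f' u) \<le> B"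
    proof (rule onorm_le)
      fix h :: real
      have "norm (f' u) * norm h \<le> B * norm h" using assms(3)[OF u] by (intro mult_right_mono) auto
      then show "norm (h *\<^sub>R f' u) \<le> B * norm h" by (simp add: mult.commute)
    qed
  qed
  then show ?thesis by simp
qed

lemma C1_map_derivative:
  assumes "C1_map S \<phi>" "\<sigma> \<in> S" "x \<in> {0..1}"
  shows "((\<lambda>u. \<phi> u \<sigma>) has_vector_derivative coord_deriv \<phi> \<sigma> x) (at x within {0..1})"
proof -
  have "(\<lambda>u. \<phi> u \<sigma>) differentiable (at x within {0..1})"
    using assms by (auto simp: C1_map_def differentiable_on_def)
  then show ?thesis unfolding coord_deriv_def by (simp add: vector_derivative_works)
qed

lemma C1_map_lipschitz:
  assumes "C1_map S \<phi>" "finite S"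
  obtains L where "L \<ge> 0"
    "\<And>\<sigma> x y. \<sigma> \<in> S \<Longrightarrow> x \<in> {0..1} \<Longrightarrow> y \<in> {0..1} \<Longrightarrow> cmod (\<phi> x \<sigma> - \<phi> y \<sigma>) \<le> L * \<bar>x - y\<bar>"
proof -
  have "\<forall>\<sigma>\<in>S. \<exists>B. 0 \<le> B \<and> (\<forall>u\<in>{0..1}. cmod (coord_deriv \<phi> \<sigma> u) \<le> B)"
  proof
    fix \<sigma> assume s: "\<sigma> \<in> S"
    have "continuous_on {0..1} (coord_deriv \<phi> \<sigma>)" using assms(1) s by (simp add: C1_map_def)
    then have "bounded (coord_deriv \<phi> \<sigma> ` {0..1})"
      by (intro compact_imp_bounded compact_continuous_image) auto
    then obtain B where "B > 0" "\<forall>z\<in>coord_deriv \<phi> \<sigma> ` {0..1}. cmod z \<le> B"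
      unfolding bounded_pos by blast
    then show "\<exists>B. 0 \<le> B \<and> (\<forall>u\<in>{0..1}. cmod (coord_deriv \<phi> \<sigma> u) \<le> B)"
      by (intro exI[of _ B]) auto
  qed
  then have "\<exists>B. \<forall>\<sigma>\<in>S. 0 \<le> B \<sigma> \<and> (\<forall>u\<in>{0..1}. cmod (coord_deriv \<phi> \<sigma> u) \<le> B \<sigma>)"
    by (rule bchoice)
  then obtain B where "\<forall>\<sigma>\<in>S. 0 \<le> B \<sigma> \<and> (\<forall>u\<in>{0..1}. cmod (coord_deriv \<phi> \<sigma> u) \<le> B \<sigma>)"
    by (rule exE)
  then have B: "B \<sigma> \<ge> 0" "u \<in> {0..1} \<Longrightarrow> cmod (coord_deriv \<phi> \<sigma> u) \<le> B \<sigma>" if "\<sigma> \<in> S" for \<sigma> u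
    using that by simp_all
  show thesis
  proof (rule that[of "\<Sum>\<sigma>\<in>S. B \<sigma>"])
    show "0 \<le> (\<Sum>\<sigma>\<in>S. B \<sigma>)" by (intro sum_nonneg B)
    fix \<sigma> and x y :: real assume s: "\<sigma> \<in> S" and xy: "x \<in> {0..1}" "y \<in> {0..1}"
    have "B \<sigma> \<le> (\<Sum>\<sigma>\<in>S. B \<sigma>)" using s assms(2) B(1) by (intro member_le_sum) auto
    then have bd: "cmod (coord_deriv \<phi> \<sigma> u) \<le> (\<Sum>\<sigma>\<in>S. B \<sigma>)" if "u \<in> {0..1}" for u
      using B(2)[OF s that] by linarith
    show "cmod (\<phi> x \<sigma> - \<phi> y \<sigma>) \<le> (\<Sum>\<sigma>\<in>S. B \<sigma>) * \<bar>x - y\<bar>"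
      by (rule has_vector_derivative_lipschitz[of "{0..1}" "\<lambda>u. \<phi> u \<sigma>", OF _ C1_map_derivative[OF assms(1) s] bd xy]) auto
  qed
qed

text \<open>The mean value theorem fails for complex values. Instead the curve minus its linear part
  at \<open>p\<close> is Lipschitz near \<open>p\<close> with constant half the size of the
  derivative, so the linear part wins.\<close>

lemma C1_map_expanding:
  assumes C1: "C1_map S \<phi>" and s: "\<sigma> \<in> S" and p: "p \<in> {0..1}" and nz: "coord_deriv \<phi> \<sigma> p \<noteq> 0"
  shows "\<exists>\<delta>>0. \<forall>x\<in>{0..1} \<inter> ball p \<delta>. \<forall>y\<in>{0..1} \<inter> ball p \<delta>.
    cmod (coord_deriv \<phi> \<sigma> p) / 2 * \<bar>x - y\<bar> \<le> cmod (\<phi> x \<sigma> - \<phi> y \<sigma>)"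
proof -
  let ?D = "coord_deriv \<phi> \<sigma>"
  have "continuous_on {0..1} ?D" using C1 s by (simp add: C1_map_def)
  moreover have "cmod (?D p) / 2 > 0" using nz by simp
  ultimately obtain \<delta> where \<delta>: "\<delta> > 0" "\<And>u. u \<in> {0..1} \<Longrightarrow> dist u p < \<delta> \<Longrightarrow> dist (?D u) (?D p) < cmod (?D p) / 2"
    using p unfolding continuous_on_iff by blast
  have "cmod (?D p) / 2 * \<bar>x - y\<bar> \<le> cmod (\<phi> x \<sigma> - \<phi> y \<sigma>)"
    if xy: "x \<in> {0..1} \<inter> ball p \<delta>" "y \<in> {0..1} \<inter> ball p \<delta>" for x y
  proof -
    define f where "f u = \<phi> u \<sigma> - u *\<^sub>R ?D p" for u
    have "cmod (f x - f y) \<le> cmod (?D p) / 2 * \<bar>x - y\<bar>"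
    proof (rule has_vector_derivative_lipschitz[OF _ _ _ xy])
      show "convex ({0..1} \<inter> ball p \<delta>)" by (intro convex_Int) auto
      fix u assume u: "u \<in> {0..1} \<inter> ball p \<delta>"
      have "((\<lambda>u. \<phi> u \<sigma>) has_vector_derivative ?D u) (at u within {0..1} \<inter> ball p \<delta>)"
        using u by (intro has_vector_derivative_within_subset[OF C1_map_derivative[OF C1 s]]) auto
      moreover have "((\<lambda>u. u *\<^sub>R ?D p) has_vector_derivative (1 *\<^sub>R ?D p)) (at u within {0..1} \<inter> ball p \<delta>)"
        by (auto intro!: derivative_eq_intros)
      ultimately show "(f has_vector_derivative ?D u - ?D p) (at u within {0..1} \<inter> ball p \<delta>)"
        unfolding f_def by (auto intro: has_vector_derivative_diff)
      show "cmod (?D u - ?D p) \<le> cmod (?D p) / 2"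
        using \<delta>(2)[of u] u by (auto simp: dist_norm dist_commute intro: less_imp_le)
    qed
    moreover have eq: "\<phi> x \<sigma> - \<phi> y \<sigma> = (f x - f y) + (x - y) *\<^sub>R ?D p"
      by (simp add: f_def algebra_simps)
    moreover have "cmod ((x - y) *\<^sub>R ?D p) - cmod (f x - f y) \<le> cmod ((f x - f y) + (x - y) *\<^sub>R ?D p)"
      using norm_diff_ineq[of "(x - y) *\<^sub>R ?D p" "f x - f y"] by (simp add: add.commute)
    moreover have "cmod ((x - y) *\<^sub>R ?D p) = cmod (?D p) / 2 * \<bar>x - y\<bar> + cmod (?D p) / 2 * \<bar>x - y\<bar>"
      by (simp add: mult.commute)
    ultimately show ?thesis unfolding eq by linarith
  qed
  then show ?thesis using \<delta>(1) by (intro exI[of _ \<delta>] conjI ballI)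
qed

section \<open>Linear forms along the curve\<close>

locale curve =
  fixes S :: "('k::field_char_0 \<Rightarrow> complex) set" and \<phi> :: "real \<Rightarrow> ('k \<Rightarrow> complex) \<Rightarrow> complex"
    and g :: "('k \<Rightarrow> complex) \<Rightarrow> complex^2^2" and d :: nat and L :: real
  assumes K: "number_field TYPE('k)" and S: "embedding_system S"
    and d: "number_field_degree TYPE('k) = d"
    and C1: "C1_map S \<phi>" and g: "g \<in> carrier (SL2_KS S)"
    and L: "L \<ge> 0" "\<And>\<sigma> x y. \<sigma> \<in> S \<Longrightarrow> x \<in> {0..1} \<Longrightarrow> y \<in> {0..1} \<Longrightarrow> cmod (\<phi> x \<sigma> - \<phi> y \<sigma>) \<le> L * \<bar>x - y\<bar>"
begin

lemmas finS = finite_embedding_system[OF K S]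
lemmas rm = embedding_system_ring_map[OF S]

lemma sum_w: "(\<Sum>\<sigma>\<in>S. weight \<sigma>) = d"
  using sum_weight[OF K S] d by simp

definition curve_point :: "real \<Rightarrow> ('k \<Rightarrow> complex) \<Rightarrow> complex^2^2" where
  "curve_point x = g \<otimes>\<^bsub>SL2_KS S\<^esub> unipotent S (\<phi> x)"

lemma curve_point_carrier: "x \<in> {0..1} \<Longrightarrow> curve_point x \<in> carrier (SL2_KS S)"
  unfolding curve_point_def
  using C1 by (intro monoid.m_closed[OF group.is_monoid[OF SL2_KS_group]] g unipotent_carrier) (auto simp: C1_map_def)

definition lin :: "2 \<Rightarrow> real \<Rightarrow> 'k \<times> 'k \<Rightarrow> ('k \<Rightarrow> complex) \<Rightarrow> complex" where
  "lin j x u \<sigma> = linform (curve_point x) j \<sigma> u"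

lemma lin_eq:
  assumes "\<sigma> \<in> S"
  shows lin1: "lin 1 x u \<sigma> = linform g 1 \<sigma> u"
    and lin2: "lin 2 x u \<sigma> = linform g 1 \<sigma> u * \<phi> x \<sigma> + linform g 2 \<sigma> u"
  using assms
  by (simp_all add: lin_def linform_def curve_point_def SL2_KS_mult matrix_mult_2_nth unipotent_def algebra_simps)

definition extent :: "real \<Rightarrow> real \<Rightarrow> 'k \<times> 'k \<Rightarrow> ('k \<Rightarrow> complex) \<Rightarrow> real" where
  "extent t x u \<sigma> = max (exp (- t) * cmod (lin 1 x u \<sigma>)) (exp t * cmod (lin 2 x u \<sigma>))"

lemma extent_nonneg: "extent t x u \<sigma> \<ge> 0"
  by (simp add: extent_def le_max_iff_disj)

definition ht :: "real \<Rightarrow> real \<Rightarrow> 'k \<times> 'k \<Rightarrow> real" where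
  "ht t x u = (\<Prod>\<sigma>\<in>S. extent t x u \<sigma> ^ weight \<sigma>)"

lemma ht_height: "ht t x u = height S (curve_point x) t u"
  by (simp add: ht_def height_def extent_def lin_def)

lemma weighted_prod_mono:
  fixes a b k :: "('k \<Rightarrow> complex) \<Rightarrow> real"
  assumes "\<And>\<sigma>. \<sigma> \<in> S \<Longrightarrow> 0 \<le> k \<sigma>" "\<And>\<sigma>. \<sigma> \<in> S \<Longrightarrow> 0 \<le> a \<sigma>" "\<And>\<sigma>. \<sigma> \<in> S \<Longrightarrow> k \<sigma> * a \<sigma> \<le> b \<sigma>"
  shows "(\<Prod>\<sigma>\<in>S. k \<sigma> ^ weight \<sigma>) * (\<Prod>\<sigma>\<in>S. a \<sigma> ^ weight \<sigma>) \<le> (\<Prod>\<sigma>\<in>S. b \<sigma> ^ weight \<sigma>)"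
proof -
  have "(\<Prod>\<sigma>\<in>S. k \<sigma> ^ weight \<sigma>) * (\<Prod>\<sigma>\<in>S. a \<sigma> ^ weight \<sigma>) = (\<Prod>\<sigma>\<in>S. (k \<sigma> * a \<sigma>) ^ weight \<sigma>)"
    by (simp add: prod.distrib power_mult_distrib)
  also have "\<dots> \<le> (\<Prod>\<sigma>\<in>S. b \<sigma> ^ weight \<sigma>)"
    using assms by (intro prod_mono conjI power_mono zero_le_power mult_nonneg_nonneg) auto
  finally show ?thesis .
qed

lemma weighted_prod_const: "(\<Prod>\<sigma>\<in>S. k ^ weight \<sigma>) = (k :: real) ^ d"
  by (simp only: power_sum[symmetric] sum_w)

lemma weighted_prod_mono_const:
  fixes a b :: "('k \<Rightarrow> complex) \<Rightarrow> real"
  assumes "0 \<le> k" "\<And>\<sigma>. \<sigma> \<in> S \<Longrightarrow> 0 \<le> a \<sigma>" "\<And>\<sigma>. \<sigma> \<in> S \<Longrightarrow> k * a \<sigma> \<le> b \<sigma>"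
  shows "k ^ d * (\<Prod>\<sigma>\<in>S. a \<sigma> ^ weight \<sigma>) \<le> (\<Prod>\<sigma>\<in>S. b \<sigma> ^ weight \<sigma>)"
  using weighted_prod_mono[of "\<lambda>_. k" a b] assms by (simp add: weighted_prod_const)

lemma extent_time:
  assumes "t \<le> t'" "\<sigma> \<in> S"
  shows "exp (- (t' - t)) * extent t x u \<sigma> \<le> extent t' x u \<sigma>"
proof -
  have "exp (- (t' - t)) * (exp (- t) * cmod (lin 1 x u \<sigma>)) = exp (- t') * cmod (lin 1 x u \<sigma>)"
    by (simp flip: mult.assoc exp_add)
  moreover have "exp (- (t' - t)) * (exp t * cmod (lin 2 x u \<sigma>)) \<le> exp t' * cmod (lin 2 x u \<sigma>)"
    using assms(1) by (simp flip: mult.assoc exp_add add: mult_right_mono)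
  moreover have "exp (- (t' - t)) * extent t x u \<sigma> =
      max (exp (- (t' - t)) * (exp (- t) * cmod (lin 1 x u \<sigma>))) (exp (- (t' - t)) * (exp t * cmod (lin 2 x u \<sigma>)))"
    unfolding extent_def by (rule max_mult_distrib_left[of "exp (- (t' - t))", THEN trans]) simp
  ultimately show ?thesis unfolding extent_def by linarith
qed

lemma ht_time:
  assumes "t \<le> t'"
  shows "exp (- (t' - t)) ^ d * ht t x u \<le> ht t' x u"
  unfolding ht_def using extent_time[OF assms] extent_nonneg by (intro weighted_prod_mono_const) auto

text \<open>The entries of \<open>u\<close> are recovered from the two linear forms by Cramer's
  rule, at the cost of a factor \<open>2 * Q\<close>; a nonzero entry is an algebraic integer, of
  norm at least one.\<close>

lemma ht_initial:
  assumes x: "x \<in> {0..1}"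
  shows "\<exists>c>0. \<forall>u. integral_pair u \<longrightarrow> u \<noteq> 0 \<longrightarrow> c \<le> ht 0 x u"
proof -
  let ?h = "curve_point x"
  define Q where "Q = 1 + (\<Sum>\<sigma>\<in>S. \<Sum>i\<in>UNIV. \<Sum>j\<in>UNIV. cmod (?h \<sigma> $ i $ j))"
  have hQ: "cmod (?h \<sigma> $ i $ j) \<le> Q" if "\<sigma> \<in> S" for \<sigma> i j
  proof -
    have "cmod (?h \<sigma> $ i $ j) \<le> (\<Sum>j\<in>UNIV. cmod (?h \<sigma> $ i $ j))" by (rule member_le_sum) auto
    also have "\<dots> \<le> (\<Sum>i\<in>UNIV. \<Sum>j\<in>UNIV. cmod (?h \<sigma> $ i $ j))"
      by (rule member_le_sum) (auto intro: sum_nonneg)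
    also have "\<dots> \<le> (\<Sum>\<sigma>\<in>S. \<Sum>i\<in>UNIV. \<Sum>j\<in>UNIV. cmod (?h \<sigma> $ i $ j))"
      by (rule member_le_sum[OF that]) (auto intro!: sum_nonneg finS)
    finally show ?thesis by (simp add: Q_def)
  qed
  have Q0: "Q > 0" unfolding Q_def by (intro add_pos_nonneg sum_nonneg) auto
  define k where "k = 1 / (2 * Q)"
  have k0: "k > 0" using Q0 by (simp add: k_def)
  have "k ^ d \<le> ht 0 x u" if u: "integral_pair u" "u \<noteq> 0" for u
  proof -
    have dh: "?h \<sigma> $ 1 $ 1 * ?h \<sigma> $ 2 $ 2 - ?h \<sigma> $ 1 $ 2 * ?h \<sigma> $ 2 $ 1 = 1" if "\<sigma> \<in> S" for \<sigma>
      using SL2_KS_coord[OF curve_point_carrier[OF x] that] by (simp add: SL2_carrier det_2)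
    have bd: "k * cmod (a * p - b * q) \<le> extent 0 x u \<sigma>"
      if "cmod p \<le> Q" "cmod q \<le> Q" "cmod a \<le> extent 0 x u \<sigma>" "cmod b \<le> extent 0 x u \<sigma>" for a b p q \<sigma>
    proof -
      have "cmod (a * p - b * q) \<le> cmod (a * p) + cmod (b * q)" by (rule norm_triangle_ineq4)
      also have "\<dots> \<le> extent 0 x u \<sigma> * Q + extent 0 x u \<sigma> * Q"
        unfolding norm_mult using that extent_nonneg Q0 by (intro add_mono mult_mono) auto
      also have "\<dots> = 2 * Q * extent 0 x u \<sigma>" by simp
      finally have "k * cmod (a * p - b * q) \<le> k * (2 * Q * extent 0 x u \<sigma>)"
        using k0 by (intro mult_left_mono) auto
      then show ?thesis using Q0 by (simp add: k_def)
    qed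
    have l: "cmod (lin 1 x u \<sigma>) \<le> extent 0 x u \<sigma>" "cmod (lin 2 x u \<sigma>) \<le> extent 0 x u \<sigma>" for \<sigma>
      by (simp_all add: extent_def)
    have "k * cmod (\<sigma> (fst u)) \<le> extent 0 x u \<sigma> \<and> k * cmod (\<sigma> (snd u)) \<le> extent 0 x u \<sigma>" if s: "\<sigma> \<in> S" for \<sigma>
    proof -
      have "\<sigma> (fst u) * (?h \<sigma> $ 1 $ 1 * ?h \<sigma> $ 2 $ 2 - ?h \<sigma> $ 1 $ 2 * ?h \<sigma> $ 2 $ 1) = lin 1 x u \<sigma> * ?h \<sigma> $ 2 $ 2 - lin 2 x u \<sigma> * ?h \<sigma> $ 2 $ 1"
        "\<sigma> (snd u) * (?h \<sigma> $ 1 $ 1 * ?h \<sigma> $ 2 $ 2 - ?h \<sigma> $ 1 $ 2 * ?h \<sigma> $ 2 $ 1) = lin 2 x u \<sigma> * ?h \<sigma> $ 1 $ 1 - lin 1 x u \<sigma> * ?h \<sigma> $ 1 $ 2"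
        by (simp_all add: lin_def linform_def algebra_simps)
      then have "\<sigma> (fst u) = lin 1 x u \<sigma> * ?h \<sigma> $ 2 $ 2 - lin 2 x u \<sigma> * ?h \<sigma> $ 2 $ 1"
        "\<sigma> (snd u) = lin 2 x u \<sigma> * ?h \<sigma> $ 1 $ 1 - lin 1 x u \<sigma> * ?h \<sigma> $ 1 $ 2"
        unfolding dh[OF s] by simp_all
      then show ?thesis using bd[OF hQ[OF s] hQ[OF s] l] bd[OF hQ[OF s] hQ[OF s] l(2,1)] by simp
    qed
    then have fs: "k ^ d * (\<Prod>\<sigma>\<in>S. cmod (\<sigma> (fst u)) ^ weight \<sigma>) \<le> ht 0 x u"
      "k ^ d * (\<Prod>\<sigma>\<in>S. cmod (\<sigma> (snd u)) ^ weight \<sigma>) \<le> ht 0 x u"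
      unfolding ht_def using k0 by (intro weighted_prod_mono_const; simp)+
    have "fst u \<noteq> 0 \<or> snd u \<noteq> 0" using u(2) by (auto simp: prod_eq_iff)
    then have "1 \<le> (\<Prod>\<sigma>\<in>S. cmod (\<sigma> (fst u)) ^ weight \<sigma>) \<or> 1 \<le> (\<Prod>\<sigma>\<in>S. cmod (\<sigma> (snd u)) ^ weight \<sigma>)"
      using weighted_norm_ge_1[OF K S] u(1) unfolding integral_pair_def by blast
    then have "k ^ d * 1 \<le> k ^ d * (\<Prod>\<sigma>\<in>S. cmod (\<sigma> (fst u)) ^ weight \<sigma>) \<or>
        k ^ d * 1 \<le> k ^ d * (\<Prod>\<sigma>\<in>S. cmod (\<sigma> (snd u)) ^ weight \<sigma>)"
      using k0 by (simp add: mult_left_mono)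
    then show ?thesis using fs by linarith
  qed
  then show ?thesis using k0 by (intro exI[of _ "k ^ d"]) simp
qed

text \<open>The time at which a ball of radius \<open>r\<close> around a point of the curve is seen at unit scale:
  \<open>e\<^sup>-\<^sup>2\<^sup>t = r\<close>.\<close>

definition tm :: "real \<Rightarrow> real" where
  "tm r = - ln r / 2"

lemma exp_tm: "r > 0 \<Longrightarrow> exp (tm r) * r = exp (- tm r)"
proof -
  assume r: "r > 0"
  then have "r = exp (- (2 * tm r))" by (simp add: tm_def)
  then have "exp (tm r) * r = exp (tm r) * exp (- (2 * tm r))" by simp
  then show ?thesis by (simp flip: exp_add)
qed

text \<open>Moving the base point by \<open>2 * r\<close> changes the second form by at most
  \<open>2 * L * r\<close> times the first; after expansion up to time \<open>tm r\<close> this is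
  at most \<open>2 * L\<close> times the contracted first coordinate.\<close>

lemma extent_nearby:
  assumes "r > 0" "\<sigma> \<in> S" "y \<in> {0..1}" "y' \<in> {0..1}" "\<bar>y - y'\<bar> \<le> 2 * r"
  shows "extent (tm r) y u \<sigma> \<le> (1 + 2 * L) * extent (tm r) y' u \<sigma>"
proof -
  let ?t = "tm r" and ?a = "linform g 1 \<sigma> u"
  have s0: "extent ?t y' u \<sigma> \<ge> 0" by (rule extent_nonneg)
  have s1: "exp (- ?t) * cmod ?a \<le> extent ?t y' u \<sigma>" and s2: "exp ?t * cmod (lin 2 y' u \<sigma>) \<le> extent ?t y' u \<sigma>"
    by (simp_all add: extent_def lin1[OF assms(2)])
  have "lin 2 y u \<sigma> = lin 2 y' u \<sigma> + ?a * (\<phi> y \<sigma> - \<phi> y' \<sigma>)"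
    by (simp add: lin2[OF assms(2)] algebra_simps)
  then have "cmod (lin 2 y u \<sigma>) \<le> cmod (lin 2 y' u \<sigma>) + cmod ?a * cmod (\<phi> y \<sigma> - \<phi> y' \<sigma>)"
    by (simp only: norm_mult[symmetric] norm_triangle_ineq)
  also have "\<dots> \<le> cmod (lin 2 y' u \<sigma>) + cmod ?a * (L * (2 * r))"
    using L(2)[OF assms(2-4)] mult_left_mono[OF assms(5) L(1)] by (intro add_left_mono mult_left_mono) auto
  finally have "exp ?t * cmod (lin 2 y u \<sigma>) \<le> exp ?t * (cmod (lin 2 y' u \<sigma>) + cmod ?a * (L * (2 * r)))"
    by (intro mult_left_mono) auto
  also have "\<dots> = exp ?t * cmod (lin 2 y' u \<sigma>) + 2 * L * ((exp ?t * r) * cmod ?a)"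
    by (simp add: algebra_simps)
  also have "\<dots> \<le> extent ?t y' u \<sigma> + 2 * L * extent ?t y' u \<sigma>"
    unfolding exp_tm[OF assms(1)] using s1 s2 L(1) by (intro add_mono mult_left_mono) auto
  finally have "exp ?t * cmod (lin 2 y u \<sigma>) \<le> (1 + 2 * L) * extent ?t y' u \<sigma>" by (simp add: algebra_simps)
  moreover have "exp (- ?t) * cmod (lin 1 y u \<sigma>) \<le> (1 + 2 * L) * extent ?t y' u \<sigma>"
  proof -
    have "(1 + 2 * L) * extent ?t y' u \<sigma> = extent ?t y' u \<sigma> + 2 * (L * extent ?t y' u \<sigma>)"
      by (simp add: algebra_simps)
    then show ?thesis using s1 mult_nonneg_nonneg[OF L(1) s0] unfolding lin1[OF assms(2)] by linarith
  qed
  ultimately show ?thesis by (simp add: extent_def)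
qed

text \<open>At each place the determinant of two vectors is at most \<open>2 * (1 + 2 * L)\<close>
  times the product of their extents at two points of the ball, so the square of this number has to
  stay below the \<open>d\<close>-th power of \<open>1 / (2 * (1 + 2 * L))\<close>.\<close>

definition threshold :: real where
  "threshold = 1 / (2 * (2 * (1 + 2 * L)) ^ d)"

lemma threshold_pos: "threshold > 0"
  using L(1) by (simp add: threshold_def)

text \<open>The outcome is unknown when B moves, so the product is tested at all points of A's
  ball.\<close>

definition dangerous :: "real \<Rightarrow> real \<Rightarrow> 'k \<times> 'k \<Rightarrow> bool" where
  "dangerous x r u \<longleftrightarrow> integral_pair u \<and> u \<noteq> 0 \<and> (\<exists>y\<in>{0..1} \<inter> cball x r. ht (tm r) y u < threshold)"

text \<open>The determinant of two dangerous vectors is an integer of norm less than one.\<close>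

lemma dangerous_collinear:
  assumes r: "r > 0" and u: "dangerous x r u" and v: "dangerous x r v"
  shows "fst u * snd v - snd u * fst v = 0"
proof (rule ccontr)
  let ?\<delta> = "fst u * snd v - snd u * fst v" and ?t = "tm r"
  assume "?\<delta> \<noteq> 0"
  moreover have "algebraic_int ?\<delta>"
    using u v by (auto simp: dangerous_def integral_pair_def intro!: algebraic_int_diff algebraic_int_mult)
  ultimately have ge: "1 \<le> (\<Prod>\<sigma>\<in>S. cmod (\<sigma> ?\<delta>) ^ weight \<sigma>)" by (intro weighted_norm_ge_1[OF K S])
  obtain y where y: "y \<in> {0..1} \<inter> cball x r" "ht ?t y u < threshold" using u by (auto simp: dangerous_def)
  obtain y' where y': "y' \<in> {0..1} \<inter> cball x r" "ht ?t y' v < threshold" using v by (auto simp: dangerous_def)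
  have near: "\<bar>y - y'\<bar> \<le> 2 * r" using y(1) y'(1) by (auto simp: dist_real_def)
  define M where "M = 2 * (1 + 2 * L)"
  have M: "M > 0" using L(1) by (simp add: M_def)
  have b: "1 / M * cmod (\<sigma> ?\<delta>) \<le> extent ?t y u \<sigma> * extent ?t y' v \<sigma>" if s: "\<sigma> \<in> S" for \<sigma>
  proof -
    have dh: "det (curve_point y \<sigma>) = 1"
      using SL2_KS_coord[OF curve_point_carrier s] y(1) by (simp add: SL2_carrier)
    have "\<sigma> ?\<delta> = lin 1 y u \<sigma> * lin 2 y v \<sigma> - lin 2 y u \<sigma> * lin 1 y v \<sigma>"
      unfolding lin_def using linform_det[of \<sigma> "curve_point y" u v, OF rm[OF s] dh] by (rule sym)
    then have "cmod (\<sigma> ?\<delta>) \<le> cmod (lin 1 y u \<sigma> * lin 2 y v \<sigma>) + cmod (lin 2 y u \<sigma> * lin 1 y v \<sigma>)"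
      by (simp only: norm_triangle_ineq4)
    \<comment> \<open>Each term of the determinant has one contracted and one expanded factor, so
      the exponentials cancel.\<close>
    also have "\<dots> = (exp (- ?t) * cmod (lin 1 y u \<sigma>)) * (exp ?t * cmod (lin 2 y v \<sigma>)) +
        (exp ?t * cmod (lin 2 y u \<sigma>)) * (exp (- ?t) * cmod (lin 1 y v \<sigma>))"
      by (simp add: norm_mult exp_minus field_simps)
    also have "\<dots> \<le> extent ?t y u \<sigma> * extent ?t y v \<sigma> + extent ?t y u \<sigma> * extent ?t y v \<sigma>"
      using extent_nonneg by (intro add_mono mult_mono) (auto simp: extent_def)
    also have "\<dots> = 2 * (extent ?t y u \<sigma> * extent ?t y v \<sigma>)" by simp
    \<comment> \<open>The product for \<open>v\<close> is known to be small at \<open>y'\<close>,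
      not at \<open>y\<close>, hence the comparison of nearby base points.\<close>
    also have "\<dots> \<le> 2 * (extent ?t y u \<sigma> * ((1 + 2 * L) * extent ?t y' v \<sigma>))"
      using extent_nearby[OF r s _ _ near, of v] y(1) y'(1) extent_nonneg by (intro mult_left_mono) auto
    also have "\<dots> = M * (extent ?t y u \<sigma> * extent ?t y' v \<sigma>)" by (simp add: M_def)
    finally have "1 / M * cmod (\<sigma> ?\<delta>) \<le> 1 / M * (M * (extent ?t y u \<sigma> * extent ?t y' v \<sigma>))"
      using M by (intro mult_left_mono) auto
    then show ?thesis using M by simp
  qed
  have "(1 / M) ^ d * (\<Prod>\<sigma>\<in>S. cmod (\<sigma> ?\<delta>) ^ weight \<sigma>) \<le> (\<Prod>\<sigma>\<in>S. (extent ?t y u \<sigma> * extent ?t y' v \<sigma>) ^ weight \<sigma>)"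
    using M b by (intro weighted_prod_mono_const) auto
  also have "\<dots> = ht ?t y u * ht ?t y' v" by (simp add: ht_def power_mult_distrib prod.distrib)
  also have "\<dots> \<le> threshold * threshold"
    using y(2) y'(2) threshold_pos unfolding ht_def
    by (intro mult_mono) (auto intro!: prod_nonneg zero_le_power extent_nonneg)
  finally have "(1 / M) ^ d * (\<Prod>\<sigma>\<in>S. cmod (\<sigma> ?\<delta>) ^ weight \<sigma>) \<le> threshold * threshold" .
  moreover have "(1 / M) ^ d * 1 \<le> (1 / M) ^ d * (\<Prod>\<sigma>\<in>S. cmod (\<sigma> ?\<delta>) ^ weight \<sigma>)"
    using ge M by (intro mult_left_mono) auto
  moreover have "threshold * threshold < (1 / M) ^ d"
  proof -
    have "M \<ge> 1" using L(1) by (simp add: M_def)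
    then have M1: "M ^ d \<ge> 1" by simp
    have "threshold * threshold = (1 / M) ^ d * (1 / (4 * M ^ d))"
      unfolding threshold_def M_def[symmetric] by (simp add: power_divide)
    also have "\<dots> < (1 / M) ^ d * 1"
      using M M1 by (intro mult_strict_left_mono) (auto simp: divide_less_eq)
    finally show ?thesis by simp
  qed
  ultimately show False by linarith
qed

text \<open>Depends on the ball alone, as the strategy requires. If there is no dangerous vector the
  value is meaningless, and avoiding it does no harm.\<close>

definition nearest :: "('k \<Rightarrow> complex) \<Rightarrow> real \<Rightarrow> real \<Rightarrow> real" where
  "nearest \<sigma> x r = (SOME z. z \<in> {0..1} \<inter> cball x r \<and>
    (\<forall>y\<in>{0..1} \<inter> cball x r. cmod (lin 2 z (SOME u. dangerous x r u) \<sigma>) \<le> cmod (lin 2 y (SOME u. dangerous x r u) \<sigma>)))"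

text \<open>The point does not depend on the chosen dangerous vector, all of them being proportional.\<close>

lemma nearest_dangerous:
  assumes x: "x \<in> {0..1}" and r: "r > 0" and s: "\<sigma> \<in> S" and u: "dangerous x r u"
  shows "nearest \<sigma> x r \<in> {0..1} \<inter> cball x r \<and>
    (\<forall>y\<in>{0..1} \<inter> cball x r. cmod (lin 2 (nearest \<sigma> x r) u \<sigma>) \<le> cmod (lin 2 y u \<sigma>))"
proof -
  define v where "v = (SOME u. dangerous x r u)"
  have v: "dangerous x r v" unfolding v_def using u by (rule someI)
  let ?I = "{0..1} \<inter> cball x r"
  have "continuous_on {0..1} (\<lambda>y. \<phi> y \<sigma>)"
    using C1 s by (intro differentiable_imp_continuous_on) (simp add: C1_map_def)
  then have "continuous_on ?I (\<lambda>y. \<phi> y \<sigma>)" by (rule continuous_on_subset) simp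
  then have "continuous_on ?I (\<lambda>y. cmod (lin 2 y v \<sigma>))"
    unfolding lin2[OF s] by (intro continuous_intros)
  moreover have "compact ?I" by (intro compact_Int) auto
  moreover have "?I \<noteq> {}" using x r by auto
  ultimately have "\<exists>z\<in>?I. \<forall>y\<in>?I. cmod (lin 2 z v \<sigma>) \<le> cmod (lin 2 y v \<sigma>)"
    using continuous_attains_inf by blast
  then have z: "nearest \<sigma> x r \<in> ?I \<and> (\<forall>y\<in>?I. cmod (lin 2 (nearest \<sigma> x r) v \<sigma>) \<le> cmod (lin 2 y v \<sigma>))"
    unfolding nearest_def v_def[symmetric] Bex_def by (rule someI_ex)
  let ?z = "nearest \<sigma> x r"
  have rs: "ring_map \<sigma>" using rm[OF s] .
  have dg: "det (g \<sigma>) = 1" using SL2_KS_coord[OF g s] by (simp add: SL2_carrier)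
  let ?a = "\<lambda>u. linform g 1 \<sigma> u" and ?b = "\<lambda>u. linform g 2 \<sigma> u"
  have "?a u * ?b v - ?b u * ?a v = 0"
    using linform_det[of \<sigma> g u v, OF rs dg] dangerous_collinear[OF r u v] ring_map_0[OF rs] by simp
  then have ab: "?a u * ?b v = ?b u * ?a v" by simp
  have nz: "?a v \<noteq> 0 \<or> ?b v \<noteq> 0"
  proof (rule ccontr)
    assume "\<not> ?thesis"
    then have "\<sigma> (fst u' * snd v - snd u' * fst v) = 0" for u'
      using linform_det[of \<sigma> g u' v, OF rs dg] by simp
    then have "fst u' * snd v - snd u' * fst v = 0" for u' using ring_map_eq_0[OF rs] by blast
    from this[of "(1, 0)"] this[of "(0, 1)"] have "v = 0" by (simp add: prod_eq_iff)
    then show False using v by (simp add: dangerous_def)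
  qed
  \<comment> \<open>Collinearity over \<open>K\<close> becomes proportionality of the pairs of
    linear forms at \<open>\<sigma>\<close>, so a minimising point for \<open>v\<close> is one for
    \<open>u\<close>.\<close>
  have "\<exists>\<mu>. ?a u = \<mu> * ?a v \<and> ?b u = \<mu> * ?b v"
  proof (cases "?a v = 0")
    case True
    then show ?thesis using nz ab by (intro exI[of _ "?b u / ?b v"]) auto
  next
    case False
    then show ?thesis using ab by (intro exI[of _ "?a u / ?a v"]) (auto simp: field_simps)
  qed
  then obtain \<mu> where "?a u = \<mu> * ?a v" "?b u = \<mu> * ?b v" by blast
  then have "lin 2 y u \<sigma> = \<mu> * lin 2 y v \<sigma>" for y by (simp add: lin2[OF s] algebra_simps)
  then show ?thesis using z by (simp add: norm_mult mult_left_mono)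
qed

text \<open>Between the minimising point and \<open>p\<close> the second form changes by the first
  form times the increment of \<open>\<phi>\<close>, which has size at least
  \<open>\<kappa> * \<alpha> * r\<close>. As the second form is no larger at the minimising point,
  at least half of the change is its size at \<open>p\<close>; \<open>exp_tm\<close> turns
  \<open>r\<close> into the ratio of contraction to expansion.\<close>

lemma expanding_if_avoiding:
  assumes x: "x \<in> {0..1}" and r: "r > 0" and s: "\<sigma> \<in> S" and u: "dangerous x r u"
    and p: "p \<in> {0..1} \<inter> cball x r" and \<alpha>: "\<alpha> * r \<le> \<bar>p - nearest \<sigma> x r\<bar>"
    and \<kappa>: "\<kappa> \<ge> 0" "\<And>y. y \<in> {0..1} \<inter> cball x r \<Longrightarrow> \<kappa> * \<bar>p - y\<bar> \<le> cmod (\<phi> p \<sigma> - \<phi> y \<sigma>)"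
  shows "\<kappa> * \<alpha> / 2 * (exp (- tm r) * cmod (lin 1 p u \<sigma>)) \<le> exp (tm r) * cmod (lin 2 p u \<sigma>)"
proof -
  let ?z = "nearest \<sigma> x r" and ?a = "linform g 1 \<sigma> u"
  have z: "?z \<in> {0..1} \<inter> cball x r" "cmod (lin 2 ?z u \<sigma>) \<le> cmod (lin 2 p u \<sigma>)"
    using nearest_dangerous[OF x r s u] p by blast+
  have "\<kappa> * (\<alpha> * r) \<le> \<kappa> * \<bar>p - ?z\<bar>" using \<alpha> \<kappa>(1) by (rule mult_left_mono)
  also have "\<dots> \<le> cmod (\<phi> p \<sigma> - \<phi> ?z \<sigma>)" using \<kappa>(2)[OF z(1)] .
  finally have "cmod ?a * (\<kappa> * (\<alpha> * r)) \<le> cmod ?a * cmod (\<phi> p \<sigma> - \<phi> ?z \<sigma>)"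
    by (intro mult_left_mono) auto
  also have "\<dots> = cmod (lin 2 p u \<sigma> - lin 2 ?z u \<sigma>)"
    by (simp add: lin2[OF s] right_diff_distrib flip: norm_mult)
  also have "\<dots> \<le> 2 * cmod (lin 2 p u \<sigma>)"
    using norm_triangle_ineq4[of "lin 2 p u \<sigma>" "lin 2 ?z u \<sigma>"] z(2) by linarith
  finally have "exp (tm r) * (cmod ?a * (\<kappa> * (\<alpha> * r))) \<le> exp (tm r) * (2 * cmod (lin 2 p u \<sigma>))"
    by (intro mult_left_mono) auto
  moreover have "exp (tm r) * (cmod ?a * (\<kappa> * (\<alpha> * r))) = \<kappa> * \<alpha> * ((exp (tm r) * r) * cmod ?a)"
    by (simp add: algebra_simps)
  ultimately show ?thesis unfolding exp_tm[OF r] lin1[OF s] by simp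
qed

text \<open>From the time at which a vector is dangerous, the places in \<open>S'\<close> expand it, and they
  outweigh the others.\<close>

lemma ht_after_avoiding:
  assumes S': "S' \<subseteq> S" "d < 2 * (\<Sum>\<sigma>\<in>S'. weight \<sigma>)" and \<eta>: "0 < \<eta>" "\<eta> \<le> 1"
    and exp: "\<And>\<sigma>. \<sigma> \<in> S' \<Longrightarrow> \<eta> * (exp (- T) * cmod (lin 1 p u \<sigma>)) \<le> exp T * cmod (lin 2 p u \<sigma>)"
    and t: "T \<le> t"
  shows "\<eta> ^ d * ht T p u \<le> ht t p u"
proof -
  \<comment> \<open>Exponential rate of the lower bound from time \<open>T\<close> on: on
    \<open>S'\<close> the expanded coordinate dominates up to the factor \<open>\<eta>\<close>,
    elsewhere the worst case is contraction.\<close>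
  define sg where "sg \<sigma> = (if \<sigma> \<in> S' then 1 else - 1 :: real)" for \<sigma>
  define k where "k \<sigma> = \<eta> * exp (sg \<sigma> * (t - T))" for \<sigma>
  have "k \<sigma> * extent T p u \<sigma> \<le> extent t p u \<sigma>" if s: "\<sigma> \<in> S" for \<sigma>
  proof (cases "\<sigma> \<in> S'")
    case True
    have "\<eta> * (exp T * cmod (lin 2 p u \<sigma>)) \<le> 1 * (exp T * cmod (lin 2 p u \<sigma>))"
      using \<eta> by (intro mult_right_mono) auto
    moreover have "\<eta> * extent T p u \<sigma> = \<eta> * (exp (- T) * cmod (lin 1 p u \<sigma>)) \<or>
        \<eta> * extent T p u \<sigma> = \<eta> * (exp T * cmod (lin 2 p u \<sigma>))"
      by (auto simp: extent_def max_def)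
    ultimately have "\<eta> * extent T p u \<sigma> \<le> exp T * cmod (lin 2 p u \<sigma>)" using exp[OF True] by linarith
    then have "exp (t - T) * (\<eta> * extent T p u \<sigma>) \<le> exp (t - T) * (exp T * cmod (lin 2 p u \<sigma>))"
      by (intro mult_left_mono) auto
    also have "\<dots> = exp t * cmod (lin 2 p u \<sigma>)" by (simp flip: mult.assoc exp_add)
    also have "\<dots> \<le> extent t p u \<sigma>" by (simp add: extent_def)
    finally show ?thesis using True by (simp add: k_def sg_def mult.commute mult.left_commute)
  next
    case False
    have "\<eta> * (exp (- (t - T)) * extent T p u \<sigma>) \<le> 1 * (exp (- (t - T)) * extent T p u \<sigma>)"
      using \<eta> extent_nonneg[of T p u \<sigma>] by (intro mult_right_mono) auto
    also have "\<dots> \<le> extent t p u \<sigma>" using extent_time[OF t s, of p u] by simp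
    finally show ?thesis using False by (simp add: k_def sg_def mult.assoc)
  qed
  then have le: "(\<Prod>\<sigma>\<in>S. k \<sigma> ^ weight \<sigma>) * ht T p u \<le> ht t p u"
    unfolding ht_def using \<eta> extent_nonneg by (intro weighted_prod_mono) (auto simp: k_def)
  have "(\<Prod>\<sigma>\<in>S. k \<sigma> ^ weight \<sigma>) = (\<Prod>\<sigma>\<in>S. \<eta> ^ weight \<sigma>) * (\<Prod>\<sigma>\<in>S. exp (sg \<sigma> * (t - T)) ^ weight \<sigma>)"
    by (simp add: k_def power_mult_distrib prod.distrib)
  also have "(\<Prod>\<sigma>\<in>S. exp (sg \<sigma> * (t - T)) ^ weight \<sigma>) = exp ((t - T) * (\<Sum>\<sigma>\<in>S. sg \<sigma> * real (weight \<sigma>)))"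
    using finS by (simp add: exp_sum sum_distrib_left mult.commute mult.left_commute flip: exp_of_nat_mult)
  finally have k: "(\<Prod>\<sigma>\<in>S. k \<sigma> ^ weight \<sigma>) = \<eta> ^ d * exp ((t - T) * (\<Sum>\<sigma>\<in>S. sg \<sigma> * real (weight \<sigma>)))"
    by (simp add: weighted_prod_const)
  \<comment> \<open>The total rate is twice the weight of \<open>S'\<close> minus \<open>d\<close>,
    hence nonnegative.\<close>
  have "(\<Sum>\<sigma>\<in>S. sg \<sigma> * real (weight \<sigma>)) = (\<Sum>\<sigma>\<in>S. 2 * (if \<sigma> \<in> S' then real (weight \<sigma>) else 0) - real (weight \<sigma>))"
    by (intro sum.cong) (auto simp: sg_def)
  also have "\<dots> = 2 * (\<Sum>\<sigma>\<in>S. if \<sigma> \<in> S' then real (weight \<sigma>) else 0) - (\<Sum>\<sigma>\<in>S. real (weight \<sigma>))"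
    by (simp add: sum_subtractf sum_distrib_left)
  also have "(\<Sum>\<sigma>\<in>S. if \<sigma> \<in> S' then real (weight \<sigma>) else 0) = (\<Sum>\<sigma>\<in>S'. real (weight \<sigma>))"
    using finS S'(1) by (simp add: sum.inter_restrict[symmetric] Int_absorb1)
  also have "2 * (\<Sum>\<sigma>\<in>S'. real (weight \<sigma>)) - (\<Sum>\<sigma>\<in>S. real (weight \<sigma>)) = real (2 * (\<Sum>\<sigma>\<in>S'. weight \<sigma>)) - real (\<Sum>\<sigma>\<in>S. weight \<sigma>)"
    by simp
  also have "\<dots> \<ge> 0"
    unfolding sum_w using of_nat_mono[OF less_imp_le[OF S'(2)], where 'a=real] by linarith
  finally have "1 \<le> exp ((t - T) * (\<Sum>\<sigma>\<in>S. sg \<sigma> * real (weight \<sigma>)))" using t by simp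
  moreover have "ht T p u \<ge> 0" unfolding ht_def by (intro prod_nonneg zero_le_power extent_nonneg ballI)
  ultimately have "\<eta> ^ d * ht T p u * 1 \<le> \<eta> ^ d * ht T p u * exp ((t - T) * (\<Sum>\<sigma>\<in>S. sg \<sigma> * real (weight \<sigma>)))"
    using \<eta> by (intro mult_left_mono) auto
  then show ?thesis using le unfolding k by (simp add: mult.commute mult.left_commute)
qed

text \<open>The product is compared with the threshold at the times \<open>T n\<close>, equally
  spaced by \<open>\<Delta>\<close>; between two of them it loses at most a constant factor. If it
  falls below the threshold at some stage, then at the first such stage it still has a lower bound,
  from the stage before or from the initial times, and from there \<open>ht_after_avoiding\<close>
  covers all later times.\<close>

lemma bounded_trajectory_outcome:
  assumes p: "p \<in> {0..1}" and S': "S' \<subseteq> S" "d < 2 * (\<Sum>\<sigma>\<in>S'. weight \<sigma>)"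
    and \<kappa>: "\<kappa> > 0" "\<delta> > 0" "\<And>\<sigma> y. \<sigma> \<in> S' \<Longrightarrow> y \<in> {0..1} \<inter> ball p \<delta> \<Longrightarrow> \<kappa> * \<bar>p - y\<bar> \<le> cmod (\<phi> p \<sigma> - \<phi> y \<sigma>)"
    and q: "0 < q" "q < 1" and \<rho>: "\<rho> > 0" and x: "\<And>n. x n \<in> {0..1}" "\<And>n. p \<in> cball (x n) (q ^ n * \<rho>)"
    and \<alpha>: "\<alpha> > 0" "\<And>n \<sigma>. \<sigma> \<in> S \<Longrightarrow> q ^ n * \<rho> \<le> 1/2 \<Longrightarrow> \<alpha> * (q ^ n * \<rho>) \<le> \<bar>p - nearest \<sigma> (x n) (q ^ n * \<rho>)\<bar>"
  shows "bounded_trajectory S (SL2_OK S #>\<^bsub>SL2_KS S\<^esub> curve_point p)"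
proof -
  define r where "r n = q ^ n * \<rho>" for n
  define T where "T n = tm (r n)" for n
  have r0: "r n > 0" for n using q \<rho> by (simp add: r_def)
  have rdec: "r m \<le> r n" if "n \<le> m" for n m
    unfolding r_def using q \<rho> that by (intro mult_right_mono power_decreasing) auto
  define \<Delta> where "\<Delta> = - ln q / 2"
  have \<Delta>: "\<Delta> > 0" using q by (simp add: \<Delta>_def)
  have T: "T n = T 0 + real n * \<Delta>" for n
    using q \<rho> by (simp add: T_def tm_def r_def \<Delta>_def ln_mult ln_realpow field_simps)
  have "r \<longlonglongrightarrow> 0" unfolding r_def using q by (intro tendsto_mult_left_zero LIMSEQ_realpow_zero) auto
  then have "eventually (\<lambda>n. r n < min (1/2) (\<delta> / 2)) sequentially"
    using \<kappa>(2) by (intro order_tendstoD) auto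
  \<comment> \<open>A radius below 1/2 makes the avoidance hypothesis apply and \<open>T n1\<close>
    nonnegative; a radius below \<open>\<delta> / 2\<close> keeps A's ball where the curve
    expands.\<close>
  then obtain n1 where n1: "r n1 < min (1/2) (\<delta> / 2)" by (auto simp: eventually_sequentially)
  have T1: "T n1 \<ge> 0" using n1 r0[of n1] by (simp add: T_def tm_def)
  obtain c0 where c0: "c0 > 0" "\<And>u. integral_pair u \<Longrightarrow> u \<noteq> 0 \<Longrightarrow> c0 \<le> ht 0 p u"
    using ht_initial[OF p] by blast
  define c1 where "c1 = exp (- T n1) ^ d * c0"
  define c2 where "c2 = exp (- \<Delta>) ^ d * threshold"
  define \<eta> where "\<eta> = min 1 (\<kappa> * \<alpha> / 2)"
  have \<eta>: "0 < \<eta>" "\<eta> \<le> 1" using \<kappa>(1) \<alpha>(1) by (simp_all add: \<eta>_def)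
  \<comment> \<open>\<open>c1\<close> serves the times up to \<open>T n1\<close>, \<open>c2\<close>
    those within one step of a stage above the threshold, the last term those after the first stage
    below it.\<close>
  define c where "c = min c1 (min c2 (\<eta> ^ d * min c1 c2))"
  have c: "c > 0" using c0(1) threshold_pos \<eta> by (simp add: c_def c1_def c2_def)
  have early: "c1 \<le> ht t p u" if "0 \<le> t" "t \<le> T n1" and u: "integral_pair u" "u \<noteq> 0" for t u
  proof -
    have "c1 \<le> exp (- (t - 0)) ^ d * ht 0 p u"
      unfolding c1_def using that c0 by (intro mult_mono power_mono) auto
    then show ?thesis using ht_time[OF that(1), of p u] by linarith
  qed
  have later: "c2 \<le> ht t p u" if "T k \<le> t" "t \<le> T k + \<Delta>" "threshold \<le> ht (T k) p u" for t k u
  proof -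
    have "c2 \<le> exp (- (t - T k)) ^ d * ht (T k) p u"
      unfolding c2_def using that threshold_pos by (intro mult_mono power_mono) auto
    then show ?thesis using ht_time[OF that(1), of p u] by linarith
  qed
  have after: "\<eta> ^ d * ht (T n) p u \<le> ht t p u"
    if n: "n1 \<le> n" and bad: "ht (T n) p u < threshold" and t: "T n \<le> t" and u: "integral_pair u" "u \<noteq> 0" for n t u
  proof (rule ht_after_avoiding[OF S' \<eta> _ t])
    fix \<sigma> assume s: "\<sigma> \<in> S'"
    then have sS: "\<sigma> \<in> S" using S'(1) by blast
    have rn: "r n < 1/2" "2 * r n < \<delta>" using rdec[OF n] n1 by auto
    have pI: "p \<in> {0..1} \<inter> cball (x n) (r n)" using p x(2)[of n] by (simp add: r_def)
    have dan: "dangerous (x n) (r n) u"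
      unfolding dangerous_def using u pI bad unfolding T_def by blast
    have "\<kappa> * \<alpha> / 2 * (exp (- tm (r n)) * cmod (lin 1 p u \<sigma>)) \<le> exp (tm (r n)) * cmod (lin 2 p u \<sigma>)"
    proof (rule expanding_if_avoiding[OF x(1) r0 sS dan pI])
      show "\<alpha> * r n \<le> \<bar>p - nearest \<sigma> (x n) (r n)\<bar>"
        using \<alpha>(2)[OF sS, of n] rn(1) by (simp add: r_def)
      show "0 \<le> \<kappa>" using \<kappa>(1) by simp
      fix y assume y: "y \<in> {0..1} \<inter> cball (x n) (r n)"
      have "dist p y \<le> 2 * r n" using y pI by (auto simp: dist_real_def)
      then have "y \<in> {0..1} \<inter> ball p \<delta>" using y rn(2) by auto
      then show "\<kappa> * \<bar>p - y\<bar> \<le> cmod (\<phi> p \<sigma> - \<phi> y \<sigma>)" by (rule \<kappa>(3)[OF s])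
    qed
    moreover have "\<eta> * (exp (- tm (r n)) * cmod (lin 1 p u \<sigma>)) \<le> \<kappa> * \<alpha> / 2 * (exp (- tm (r n)) * cmod (lin 1 p u \<sigma>))"
      by (intro mult_right_mono) (auto simp: \<eta>_def)
    ultimately show "\<eta> * (exp (- T n) * cmod (lin 1 p u \<sigma>)) \<le> exp (T n) * cmod (lin 2 p u \<sigma>)"
      unfolding T_def by linarith
  qed
  have main: "c \<le> ht t p u" if t: "t \<ge> 0" and u: "integral_pair u" "u \<noteq> 0" for t u
  proof (cases "t \<le> T n1")
    case True
    then show ?thesis using early[OF t True u] by (simp add: c_def)
  next
    case False
    define k where "k = n1 + nat \<lfloor>(t - T n1) / \<Delta>\<rfloor>"
    have "0 \<le> \<lfloor>(t - T n1) / \<Delta>\<rfloor>" using False \<Delta> by simp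
    then have "real k = real n1 + of_int \<lfloor>(t - T n1) / \<Delta>\<rfloor>" by (simp add: k_def)
    then have "real k - real n1 \<le> (t - T n1) / \<Delta>" "(t - T n1) / \<Delta> \<le> real k - real n1 + 1" by linarith+
    then have "(real k - real n1) * \<Delta> \<le> t - T n1" "t - T n1 \<le> (real k - real n1 + 1) * \<Delta>"
      using \<Delta> by (simp_all add: pos_le_divide_eq pos_divide_le_eq)
    then have tk: "T k \<le> t" "t \<le> T k + \<Delta>" using T[of k] T[of n1] by (simp_all add: algebra_simps)
    have k1: "n1 \<le> k" by (simp add: k_def)
    show ?thesis
    proof (cases "\<exists>n. n1 \<le> n \<and> n \<le> k \<and> ht (T n) p u < threshold")
      case False
      then have "threshold \<le> ht (T k) p u" using k1 by (meson linorder_not_less order_refl)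
      then have "c2 \<le> ht t p u" by (rule later[OF tk])
      then show ?thesis by (simp add: c_def min_le_iff_disj)
    next
      case True
      define n where "n = (LEAST n. n1 \<le> n \<and> n \<le> k \<and> ht (T n) p u < threshold)"
      have n: "n1 \<le> n" "n \<le> k" "ht (T n) p u < threshold"
        using LeastI_ex[OF True] unfolding n_def by blast+
      have "min c1 c2 \<le> ht (T n) p u"
      proof (cases "n = n1")
        case True
        then show ?thesis using early[OF T1 order_refl u] by simp
      next
        case False
        then obtain m where m: "n = Suc m" "n1 \<le> m" using n(1) by (cases n) auto
        have "\<not> (n1 \<le> m \<and> m \<le> k \<and> ht (T m) p u < threshold)"
          using not_less_Least[of m "\<lambda>n. n1 \<le> n \<and> n \<le> k \<and> ht (T n) p u < threshold"] m(1) unfolding n_def by simp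
        then have "threshold \<le> ht (T m) p u" using m n(2) by auto
        moreover have "T n = T m + \<Delta>" using T[of "Suc m"] T[of m] m(1) by (simp add: algebra_simps)
        ultimately show ?thesis using later[of m "T n" u] \<Delta> by simp
      qed
      then have "\<eta> ^ d * min c1 c2 \<le> \<eta> ^ d * ht (T n) p u" using \<eta> by (intro mult_left_mono) auto
      also have "\<dots> \<le> ht t p u"
      proof (rule after[OF n(1,3) _ u])
        have "real n * \<Delta> \<le> real k * \<Delta>" using n(2) \<Delta> by (intro mult_right_mono) auto
        then show "T n \<le> t" using tk(1) T[of n] T[of k] by linarith
      qed
      finally show ?thesis by (simp add: c_def min_le_iff_disj)
    qed
  qed
  show ?thesis
    by (rule bounded_trajectory_if_height_bounded[OF K S curve_point_carrier[OF p] c]) (use main in \<open>simp add: ht_height\<close>)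
qed

end

lemma sum_weight_card:
  assumes "finite S'"
  shows "(\<Sum>\<sigma>\<in>S'. weight \<sigma>) = card {\<sigma>\<in>S'. real_valued \<sigma>} + 2 * card {\<sigma>\<in>S'. \<not> real_valued \<sigma>}"
proof -
  have "(\<Sum>\<sigma>\<in>S'. weight \<sigma>) = (\<Sum>\<sigma>\<in>S'. (if real_valued \<sigma> then 1 else 0) + (if \<not> real_valued \<sigma> then 2 else 0))"
    by (intro sum.cong) (auto simp: weight_def)
  also have "\<dots> = card {\<sigma>\<in>S'. real_valued \<sigma>} + 2 * card {\<sigma>\<in>S'. \<not> real_valued \<sigma>}"
    using assms by (simp add: sum.distrib sum.inter_filter[symmetric])
  finally show ?thesis .
qed

theorem theorem1p1:
  fixes S :: "('k::field_char_0 \<Rightarrow> complex) set"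
    and d :: nat
    and \<phi> :: "real \<Rightarrow> ('k \<Rightarrow> complex) \<Rightarrow> complex"
    and g :: "('k \<Rightarrow> complex) \<Rightarrow> complex^2^2"
    and \<Lambda> :: "(('k \<Rightarrow> complex) \<Rightarrow> complex^2^2) set"
  assumes "number_field TYPE('k)"
    and "number_field_degree TYPE('k) = d"
    and "embedding_system S"
    and "C1_map S \<phi>"
    and "finite {x \<in> {0..1}. \<not> (\<exists>S'\<subseteq>S. (\<forall>\<sigma>\<in>S'. coord_deriv \<phi> \<sigma> x \<noteq> 0) \<and>
           card {\<sigma>\<in>S'. real_valued \<sigma>} + 2 * card {\<sigma>\<in>S'. \<not> real_valued \<sigma>} > d div 2)}"
    and "g \<in> carrier (SL2_KS S)"
    and "\<Lambda> = SL2_OK S #>\<^bsub>SL2_KS S\<^esub> g"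
  shows "schmidt_winning {0..1}
           {x \<in> {0..1}. bounded_trajectory S (\<Lambda> #>\<^bsub>SL2_KS S\<^esub> unipotent S (\<phi> x))}
       \<and> hausdorff_dimension
           {x \<in> {0..1}. bounded_trajectory S (\<Lambda> #>\<^bsub>SL2_KS S\<^esub> unipotent S (\<phi> x))} = 1"
proof -
  note K = assms(1) and S = assms(3)
  note finS = finite_embedding_system[OF K S]
  let ?F = "{x \<in> {0..1}. \<not> (\<exists>S'\<subseteq>S. (\<forall>\<sigma>\<in>S'. coord_deriv \<phi> \<sigma> x \<noteq> 0) \<and>
           card {\<sigma>\<in>S'. real_valued \<sigma>} + 2 * card {\<sigma>\<in>S'. \<not> real_valued \<sigma>} > d div 2)}"
  let ?W = "{x \<in> {0..1}. bounded_trajectory S (\<Lambda> #>\<^bsub>SL2_KS S\<^esub> unipotent S (\<phi> x))}"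
  obtain L where L: "L \<ge> 0"
    "\<And>\<sigma> x y. \<sigma> \<in> S \<Longrightarrow> x \<in> {0..1} \<Longrightarrow> y \<in> {0..1} \<Longrightarrow> cmod (\<phi> x \<sigma> - \<phi> y \<sigma>) \<le> L * \<bar>x - y\<bar>"
    by (rule C1_map_lipschitz[OF assms(4) finS]) (rule that, assumption+)
  interpret curve S \<phi> g d L
    using assms L by unfold_locales auto
  have W: "x \<in> ?W" if "x \<in> {0..1}" "bounded_trajectory S (SL2_OK S #>\<^bsub>SL2_KS S\<^esub> curve_point x)" for x
  proof -
    have u: "unipotent S (\<phi> x) \<in> carrier (SL2_KS S)"
      using C1 that(1) by (intro unipotent_carrier) (auto simp: C1_map_def)
    have "\<Lambda> #>\<^bsub>SL2_KS S\<^esub> unipotent S (\<phi> x) = SL2_OK S #>\<^bsub>SL2_KS S\<^esub> curve_point x"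
      unfolding assms(7) curve_point_def
      by (rule group.coset_mult_assoc[OF SL2_KS_group subgroup.subset[OF SL2_OK_subgroup[OF S]] g u])
    then show ?thesis using that by simp
  qed
  define Z where "Z x r = ?F \<union> (\<lambda>\<sigma>. nearest \<sigma> x r) ` S" for x r
  define M where "M = card ?F + card S"
  define \<alpha> where "\<alpha> = 1 / (4 * (real M + 1))"
  have \<alpha>01: "0 < \<alpha>" "\<alpha> < 1"
    by (simp add: \<alpha>_def, unfold \<alpha>_def, subst divide_less_eq_1_pos) auto
  have "alpha_winning {0..1} \<alpha> ?W"
  proof (rule alpha_winning_by_avoidance[where Z = Z and M = M])
    show "finite (Z x r)" for x r using assms(5) finS by (simp add: Z_def)
    show "card (Z x r) \<le> M" for x r
      unfolding Z_def M_def using card_Un_le[of ?F "(\<lambda>\<sigma>. nearest \<sigma> x r) ` S"] card_image_le[OF finS, of "\<lambda>\<sigma>. nearest \<sigma> x r"]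
      by linarith
    show "?W \<subseteq> {0..1}" by blast
    show "\<alpha> = 1 / (4 * (real M + 1))" by (rule \<alpha>_def)
    fix p \<rho> \<beta> :: real and x :: "nat \<Rightarrow> real"
    assume \<rho>: "0 < \<rho>" and \<beta>: "0 < \<beta>" "\<beta> < 1" and p: "p \<in> {0..1}" and x: "\<And>n. x n \<in> {0..1}"
      "\<And>n. p \<in> cball (x n) ((\<alpha> * \<beta>) ^ n * \<rho>)"
      and av: "\<And>n z. (\<alpha> * \<beta>) ^ n * \<rho> \<le> 1/2 \<Longrightarrow> z \<in> Z (x n) ((\<alpha> * \<beta>) ^ n * \<rho>) \<Longrightarrow>
            \<alpha> * ((\<alpha> * \<beta>) ^ n * \<rho>) \<le> \<bar>p - z\<bar>"
    have "\<alpha> * \<beta> < 1 * 1" using \<alpha>01 \<beta> by (intro mult_strict_mono) auto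
    then have q: "0 < \<alpha> * \<beta>" "\<alpha> * \<beta> < 1" using \<alpha>01 \<beta> by simp_all
    have "(\<lambda>n. (\<alpha> * \<beta>) ^ n * \<rho>) \<longlonglongrightarrow> 0"
      using q by (intro tendsto_mult_left_zero LIMSEQ_realpow_zero) auto
    then have "eventually (\<lambda>n. (\<alpha> * \<beta>) ^ n * \<rho> < 1/2) sequentially" by (intro order_tendstoD) auto
    then obtain n where n: "(\<alpha> * \<beta>) ^ n * \<rho> < 1/2" by (auto simp: eventually_sequentially)
    \<comment> \<open>An exceptional \<open>p\<close> would have been avoided at stage
      \<open>n\<close>, hence would have positive distance from itself.\<close>
    have "p \<notin> ?F"
    proof
      assume "p \<in> ?F"
      then have "p \<in> Z (x n) ((\<alpha> * \<beta>) ^ n * \<rho>)" unfolding Z_def by (rule UnI1)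
      then have "\<alpha> * ((\<alpha> * \<beta>) ^ n * \<rho>) \<le> \<bar>p - p\<bar>" using n by (intro av) auto
      moreover have "\<alpha> * ((\<alpha> * \<beta>) ^ n * \<rho>) > 0" using \<alpha>01 q \<rho> by simp
      ultimately show False by simp
    qed
    then obtain S' where S': "S' \<subseteq> S" "\<And>\<sigma>. \<sigma> \<in> S' \<Longrightarrow> coord_deriv \<phi> \<sigma> p \<noteq> 0"
      "d div 2 < card {\<sigma>\<in>S'. real_valued \<sigma>} + 2 * card {\<sigma>\<in>S'. \<not> real_valued \<sigma>}"
      using p by blast
    have fin': "finite S'" using S'(1) finS by (rule finite_subset)
    \<comment> \<open>For integers, exceeding the floor of \<open>d / 2\<close> is the same as
      exceeding \<open>d / 2\<close>.\<close>
    have "d < 2 * Suc (d div 2)" by presburger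
    then have w: "d < 2 * (\<Sum>\<sigma>\<in>S'. weight \<sigma>)"
      unfolding sum_weight_card[OF fin'] using mult_le_mono2[OF Suc_leI[OF S'(3)]] by (rule less_le_trans)
    have "\<forall>\<sigma>\<in>S'. \<exists>\<delta>. \<delta> > 0 \<and> (\<forall>x\<in>{0..1} \<inter> ball p \<delta>. \<forall>y\<in>{0..1} \<inter> ball p \<delta>.
        cmod (coord_deriv \<phi> \<sigma> p) / 2 * \<bar>x - y\<bar> \<le> cmod (\<phi> x \<sigma> - \<phi> y \<sigma>))"
      using C1_map_expanding[OF C1 _ p] S'(1,2) by blast
    then have "\<exists>\<delta>. \<forall>\<sigma>\<in>S'. \<delta> \<sigma> > 0 \<and> (\<forall>x\<in>{0..1} \<inter> ball p (\<delta> \<sigma>). \<forall>y\<in>{0..1} \<inter> ball p (\<delta> \<sigma>).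
        cmod (coord_deriv \<phi> \<sigma> p) / 2 * \<bar>x - y\<bar> \<le> cmod (\<phi> x \<sigma> - \<phi> y \<sigma>))"
      by (rule bchoice)
    then obtain \<delta>' where \<delta>': "\<forall>\<sigma>\<in>S'. \<delta>' \<sigma> > 0 \<and> (\<forall>x\<in>{0..1} \<inter> ball p (\<delta>' \<sigma>). \<forall>y\<in>{0..1} \<inter> ball p (\<delta>' \<sigma>).
        cmod (coord_deriv \<phi> \<sigma> p) / 2 * \<bar>x - y\<bar> \<le> cmod (\<phi> x \<sigma> - \<phi> y \<sigma>))"
      by (rule exE)
    define \<delta> where "\<delta> = Min (insert 1 (\<delta>' ` S'))"
    define \<kappa> where "\<kappa> = Min (insert 1 ((\<lambda>\<sigma>. cmod (coord_deriv \<phi> \<sigma> p) / 2) ` S'))"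
    have \<delta>: "\<delta> > 0" "\<And>\<sigma>. \<sigma> \<in> S' \<Longrightarrow> \<delta> \<le> \<delta>' \<sigma>" using fin' \<delta>' by (auto simp: \<delta>_def)
    have \<kappa>: "\<kappa> > 0" "\<And>\<sigma>. \<sigma> \<in> S' \<Longrightarrow> \<kappa> \<le> cmod (coord_deriv \<phi> \<sigma> p) / 2"
      subgoal using fin' S'(2) by (simp add: \<kappa>_def)
      subgoal unfolding \<kappa>_def using fin' by (intro Min_le) auto
      done
    have "bounded_trajectory S (SL2_OK S #>\<^bsub>SL2_KS S\<^esub> curve_point p)"
    proof (rule bounded_trajectory_outcome[OF p S'(1) w \<kappa>(1) \<delta>(1) _ q \<rho> x \<alpha>01(1)])
      fix \<sigma> y assume s: "\<sigma> \<in> S'" and y: "y \<in> {0..1} \<inter> ball p \<delta>"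
      have "\<kappa> * \<bar>p - y\<bar> \<le> cmod (coord_deriv \<phi> \<sigma> p) / 2 * \<bar>p - y\<bar>"
        using \<kappa>(2)[OF s] by (intro mult_right_mono) auto
      also have "\<dots> \<le> cmod (\<phi> p \<sigma> - \<phi> y \<sigma>)"
      proof -
        have "p \<in> {0..1} \<inter> ball p (\<delta>' \<sigma>)" "y \<in> {0..1} \<inter> ball p (\<delta>' \<sigma>)"
          using p y \<delta>(1) \<delta>(2)[OF s] by auto
        then show ?thesis using bspec[OF \<delta>' s] by blast
      qed
      finally show "\<kappa> * \<bar>p - y\<bar> \<le> cmod (\<phi> p \<sigma> - \<phi> y \<sigma>)" .
    next
      fix n \<sigma> assume "\<sigma> \<in> S" "(\<alpha> * \<beta>) ^ n * \<rho> \<le> 1/2"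
      then show "\<alpha> * ((\<alpha> * \<beta>) ^ n * \<rho>) \<le> \<bar>p - nearest \<sigma> (x n) ((\<alpha> * \<beta>) ^ n * \<rho>)\<bar>"
        by (intro av) (simp_all add: Z_def)
    qed
    then show "p \<in> ?W" by (rule W[OF p])
  qed
  then have "schmidt_winning {0..1} ?W" using \<alpha>01 unfolding schmidt_winning_def by blast
  then show ?thesis using winning_hausdorff_dimension by blast
qed

end
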